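(* Let $V$ be a finite set of vertices and fix $(K,\omega,\mu)$ as in the context. Suppose that for each DAG $G$ with vertices $V$ there exists a faithful Bayesian network in $\mathrm{BN}_G^{\mathrm{eqb}}$. Then every constraint-based causal discovery algorithm that is sound under the assumption of faithfulness, when combined with consistent conditional independence tests for the set of observational distributions induced by $\mathrm{BN}^{\mathrm{eqb}}$ (such tests exist), is consistent on an open and dense domain in $\mathrm{BN}^{\mathrm{eqb}}$; that is, there is an open and dense set $O\subseteq\mathrm{BN}^{\mathrm{eqb}}$ such that the algorithm is consistent at every $(G,m)\in O$.
   Context: A DAG $G=(V,E)$ has no directed cycles; $\mathrm{pa}_G(v)=\{w: w\to v\in E\}$. The ancestors of $v$ are $v$ itself and all $w$ with a directed path from $w$ to $v$; an ancestor of a set $C$ is an ancestor of some element of $C$. A collider on a path is a vertex $v$ with $\cdots\to v\leftarrow\cdots$ on the path; other vertices of the path (including endpoints) are non-colliders. For (not necessarily disjoint) $A,B,C\subseteq V$, $A\perp^d_G B\mid C$ means that every path between some $a\in A$ and some $b\in B$ contains a collider that is not an ancestor of $C$, or a non-collider in $C$; for $a=b$ the trivial path $a$ counts as a path, blocked precisely when $a\in C$. $A\not\perp^d_G B\mid C$ is the negation. For each $v\in V$, $\mathcal X_v$ is a separable complete metric space with at least two points and its Borel $\sigma$-algebra; $\mathcal X_A=\prod_{v\in A}\mathcal X_v$ carries the Euclidean product metric $d(x,x')=(\sum_{v\in A}d_v(x_v,x_v')^2)^{1/2}$. $X_A\perp\!\!\!\perp_{\mathbb P}X_B\mid X_C$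 means $\mathbb P(X_A\in E_A,X_B\in E_B\mid X_C)=\mathbb P(X_A\in E_A\mid X_C)\mathbb P(X_B\in E_B\mid X_C)$ a.s. for all Borel $E_A,E_B$. $M_G$ is the set of Borel probability measures $\mathbb P$ on $\mathcal X_V$ with $A\perp^d_G B\mid C\Rightarrow X_A\perp\!\!\!\perp_{\mathbb P}X_B\mid X_C$ for all $A,B,C\subseteq V$; $F_G$ is the set of $\mathbb P\in M_G$ such that $A\not\perp^d_G B\mid C$ implies that $X_A\perp\!\!\!\perp_{\mathbb P}X_B\mid X_C$ fails, for all $A,B,C\subseteq V$. $\mathrm{BN}_G$ is the set of tuples $(\mathbb P(X_v\mid X_{\mathrm{pa}_G(v)}))_{v\in V}$ of Markov kernels; $D$ sends a tuple $m$ to its observational distribution $\bigotimes_v\mathbb P(X_v\mid X_{\mathrm{pa}_G(v)})\in M_G$; $m$ is faithful if $D(m)\in F_G$. With $d_{TV}$ the total variation metric $\sup_E|\mathbb P(E)-\mathbb Q(E)|$, $d_{TV}^\circ(m,m')=\sum_{v}\sup_{x_{\mathrm{pa}_G(v)}}d_{TV}(\mathbb P_m(X_v\mid x_{\mathrm{pa}_G(v)}),\mathbb P_{m'}(X_v\mid x_{\mathrm{pa}_G(v)}))$. A modulus of continuity is a nonzero concave function $\omega:[0,\infty)\to[0,\infty)$ with $\lim_{t\downarrow0}\omega(t)=\omega(0)=0$; $f$ admits $\omega$ if $|f(x)-f(x')|\le\omega(d(x,x'))$. Fix $K>0$, a modulus $\omega$ and locally finite measures $\mu_v$ on $\mathcal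 X_v$, $\mu=\bigotimes_v\mu_v$. $\mathrm{BN}_G^{\mathrm{eqb}}\subseteq\mathrm{BN}_G$ consists of the Bayesian networks such that each kernel has a conditional density $(x_v,x_{\mathrm{pa}_G(v)})\mapsto p(x_v\mid x_{\mathrm{pa}_G(v)})$ with respect to $\mu_v$ that is bounded by $K$ and admits the modulus $\omega$. $\mathrm{BN}^{\mathrm{eqb}}=\bigcup_G\{G\}\times\mathrm{BN}_G^{\mathrm{eqb}}$, the union over all DAGs $G$ with vertices $V$, equipped with the metric $\delta+d_{TV}^\circ$, $\delta$ the discrete metric on DAGs (kernels of different graphs being compared as functions of all of $x_V$); its topology is the disjoint union topology of the spaces $(\mathrm{BN}_G^{\mathrm{eqb}},d_{TV}^\circ)$. Consistent tests: with $\mathcal P$ the set of observational distributions $D(m)$, $(G,m)\in\mathrm{BN}^{\mathrm{eqb}}$, a consistent conditional independence test for $(A,B,C)$ is a sequence of measurable maps $\varphi_n:\mathcal X_V^n\to\{0,1\}$ such that for every $\mathbb P\in\mathcal P$, $\lim_n\mathbb P^n(\varphi_n=0)=1$ iff $X_A\perp\!\!\!\perp_{\mathbb P}X_B\mid X_C$, and $\lim_n\mathbb P^n(\varphi_n=1)=1$ iff this conditional independence fails. Constraint-based algorithm: a map $f$ assigning to each set $I$ of triples $(A,B,C)$ of subsets of $V$ (the conditional independencies judged to hold) an output $f(I)$ in a set $\mathcal Y$, where for each DAG $G$ a set of correct conclusions $R(G)\subseteq\mathcal Y$ is specified. It is sound under faithfulness if, given a conditional independence oracle, it is correct: $f(\{(A,B,C):X_A\perp\!\!\!\perp_{\mathbb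 P}X_B\mid X_C\})\in R(G)$ for every DAG $G$ and every $\mathbb P\in F_G$. Combined with tests $\varphi_n^{A,B,C}$, it outputs $\hat f_n=f(\{(A,B,C):\varphi_n^{A,B,C}=0\})$ from $n$ i.i.d. observations; it is consistent at $(G,m)$ if $\mathbb P^n(\hat f_n\in R(G))\to1$ as $n\to\infty$, with $\mathbb P=D(m)$. *)

theory Defs
  imports "HOL-Probability.Probability"
begin

section \<open>Directed acyclic graphs and d-separation\<close>

text \<open>A graph on the vertex set \<open>V\<close> is given by its edge set; \<open>(w, v) \<in> E\<close> stands for the edge
  from \<open>w\<close> to \<open>v\<close>.\<close>

definition dag :: "'v set \<Rightarrow> ('v \<times> 'v) set \<Rightarrow> bool" where
  "dag V E \<longleftrightarrow> E \<subseteq> V \<times> V \<and> acyclic E"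

definition parents :: "('v \<times> 'v) set \<Rightarrow> 'v \<Rightarrow> 'v set" where
  "parents E v = {w. (w, v) \<in> E}"

definition ancestors :: "('v \<times> 'v) set \<Rightarrow> 'v set \<Rightarrow> 'v set" where
  "ancestors E C = {w. \<exists>c\<in>C. (w, c) \<in> E\<^sup>*}"

text \<open>Two vertices of a DAG are joined by at most one edge, so a path is determined by its vertices.
  Paths do not repeat vertices; in particular the only path from \<open>a\<close> to \<open>a\<close> is \<open>[a]\<close>.\<close>

definition path_between :: "('v \<times> 'v) set \<Rightarrow> 'v \<Rightarrow> 'v \<Rightarrow> 'v list \<Rightarrow> bool" where
  "path_between E a b p \<longleftrightarrow> p \<noteq> [] \<and> hd p = a \<and> last p = b \<and> distinct p \<and>
     (\<forall>i. Suc i < length p \<longrightarrow> (p ! i, p ! Suc i) \<in> E \<or> (p ! Suc i, p ! i) \<in> E)"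

definition collider_at :: "('v \<times> 'v) set \<Rightarrow> 'v list \<Rightarrow> nat \<Rightarrow> bool" where
  "collider_at E p i \<longleftrightarrow>
     0 < i \<and> Suc i < length p \<and> (p ! (i - 1), p ! i) \<in> E \<and> (p ! Suc i, p ! i) \<in> E"

definition d_sep :: "('v \<times> 'v) set \<Rightarrow> 'v set \<Rightarrow> 'v set \<Rightarrow> 'v set \<Rightarrow> bool" where
  "d_sep E A B C \<longleftrightarrow> (\<forall>a\<in>A. \<forall>b\<in>B. \<forall>p. path_between E a b p \<longrightarrow>
     (\<exists>i<length p. collider_at E p i \<and> p ! i \<notin> ancestors E C \<or>
                   \<not> collider_at E p i \<and> p ! i \<in> C))"

section \<open>State spaces\<close>

text \<open>The spaces are carried by one type \<open>'x\<close>; this is no restriction, since \<open>'x\<close> is arbitrary and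
  every \<open>X v\<close> has its own underlying set and metric.\<close>

definition polish_state_space :: "'x metric \<Rightarrow> bool" where
  "polish_state_space S \<longleftrightarrow> mcomplete_of S \<and> separable_space (mtopology_of S) \<and>
     (\<exists>x\<in>mspace S. \<exists>y\<in>mspace S. x \<noteq> y)"

definition borel_metric :: "'x metric \<Rightarrow> 'x measure" where
  "borel_metric S = sigma (mspace S) {U. openin (mtopology_of S) U}"

text \<open>Elements of the product are extensional functions on \<open>A\<close>. As the factors are separable and
  \<open>A\<close> is finite in all uses, the product \<sigma>-algebra is the Borel \<sigma>-algebra of \<open>prod_dist_on X A\<close>.\<close>

definition prod_space :: "('v \<Rightarrow> 'x metric) \<Rightarrow> 'v set \<Rightarrow> ('v \<Rightarrow> 'x) measure" where
  "prod_space X A = Pi\<^sub>M A (\<lambda>v. borel_metric (X v))"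

definition prod_dist_on :: "('v \<Rightarrow> 'x metric) \<Rightarrow> 'v set \<Rightarrow> ('v \<Rightarrow> 'x) \<Rightarrow> ('v \<Rightarrow> 'x) \<Rightarrow> real" where
  "prod_dist_on X A x y = L2_set (\<lambda>v. mdist (X v) (x v) (y v)) A"

definition locally_finite_on :: "'x metric \<Rightarrow> 'x measure \<Rightarrow> bool" where
  "locally_finite_on S \<mu> \<longleftrightarrow> sets \<mu> = sets (borel_metric S) \<and>
     (\<forall>x\<in>mspace S. \<exists>U. openin (mtopology_of S) U \<and> x \<in> U \<and> emeasure \<mu> U < \<infinity>)"

section \<open>Conditional independence, Markov property and faithfulness\<close>

definition cond_indep ::
  "('v \<Rightarrow> 'x metric) \<Rightarrow> ('v \<Rightarrow> 'x) measure \<Rightarrow> 'v set \<Rightarrow> 'v set \<Rightarrow> 'v set \<Rightarrow> bool" where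
  "cond_indep X P A B C \<longleftrightarrow>
     (let F = vimage_algebra (space P) (\<lambda>x. restrict x C) (prod_space X C) in
      \<forall>S\<in>sets (prod_space X A). \<forall>T\<in>sets (prod_space X B). AE x in P.
        real_cond_exp P F (indicator {y\<in>space P. restrict y A \<in> S \<and> restrict y B \<in> T}) x =
        real_cond_exp P F (indicator {y\<in>space P. restrict y A \<in> S}) x *
        real_cond_exp P F (indicator {y\<in>space P. restrict y B \<in> T}) x)"

definition markov_measures ::
  "('v \<Rightarrow> 'x metric) \<Rightarrow> 'v set \<Rightarrow> ('v \<times> 'v) set \<Rightarrow> ('v \<Rightarrow> 'x) measure set" where
  "markov_measures X V E = {P \<in> space (prob_algebra (prod_space X V)).
     \<forall>A B C. A \<subseteq> V \<longrightarrow> B \<subseteq> V \<longrightarrow> C \<subseteq> V \<longrightarrow> d_sep E A B C \<longrightarrow> cond_indep X P A B C}"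

definition faithful_measures ::
  "('v \<Rightarrow> 'x metric) \<Rightarrow> 'v set \<Rightarrow> ('v \<times> 'v) set \<Rightarrow> ('v \<Rightarrow> 'x) measure set" where
  "faithful_measures X V E = {P \<in> markov_measures X V E.
     \<forall>A B C. A \<subseteq> V \<longrightarrow> B \<subseteq> V \<longrightarrow> C \<subseteq> V \<longrightarrow> \<not> d_sep E A B C \<longrightarrow> \<not> cond_indep X P A B C}"

section \<open>Bayesian networks\<close>

type_synonym ('v, 'x) kernels = "'v \<Rightarrow> ('v \<Rightarrow> 'x) \<Rightarrow> 'x measure"

text \<open>Extensionality makes two networks equal iff their kernels agree at all arguments.\<close>

definition bayes_nets ::
  "('v \<Rightarrow> 'x metric) \<Rightarrow> 'v set \<Rightarrow> ('v \<times> 'v) set \<Rightarrow> ('v, 'x) kernels set" where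
  "bayes_nets X V E = {m \<in> extensional V. \<forall>v\<in>V.
     m v \<in> extensional (space (prod_space X (parents E v))) \<and>
     m v \<in> prod_space X (parents E v) \<rightarrow>\<^sub>M prob_algebra (borel_metric (X v))}"

text \<open>The product of the kernels along a list in which parents occur later than their children. The
  result for a DAG does not depend on the chosen topological order.\<close>

primrec kernel_product ::
  "('v \<Rightarrow> 'x metric) \<Rightarrow> ('v \<times> 'v) set \<Rightarrow> ('v, 'x) kernels \<Rightarrow> 'v list \<Rightarrow> ('v \<Rightarrow> 'x) measure" where
  "kernel_product X E m [] = return (prod_space X {}) (\<lambda>_. undefined)"
| "kernel_product X E m (v # vs) =
     kernel_product X E m vs \<bind>
       (\<lambda>x. distr (m v (restrict x (parents E v))) (prod_space X (set (v # vs))) (\<lambda>y. x(v := y)))"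

definition reverse_topological_order :: "'v set \<Rightarrow> ('v \<times> 'v) set \<Rightarrow> 'v list \<Rightarrow> bool" where
  "reverse_topological_order V E vs \<longleftrightarrow> set vs = V \<and> distinct vs \<and>
     (\<forall>i<length vs. \<forall>j<length vs. (vs ! i, vs ! j) \<in> E \<longrightarrow> j < i)"

definition obs_dist ::
  "('v \<Rightarrow> 'x metric) \<Rightarrow> 'v set \<Rightarrow> ('v \<times> 'v) set \<Rightarrow> ('v, 'x) kernels \<Rightarrow> ('v \<Rightarrow> 'x) measure" where
  "obs_dist X V E m = kernel_product X E m (SOME vs. reverse_topological_order V E vs)"

definition faithful_net ::
  "('v \<Rightarrow> 'x metric) \<Rightarrow> 'v set \<Rightarrow> ('v \<times> 'v) set \<Rightarrow> ('v, 'x) kernels \<Rightarrow> bool" where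
  "faithful_net X V E m \<longleftrightarrow> obs_dist X V E m \<in> faithful_measures X V E"

definition modulus_of_continuity :: "(real \<Rightarrow> real) \<Rightarrow> bool" where
  "modulus_of_continuity \<omega> \<longleftrightarrow> concave_on {0..} \<omega> \<and> (\<forall>t\<ge>0. 0 \<le> \<omega> t) \<and> (\<exists>t\<ge>0. \<omega> t \<noteq> 0) \<and>
     \<omega> 0 = 0 \<and> (\<omega> \<longlongrightarrow> 0) (at_right 0)"

text \<open>The density \<open>p\<close> is a function on the product over \<open>v\<close> and its parents.\<close>

definition bayes_nets_eqb ::
  "('v \<Rightarrow> 'x metric) \<Rightarrow> 'v set \<Rightarrow> ('v \<Rightarrow> 'x measure) \<Rightarrow> real \<Rightarrow> (real \<Rightarrow> real) \<Rightarrow> ('v \<times> 'v) set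
    \<Rightarrow> ('v, 'x) kernels set" where
  "bayes_nets_eqb X V \<mu> K \<omega> E = {m \<in> bayes_nets X V E. \<forall>v\<in>V.
     \<exists>p :: ('v \<Rightarrow> 'x) \<Rightarrow> real.
       (\<forall>x\<in>space (prod_space X (insert v (parents E v))). 0 \<le> p x \<and> p x \<le> K) \<and>
       (\<forall>x\<in>space (prod_space X (insert v (parents E v))).
        \<forall>y\<in>space (prod_space X (insert v (parents E v))).
          \<bar>p x - p y\<bar> \<le> \<omega> (prod_dist_on X (insert v (parents E v)) x y)) \<and>
       (\<forall>x\<in>space (prod_space X (parents E v)).
          m v x = density (\<mu> v) (\<lambda>y. ennreal (p (x(v := y)))))}"

definition BN_eqb ::
  "('v \<Rightarrow> 'x metric) \<Rightarrow> 'v set \<Rightarrow> ('v \<Rightarrow> 'x measure) \<Rightarrow> real \<Rightarrow> (real \<Rightarrow> real)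
    \<Rightarrow> (('v \<times> 'v) set \<times> ('v, 'x) kernels) set" where
  "BN_eqb X V \<mu> K \<omega> = Sigma {E. dag V E} (bayes_nets_eqb X V \<mu> K \<omega>)"

definition tv_dist :: "'x measure \<Rightarrow> 'x measure \<Rightarrow> real" where
  "tv_dist P Q = (SUP S\<in>sets P. \<bar>measure P S - measure Q S\<bar>)"

text \<open>Kernels are compared as functions of all coordinates. Since the product over \<open>V\<close> is nonempty,
  for equal graphs this is the supremum over the parent configurations.\<close>

definition tv_circ ::
  "('v \<Rightarrow> 'x metric) \<Rightarrow> 'v set \<Rightarrow> ('v \<times> 'v) set \<times> ('v, 'x) kernels
    \<Rightarrow> ('v \<times> 'v) set \<times> ('v, 'x) kernels \<Rightarrow> real" where
  "tv_circ X V = (\<lambda>(E, m) (E', m'). \<Sum>v\<in>V. SUP x\<in>space (prod_space X V).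
     tv_dist (m v (restrict x (parents E v))) (m' v (restrict x (parents E' v))))"

text \<open>The value 0 off the carrier is immaterial; \<open>Metric_space\<close> asks for nonnegativity and symmetry on
  the whole type.\<close>

definition BN_eqb_dist ::
  "('v \<Rightarrow> 'x metric) \<Rightarrow> 'v set \<Rightarrow> ('v \<Rightarrow> 'x measure) \<Rightarrow> real \<Rightarrow> (real \<Rightarrow> real)
    \<Rightarrow> ('v \<times> 'v) set \<times> ('v, 'x) kernels \<Rightarrow> ('v \<times> 'v) set \<times> ('v, 'x) kernels \<Rightarrow> real" where
  "BN_eqb_dist X V \<mu> K \<omega> g h =
     (if g \<in> BN_eqb X V \<mu> K \<omega> \<and> h \<in> BN_eqb X V \<mu> K \<omega>
      then (if fst g = fst h then 0 else 1) + tv_circ X V g h else 0)"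

definition BN_eqb_topology ::
  "('v \<Rightarrow> 'x metric) \<Rightarrow> 'v set \<Rightarrow> ('v \<Rightarrow> 'x measure) \<Rightarrow> real \<Rightarrow> (real \<Rightarrow> real)
    \<Rightarrow> (('v \<times> 'v) set \<times> ('v, 'x) kernels) topology" where
  "BN_eqb_topology X V \<mu> K \<omega> =
     Metric_space.mtopology (BN_eqb X V \<mu> K \<omega>) (BN_eqb_dist X V \<mu> K \<omega>)"

definition obs_dists_eqb ::
  "('v \<Rightarrow> 'x metric) \<Rightarrow> 'v set \<Rightarrow> ('v \<Rightarrow> 'x measure) \<Rightarrow> real \<Rightarrow> (real \<Rightarrow> real)
    \<Rightarrow> ('v \<Rightarrow> 'x) measure set" where
  "obs_dists_eqb X V \<mu> K \<omega> = (\<lambda>(E, m). obs_dist X V E m) ` BN_eqb X V \<mu> K \<omega>"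

section \<open>Tests and constraint-based algorithms\<close>

abbreviation iid :: "'s measure \<Rightarrow> nat \<Rightarrow> (nat \<Rightarrow> 's) measure" where
  "iid P n \<equiv> Pi\<^sub>M {..<n} (\<lambda>_. P)"

text \<open>The test value 0 is the decision that the conditional independence holds.\<close>

definition consistent_ci_test ::
  "('v \<Rightarrow> 'x metric) \<Rightarrow> 'v set \<Rightarrow> ('v \<Rightarrow> 'x) measure set \<Rightarrow> 'v set \<Rightarrow> 'v set \<Rightarrow> 'v set
    \<Rightarrow> (nat \<Rightarrow> (nat \<Rightarrow> 'v \<Rightarrow> 'x) \<Rightarrow> nat) \<Rightarrow> bool" where
  "consistent_ci_test X V \<P> A B C \<phi> \<longleftrightarrow>
     (\<forall>n. \<phi> n \<in> iid (prod_space X V) n \<rightarrow>\<^sub>M count_space {0, 1}) \<and>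
     (\<forall>P\<in>\<P>.
        ((\<lambda>n. measure (iid P n) {s\<in>space (iid P n). \<phi> n s = 0}) \<longlonglongrightarrow> 1
           \<longleftrightarrow> cond_indep X P A B C) \<and>
        ((\<lambda>n. measure (iid P n) {s\<in>space (iid P n). \<phi> n s = 1}) \<longlonglongrightarrow> 1
           \<longleftrightarrow> \<not> cond_indep X P A B C))"

definition triples :: "'v set \<Rightarrow> ('v set \<times> 'v set \<times> 'v set) set" where
  "triples V = Pow V \<times> Pow V \<times> Pow V"

definition sound_under_faithfulness ::
  "('v \<Rightarrow> 'x metric) \<Rightarrow> 'v set \<Rightarrow> (('v set \<times> 'v set \<times> 'v set) set \<Rightarrow> 'y)
    \<Rightarrow> (('v \<times> 'v) set \<Rightarrow> 'y set) \<Rightarrow> bool" where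
  "sound_under_faithfulness X V f R \<longleftrightarrow> (\<forall>E. dag V E \<longrightarrow>
     (\<forall>P\<in>faithful_measures X V E. f {(A, B, C) \<in> triples V. cond_indep X P A B C} \<in> R E))"

definition consistent_at ::
  "('v \<Rightarrow> 'x metric) \<Rightarrow> 'v set \<Rightarrow> (('v set \<times> 'v set \<times> 'v set) set \<Rightarrow> 'y)
    \<Rightarrow> (('v \<times> 'v) set \<Rightarrow> 'y set)
    \<Rightarrow> ('v set \<Rightarrow> 'v set \<Rightarrow> 'v set \<Rightarrow> nat \<Rightarrow> (nat \<Rightarrow> 'v \<Rightarrow> 'x) \<Rightarrow> nat)
    \<Rightarrow> ('v \<times> 'v) set \<Rightarrow> ('v, 'x) kernels \<Rightarrow> bool" where
  "consistent_at X V f R \<phi> E m \<longleftrightarrow>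
     (let P = obs_dist X V E m in
      (\<lambda>n. measure (iid P n)
        {s\<in>space (iid P n). f {(A, B, C) \<in> triples V. \<phi> A B C n s = 0} \<in> R E}) \<longlonglongrightarrow> 1)"

section \<open>The metric on networks and the observational distribution are well-defined\<close>

lemma space_borel_metric: "space (borel_metric S) = mspace S"
  unfolding borel_metric_def by (rule space_measure_of)
    (use openin_subset[of "mtopology_of S"] in auto)

lemma tv_dist_bdd: assumes "prob_space P" "prob_space Q"
  shows "bdd_above ((\<lambda>S. \<bar>measure P S - measure Q S\<bar>) ` A)"
    and "\<bar>measure P S - measure Q S\<bar> \<le> 1"
proof -
  have *: "\<bar>measure P S - measure Q S\<bar> \<le> 1" for S
    using prob_space.prob_le_1[OF assms(1), of S] prob_space.prob_le_1[OF assms(2), of S]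
      measure_nonneg[of P S] measure_nonneg[of Q S] by linarith
  show "bdd_above ((\<lambda>S. \<bar>measure P S - measure Q S\<bar>) ` A)"
    using * by (intro bdd_aboveI[of _ 1]) auto
  show "\<bar>measure P S - measure Q S\<bar> \<le> 1" by (rule *)
qed

lemma tv_dist_bounds: assumes "prob_space P" "prob_space Q" shows "tv_dist P Q \<le> 1" "0 \<le> tv_dist P Q"
proof -
  have ne: "sets P \<noteq> {}" by blast
  show "tv_dist P Q \<le> 1" unfolding tv_dist_def
    by (rule cSUP_least[OF ne]) (use tv_dist_bdd(2)[OF assms] in auto)
  have "\<bar>measure P {} - measure Q {}\<bar> \<le> tv_dist P Q" unfolding tv_dist_def
    by (rule cSUP_upper[OF _ tv_dist_bdd(1)[OF assms]]) simp
  thus "0 \<le> tv_dist P Q" by simp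
qed

lemma tv_dist_triangle: assumes "prob_space P" "prob_space Q" "prob_space R" "sets P = sets Q" "sets Q = sets R"
  shows "tv_dist P R \<le> tv_dist P Q + tv_dist Q R"
proof -
  have ne: "sets P \<noteq> {}" by blast
  have "\<bar>measure P S - measure R S\<bar> \<le> tv_dist P Q + tv_dist Q R" if S: "S \<in> sets P" for S
  proof -
    have "\<bar>measure P S - measure Q S\<bar> \<le> tv_dist P Q" unfolding tv_dist_def
      by (rule cSUP_upper[OF S tv_dist_bdd(1)[OF assms(1,2)]])
    moreover have "\<bar>measure Q S - measure R S\<bar> \<le> tv_dist Q R" unfolding tv_dist_def
      by (rule cSUP_upper[OF _ tv_dist_bdd(1)[OF assms(2,3)]]) (use S assms in simp)
    ultimately show ?thesis by linarith
  qed
  thus ?thesis unfolding tv_dist_def[of P R] by (rule cSUP_least[OF ne])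
qed

lemma tv_dist_commute: "sets P = sets Q \<Longrightarrow> tv_dist P Q = tv_dist Q P"
  unfolding tv_dist_def by (simp add: abs_minus_commute)

lemma tv_dist_eq_0D: assumes "prob_space P" "prob_space Q" "sets P = sets Q" "tv_dist P Q = 0" shows "P = Q"
proof (rule measure_eqI)
  fix S assume S: "S \<in> sets P"
  have "\<bar>measure P S - measure Q S\<bar> \<le> tv_dist P Q" unfolding tv_dist_def
      by (rule cSUP_upper[OF S tv_dist_bdd(1)[OF assms(1,2)]])
  hence "measure P S = measure Q S" using assms by simp
  thus "emeasure P S = emeasure Q S"
    using assms(1,2) by (metis finite_measure.emeasure_eq_measure prob_space.finite_measure)
qed (use assms in auto)

lemma Metric_space_BN_eqb:
  assumes fin: "finite V" and pol: "\<forall>v\<in>V. polish_state_space (X v)"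
  shows "Metric_space (BN_eqb X V \<mu> K \<omega>) (BN_eqb_dist X V \<mu> K \<omega>)"
proof -
  let ?S = "space (prod_space X V)"
  let ?k = "\<lambda>(g :: ('a \<times> 'a) set \<times> ('a,'b) kernels) v x. (snd g) v (restrict x (parents (fst g) v))"
  define t where "t = (\<lambda>g h v. SUP x\<in>?S. tv_dist (?k g v x) (?k h v x))"
  have tv: "tv_circ X V g h = (\<Sum>v\<in>V. t g h v)" for g h
    by (simp add: tv_circ_def t_def split_beta)
  have ne: "?S \<noteq> {}"
    using pol by (auto simp: prod_space_def space_PiM space_borel_metric PiE_eq_empty_iff polish_state_space_def)
  have kp: "prob_space (?k g v x)" "sets (?k g v x) = sets (borel_metric (X v))"
    if g: "g \<in> BN_eqb X V \<mu> K \<omega>" and v: "v \<in> V" and x: "x \<in> ?S" for g v x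
  proof -
    have d: "parents (fst g) v \<subseteq> V" using g by (auto simp: BN_eqb_def dag_def parents_def)
    have "snd g \<in> bayes_nets X V (fst g)" using g by (auto simp: BN_eqb_def bayes_nets_eqb_def)
    hence m: "snd g v \<in> prod_space X (parents (fst g) v) \<rightarrow>\<^sub>M prob_algebra (borel_metric (X v))"
      using v by (auto simp: bayes_nets_def)
    have "restrict x (parents (fst g) v) \<in> space (prod_space X (parents (fst g) v))"
      using x d by (auto simp: prod_space_def space_PiM PiE_def Pi_def)
    from measurable_space[OF m this]
    show "prob_space (?k g v x)" "sets (?k g v x) = sets (borel_metric (X v))"
      by (auto simp: space_prob_algebra)
  qed
  have bd: "bdd_above ((\<lambda>x. tv_dist (?k g v x) (?k h v x)) ` ?S)"
    if "g \<in> BN_eqb X V \<mu> K \<omega>" "h \<in> BN_eqb X V \<mu> K \<omega>" "v \<in> V" for g h v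
  proof (rule bdd_aboveI2)
    fix x assume x: "x \<in> ?S"
    show "tv_dist (?k g v x) (?k h v x) \<le> 1"
      by (rule tv_dist_bounds(1)[OF kp(1)[OF that(1,3) x] kp(1)[OF that(2,3) x]])
  qed
  have up: "tv_dist (?k g v x) (?k h v x) \<le> t g h v"
    if "g \<in> BN_eqb X V \<mu> K \<omega>" "h \<in> BN_eqb X V \<mu> K \<omega>" "v \<in> V" "x \<in> ?S" for g h v x
    unfolding t_def by (rule cSUP_upper[OF that(4) bd[OF that(1-3)]])
  have t0: "0 \<le> t g h v" if gh: "g \<in> BN_eqb X V \<mu> K \<omega>" "h \<in> BN_eqb X V \<mu> K \<omega>" "v \<in> V" for g h v
  proof -
    obtain x where x: "x \<in> ?S" using ne by blast
    show ?thesis using up[OF gh x] tv_dist_bounds(2)[OF kp(1)[OF gh(1,3) x] kp(1)[OF gh(2,3) x]] by linarith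
  qed
  have tt: "t g k v \<le> t g h v + t h k v" if gh: "g \<in> BN_eqb X V \<mu> K \<omega>" "h \<in> BN_eqb X V \<mu> K \<omega>"
     "k \<in> BN_eqb X V \<mu> K \<omega>" "v \<in> V" for g h k v
    unfolding t_def
  proof (rule cSUP_least[OF ne])
    fix x assume x: "x \<in> ?S"
    have "tv_dist (?k g v x) (?k k v x) \<le> tv_dist (?k g v x) (?k h v x) + tv_dist (?k h v x) (?k k v x)"
      by (rule tv_dist_triangle) (use kp gh x in auto)
    also have "\<dots> \<le> t g h v + t h k v" using up[of g h v x] up[of h k v x] gh x by linarith
    finally show "tv_dist (?k g v x) (?k k v x) \<le> (SUP x\<in>?S. tv_dist (?k g v x) (?k h v x)) + (SUP x\<in>?S. tv_dist (?k h v x) (?k k v x))"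
      by (simp add: t_def)
  qed
  let ?B = "BN_eqb X V \<mu> K \<omega>"
  have sym: "t g h v = t h g v" if "g \<in> ?B" "h \<in> ?B" "v \<in> V" for g h v
    unfolding t_def by (rule SUP_cong[OF refl], rule tv_dist_commute) (use kp that in auto)
  have teq: "snd g v = snd h v" if gh: "g \<in> ?B" "h \<in> ?B" "v \<in> V" and 0: "t g h v = 0" and E: "fst g = fst h" for g h v
  proof
    fix y
    have d: "parents (fst g) v \<subseteq> V" using gh by (auto simp: BN_eqb_def dag_def parents_def)
    have mg: "snd g v \<in> extensional (space (prod_space X (parents (fst g) v)))"
         "snd h v \<in> extensional (space (prod_space X (parents (fst g) v)))"
      using gh E by (auto simp: BN_eqb_def bayes_nets_eqb_def bayes_nets_def)
    show "snd g v y = snd h v y"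
    proof (cases "y \<in> space (prod_space X (parents (fst g) v))")
      case False thus ?thesis using mg by (simp add: extensional_def)
    next
      case True
      obtain z where z: "z \<in> ?S" using ne by blast
      define x where "x = (\<lambda>w. if w \<in> parents (fst g) v then y w else z w)"
      have x: "x \<in> ?S" using True z d by (auto simp: x_def prod_space_def space_PiM PiE_def Pi_def extensional_def)
      have r: "restrict x (parents (fst g) v) = y"
        using True by (auto simp: x_def prod_space_def space_PiM PiE_def extensional_def fun_eq_iff)
      have "tv_dist (?k g v x) (?k h v x) = 0"
        using up[OF gh x] 0 tv_dist_bounds(2)[OF kp(1)[OF gh(1,3) x] kp(1)[OF gh(2,3) x]] by linarith
      from tv_dist_eq_0D[OF kp(1)[OF gh(1,3) x] kp(1)[OF gh(2,3) x] _ this]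
      have "?k g v x = ?k h v x" using kp(2)[OF gh(1,3) x] kp(2)[OF gh(2,3) x] by simp
      thus ?thesis using r E by simp
    qed
  qed
  have refl: "t g g v = 0" if "g \<in> ?B" "v \<in> V" for g v
  proof -
    have "tv_dist P P = 0" for P :: "'b measure"
    proof -
      have "sets P \<noteq> {}" by blast
      thus ?thesis by (simp add: tv_dist_def)
    qed
    thus ?thesis unfolding t_def using ne by simp
  qed
  have tc0: "0 \<le> tv_circ X V g h" if "g \<in> ?B" "h \<in> ?B" for g h
    unfolding tv using t0 that by (intro sum_nonneg) auto
  show ?thesis
  proof
    fix g h k
    show "0 \<le> BN_eqb_dist X V \<mu> K \<omega> g h" using tc0 by (simp add: BN_eqb_dist_def)
    show "BN_eqb_dist X V \<mu> K \<omega> g h = BN_eqb_dist X V \<mu> K \<omega> h g"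
      using sym by (auto simp: BN_eqb_dist_def tv intro!: sum.cong)
    show "BN_eqb_dist X V \<mu> K \<omega> g h = 0 \<longleftrightarrow> g = h" if gh: "g \<in> ?B" "h \<in> ?B"
    proof
      assume "g = h" thus "BN_eqb_dist X V \<mu> K \<omega> g h = 0" using refl gh by (simp add: BN_eqb_dist_def tv)
    next
      assume 0: "BN_eqb_dist X V \<mu> K \<omega> g h = 0"
      hence E: "fst g = fst h" using tc0[OF gh] gh by (auto simp: BN_eqb_dist_def split: if_splits)
      with 0 gh have "(\<Sum>v\<in>V. t g h v) = 0" by (simp add: BN_eqb_dist_def tv)
      hence "\<forall>v\<in>V. t g h v = 0" using t0[OF gh] by (subst (asm) sum_nonneg_eq_0_iff[OF fin]) auto
      hence a: "snd g v = snd h v" if "v \<in> V" for v using teq[OF gh that _ E] that by blast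
      have "snd g \<in> extensional V" "snd h \<in> extensional V"
        using gh by (auto simp: BN_eqb_def bayes_nets_eqb_def bayes_nets_def)
      hence "snd g = snd h" using a by (rule extensionalityI)
      thus "g = h" using E by (simp add: prod_eq_iff)
    qed
    show "BN_eqb_dist X V \<mu> K \<omega> g k \<le> BN_eqb_dist X V \<mu> K \<omega> g h + BN_eqb_dist X V \<mu> K \<omega> h k"
      if ghk: "g \<in> ?B" "h \<in> ?B" "k \<in> ?B"
    proof -
      have "(\<Sum>v\<in>V. t g k v) \<le> (\<Sum>v\<in>V. t g h v + t h k v)" using tt ghk by (intro sum_mono) auto
      thus ?thesis using ghk by (simp add: BN_eqb_dist_def tv sum.distrib)
    qed
  qed
qed

lemma kernel_product_prob:
  assumes "distinct vs" "\<forall>i<length vs. parents E (vs!i) \<subseteq> set (drop (Suc i) vs)"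
    "\<forall>v\<in>set vs. m v \<in> prod_space X (parents E v) \<rightarrow>\<^sub>M prob_algebra (borel_metric (X v))"
  shows "kernel_product X E m vs \<in> space (prob_algebra (prod_space X (set vs)))"
  using assms
proof (induction vs)
  case Nil
  have "prob_space (return (prod_space X {}) (\<lambda>_. undefined))"
    by (rule prob_space_return) (simp add: prod_space_def space_PiM)
  thus ?case by (simp add: space_prob_algebra)
next
  case (Cons v vs)
  let ?N = "prod_space X (set vs)" and ?L = "prod_space X (set (v#vs))"
  have P: "kernel_product X E m vs \<in> space (prob_algebra ?N)"
    by (rule Cons.IH) (use Cons.prems in \<open>fastforce+\<close>)
  have pa: "parents E v \<subseteq> set vs" using Cons.prems(2)[rule_format, of 0] by simp
  have m[measurable]: "m v \<in> prod_space X (parents E v) \<rightarrow>\<^sub>M prob_algebra (borel_metric (X v))"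
    using Cons.prems by simp
  have r[measurable]: "(\<lambda>x. restrict x (parents E v)) \<in> ?N \<rightarrow>\<^sub>M prod_space X (parents E v)"
    unfolding prod_space_def using pa by (rule measurable_restrict_subset)
  have u: "(\<lambda>(x, y). x(v := y)) \<in> ?N \<Otimes>\<^sub>M borel_metric (X v) \<rightarrow>\<^sub>M ?L"
    unfolding prod_space_def using measurable_add_dim[of v "set vs" "\<lambda>v. borel_metric (X v)"] by simp
  have k: "(\<lambda>x. distr (m v (restrict x (parents E v))) ?L (\<lambda>y. x(v := y))) \<in> ?N \<rightarrow>\<^sub>M prob_algebra ?L"
    by (rule measurable_distr_prob_space2[OF _ u]) measurable
  show ?case
    unfolding kernel_product.simps space_prob_algebra
    using prob_space_bind'[OF P k] sets_bind'[OF P k] by simp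
qed

end

theory Submission
  imports Defs "HOL-Real_Asymp.Real_Asymp"
begin

text \<open>An algorithm that is correct on the true set of conditional independencies is consistent wherever
  the tests recover that set and the network is faithful: there are finitely many triples, so
  with probability tending to one all tests are right simultaneously. It therefore suffices that the
  faithful networks form an open and dense set and that consistent tests exist.

  Openness. Every Bayesian network satisfies the global Markov property
  (\<open>ordered_markov_imp_global_markov\<close>), so unfaithfulness means that one of finitely many
  conditional independencies holds that is not forced by d-separation. Conditional independence is closed in
  total variation (\<open>indep_given_tv_closed\<close>), because conditional probabilities depend continuously,
  in mean, on the measure. The observational distribution is a Lipschitz function of
  the network (\<open>obs_dist_tv_circ\<close>).

  Density. Start from a faithful network on the same graph and move its kernels to those of the given network, one
  vertex at a time. Interpolating a single kernel linearly makes the observational distribution a mixture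
  of two measures (\<open>ex_interpolation_at_vertex\<close>). Along a mixture a conditional independence is, after
  clearing denominators, a quadratic identity in the mixing parameter; so if it fails at one end, it holds
  for finitely many parameters only (\<open>finite_indep_given_mixture\<close>). Hence one can stop arbitrarily close to the
  given kernel without losing faithfulness.

  Tests. The joint densities of all networks under consideration are uniformly equicontinuous. For such
  densities, convergence of the probabilities of countably many small boxes implies convergence in total
  variation (\<open>equicontinuous_densities_tv_limit\<close>). As conditional independence is closed, each distribution that
  violates it is separated from all those that satisfy it by finitely many of the boxes, and comparing
  empirical frequencies of boxes with their probabilities gives the test (\<open>ex_consistent_test\<close>).\<close>

section \<open>Open paths and d-separation\<close>

definition open_path :: "('v \<times> 'v) set \<Rightarrow> 'v set \<Rightarrow> 'v list \<Rightarrow> bool" where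
  "open_path E C p \<longleftrightarrow>
     (\<forall>i<length p. if collider_at E p i then p ! i \<in> ancestors E C else p ! i \<notin> C)"

lemma d_sep_iff_no_open_path:
  "d_sep E A B C \<longleftrightarrow> (\<forall>a\<in>A. \<forall>b\<in>B. \<forall>p. path_between E a b p \<longrightarrow> \<not> open_path E C p)"
  unfolding d_sep_def open_path_def by (meson)

lemma d_sep_mono: "d_sep E A B C \<Longrightarrow> A' \<subseteq> A \<Longrightarrow> B' \<subseteq> B \<Longrightarrow> d_sep E A' B' C"
  unfolding d_sep_def by blast

lemma ancestors_mono: "C \<subseteq> C' \<Longrightarrow> ancestors E C \<subseteq> ancestors E C'"
  unfolding ancestors_def by blast

lemma collider_at_rev:
  assumes "i < length p"
  shows "collider_at E (rev p) i \<longleftrightarrow> collider_at E p (length p - 1 - i)"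
proof -
  have "collider_at E (rev p) i \<longleftrightarrow> 0 < i \<and> Suc i < length p \<and>
      (p ! (length p - i), p ! (length p - 1 - i)) \<in> E \<and>
      (p ! (length p - 1 - Suc i), p ! (length p - 1 - i)) \<in> E"
    using assms by (auto simp: collider_at_def rev_nth)
  moreover have "length p - 1 - Suc i = length p - 1 - i - 1" by simp
  moreover have "Suc (length p - 1 - i) = length p - i" using assms by simp
  ultimately show ?thesis using assms by (auto simp: collider_at_def)
qed

lemma path_between_rev: "path_between E a b p \<Longrightarrow> path_between E b a (rev p)"
  unfolding path_between_def
proof (elim conjE, intro conjI allI impI)
  fix i
  assume p: "p \<noteq> []"
    "\<forall>i. Suc i < length p \<longrightarrow> (p ! i, p ! Suc i) \<in> E \<or> (p ! Suc i, p ! i) \<in> E"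
    "Suc i < length (rev p)"
  have e: "Suc (length p - 1 - Suc i) = length p - 1 - i" using p by simp
  hence "(p ! (length p - 1 - Suc i), p ! (length p - 1 - i)) \<in> E \<or>
        (p ! (length p - 1 - i), p ! (length p - 1 - Suc i)) \<in> E"
    using p(2)[rule_format, of "length p - 1 - Suc i"] p(1,3) by simp
  thus "(rev p ! i, rev p ! Suc i) \<in> E \<or> (rev p ! Suc i, rev p ! i) \<in> E"
    using p by (auto simp: rev_nth)
qed (auto simp: hd_rev last_rev)

lemma open_path_rev:
  assumes "open_path E C p" shows "open_path E C (rev p)"
  unfolding open_path_def
proof (intro allI impI)
  fix i assume i: "i < length (rev p)"
  hence "length p - Suc i < length p" by simp
  with assms have "if collider_at E p (length p - Suc i) then p ! (length p - Suc i) \<in> ancestors E C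
      else p ! (length p - Suc i) \<notin> C" unfolding open_path_def by blast
  thus "if collider_at E (rev p) i then rev p ! i \<in> ancestors E C else rev p ! i \<notin> C"
    using i by (simp add: collider_at_rev rev_nth)
qed

lemma d_sep_sym: "d_sep E A B C \<Longrightarrow> d_sep E B A C"
  unfolding d_sep_iff_no_open_path using path_between_rev open_path_rev by metis

lemma path_between_subset:
  assumes "path_between E a b p" "E \<subseteq> W \<times> W" "a \<in> W"
  shows "set p \<subseteq> W"
proof
  fix x assume "x \<in> set p"
  then obtain i where i: "i < length p" "x = p ! i" by (auto simp: in_set_conv_nth)
  show "x \<in> W"
  proof (cases i)
    case 0
    with i assms show ?thesis by (auto simp: path_between_def hd_conv_nth)
  next
    case (Suc j)
    hence "(p ! j, p ! Suc j) \<in> E \<or> (p ! Suc j, p ! j) \<in> E"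
      using i assms by (auto simp: path_between_def)
    with Suc i assms(2) show ?thesis by auto
  qed
qed

text \<open>A path in the smaller graph is a path in the larger one with the same colliders, while the larger
  graph has at least as many ancestors; an open path therefore stays open.\<close>

lemma d_sep_subgraph:
  assumes "d_sep (E \<inter> W \<times> W) A B C" "W' \<subseteq> W" "A \<subseteq> W'"
  shows "d_sep (E \<inter> W' \<times> W') A B C"
  unfolding d_sep_iff_no_open_path
proof (intro ballI allI impI notI)
  fix a b p
  assume a: "a \<in> A" and b: "b \<in> B" and p: "path_between (E \<inter> W' \<times> W') a b p"
    and o: "open_path (E \<inter> W' \<times> W') C p"
  have s: "set p \<subseteq> W'" by (rule path_between_subset[OF p]) (use a assms in auto)
  have c: "collider_at (E \<inter> W' \<times> W') p i \<longleftrightarrow> collider_at (E \<inter> W \<times> W) p i" if "i < length p" for i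
  proof -
    have "p ! j \<in> W'" if "j < length p" for j using s that by auto
    thus ?thesis using that assms(2) unfolding collider_at_def
      by (auto simp: subset_iff)
  qed
  have "(E \<inter> W' \<times> W')\<^sup>* \<subseteq> (E \<inter> W \<times> W)\<^sup>*" by (rule rtrancl_mono) (use assms(2) in auto)
  hence "ancestors (E \<inter> W' \<times> W') C \<subseteq> ancestors (E \<inter> W \<times> W) C"
    unfolding ancestors_def by blast
  hence "open_path (E \<inter> W \<times> W) C p" using o c unfolding open_path_def by (meson subsetD)
  moreover have "path_between (E \<inter> W \<times> W) a b p"
    using p assms(2) unfolding path_between_def by blast
  ultimately show False using assms(1) a b unfolding d_sep_iff_no_open_path by blast
qed

lemma ancestors_sink:
  assumes "\<And>u. (v, u) \<notin> E" "v \<in> ancestors E C" shows "v \<in> C"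
proof -
  obtain c where "c \<in> C" "(v, c) \<in> E\<^sup>*" using assms(2) by (auto simp: ancestors_def)
  thus ?thesis using assms(1) by (metis converse_rtranclE)
qed

text \<open>In the interior of a path a sink can only be a collider, and its only descendant is itself.\<close>

lemma sink_not_on_open_path:
  assumes p: "path_between E a b p" and o: "open_path E C p"
    and sink: "\<And>u. (v, u) \<notin> E" and v: "v \<notin> C" "v \<noteq> a" "v \<noteq> b"
  shows "v \<notin> set p"
proof
  assume "v \<in> set p"
  then obtain i where i: "i < length p" "p ! i = v" by (auto simp: in_set_conv_nth)
  have "0 < i" using i v p by (cases i) (auto simp: path_between_def hd_conv_nth)
  moreover have "Suc i < length p"
  proof (rule ccontr)
    assume "\<not> Suc i < length p"
    hence "i = length p - 1" using i by simp
    thus False using i v p by (auto simp: path_between_def last_conv_nth)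
  qed
  ultimately have "collider_at E p i"
    using p sink i unfolding collider_at_def path_between_def
    by (metis Suc_lessD Suc_pred' diff_Suc_1 less_imp_Suc_add)
  hence "v \<in> ancestors E C" using o i by (auto simp: open_path_def)
  thus False using ancestors_sink[OF sink] v by blast
qed

text \<open>A path that leaves a sink starts with a reversed edge, so the parent it steps to is a
  non-collider: prepending the sink neither opens nor blocks anything else.\<close>

lemma d_sep_sink_parents:
  assumes d: "d_sep E A B C" and v: "v \<in> A" "v \<notin> C" and sink: "\<And>u. (v, u) \<notin> E"
  shows "d_sep E (A \<union> (parents E v - C)) B C"
  unfolding d_sep_iff_no_open_path
proof (intro ballI allI impI notI)
  fix w b p
  assume w: "w \<in> A \<union> (parents E v - C)" and b: "b \<in> B"
    and p: "path_between E w b p" and o: "open_path E C p"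
  have vB: "v \<notin> B"
  proof
    assume "v \<in> B"
    have "path_between E v v [v]" by (simp add: path_between_def)
    moreover have "open_path E C [v]" using v by (simp add: open_path_def collider_at_def)
    ultimately show False using d v \<open>v \<in> B\<close> unfolding d_sep_iff_no_open_path by blast
  qed
  show False
  proof (cases "w \<in> A")
    case True
    thus ?thesis using d b p o unfolding d_sep_iff_no_open_path by blast
  next
    case False
    hence wv: "(w, v) \<in> E" "w \<notin> C" using w by (auto simp: parents_def)
    have vp: "v \<notin> set p"
      by (rule sink_not_on_open_path[OF p o sink v(2)]) (use vB b False v in auto)
    have hd: "p \<noteq> []" "hd p = w" using p by (auto simp: path_between_def)
    have "path_between E v b (v # p)"
      unfolding path_between_def
    proof (intro conjI allI impI)
      fix i assume i: "Suc i < length (v # p)"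
      show "((v # p) ! i, (v # p) ! Suc i) \<in> E \<or> ((v # p) ! Suc i, (v # p) ! i) \<in> E"
        using i p wv hd by (cases i) (auto simp: path_between_def hd_conv_nth)
    qed (use p vp in \<open>auto simp: path_between_def\<close>)
    moreover have "open_path E C (v # p)"
      unfolding open_path_def
    proof (intro allI impI)
      fix i assume i: "i < length (v # p)"
      consider "i = 0" | "i = 1" | j where "i = Suc (Suc j)" by (metis One_nat_def nat.exhaust)
      thus "if collider_at E (v # p) i then (v # p) ! i \<in> ancestors E C else (v # p) ! i \<notin> C"
      proof cases
        case 1 thus ?thesis using v by (simp add: collider_at_def)
      next
        case 2 thus ?thesis using wv hd sink by (simp add: collider_at_def hd_conv_nth)
      next
        case 3
        hence "collider_at E (v # p) i \<longleftrightarrow> collider_at E p (Suc j)"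
          by (simp add: collider_at_def)
        thus ?thesis using o i 3 by (auto simp: open_path_def)
      qed
    qed
    ultimately show False using d b v unfolding d_sep_iff_no_open_path by blast
  qed
qed

lemma collider_at_append:
  "collider_at E (xs @ x # ys) (length xs) \<longleftrightarrow>
     xs \<noteq> [] \<and> ys \<noteq> [] \<and> (last xs, x) \<in> E \<and> (hd ys, x) \<in> E"
  by (cases xs rule: rev_cases; cases ys) (auto simp: collider_at_def nth_append)

lemma open_path_at:
  assumes "open_path E C (xs @ x # ys)"
  shows "if collider_at E (xs @ x # ys) (length xs) then x \<in> ancestors E C else x \<notin> C"
  using assms unfolding open_path_def by (auto dest!: spec[of _ "length xs"])

lemma path_between_edge:
  assumes "path_between E a b (xs @ x # y # ys)"
  shows "(x, y) \<in> E \<or> (y, x) \<in> E"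
  using assms unfolding path_between_def
  by (auto simp: nth_append dest!: spec[of _ "length xs"])

text \<open>An open path that leaves a vertex along a forward edge stays directed up to its first collider
  or to its end, and both of these are ancestors of \<open>C'\<close>.\<close>

lemma open_path_forward_ancestor:
  assumes "open_path E C (xs @ x # ys)" "path_between E a b (xs @ x # ys)"
    "ys \<noteq> []" "(x, hd ys) \<in> E" "C \<subseteq> C'" "b \<in> C'"
  shows "x \<in> ancestors E C'"
  using assms
proof (induction ys arbitrary: xs x)
  case Nil thus ?case by simp
next
  case (Cons y ys)
  have xy: "(x, y) \<in> E" using Cons.prems by simp
  have "y \<in> ancestors E C'"
  proof (cases ys)
    case Nil
    hence "y = b" using Cons.prems by (auto simp: path_between_def)
    thus ?thesis using Cons.prems by (auto simp: ancestors_def)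
  next
    case (Cons z zs)
    have e: "(xs @ [x]) @ y # ys = xs @ x # y # ys" by simp
    show ?thesis
    proof (cases "(y, z) \<in> E")
      case True
      show ?thesis
        by (rule Cons.IH[of "xs @ [x]" y]) (use Cons.prems Cons True in auto)
    next
      case False
      hence "(z, y) \<in> E" using path_between_edge[of E a b "xs @ [x]" y z zs] Cons.prems Cons by simp
      hence "collider_at E ((xs @ [x]) @ y # ys) (length (xs @ [x]))"
        unfolding collider_at_append using xy Cons by simp
      hence "y \<in> ancestors E C"
        using open_path_at[of E C "xs @ [x]" y ys] Cons.prems(1) by simp
      thus ?thesis using ancestors_mono[OF Cons.prems(5)] by blast
    qed
  qed
  thus ?case using xy by (auto simp: ancestors_def intro: converse_rtrancl_into_rtrancl)
qed

lemma collider_at_append_left: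
  assumes "i < length xs"
  shows "collider_at E (xs @ x # ys) i \<longleftrightarrow> collider_at E (xs @ x # zs) i"
proof (cases "Suc i < length xs")
  case True thus ?thesis using assms by (auto simp: collider_at_def nth_append)
next
  case False
  hence "Suc i = length xs" using assms by simp
  thus ?thesis using assms by (auto simp: collider_at_def nth_append)
qed

lemma collider_at_append_right:
  assumes "j > 0"
  shows "collider_at E (xs @ x # ys) (length xs + j) \<longleftrightarrow> collider_at E (x # ys) j"
  using assms by (auto simp: collider_at_def nth_append nth_Cons')

text \<open>Two open paths into a sink \<open>v\<close> are spliced at the first common vertex \<open>x\<close>. Away from \<open>x\<close> nothing
  changes. If \<open>x\<close> becomes a collider that it was not before, then the first path runs forward from \<open>x\<close>
  towards \<open>v\<close>, hence \<open>x\<close> is an ancestor of the conditioning set enlarged by \<open>v\<close>.\<close>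

lemma splice_open_paths:
  assumes p: "path_between E a v p" "open_path E C p"
    and q: "path_between E v b q" "open_path E C q"
    and sink: "\<And>u. (v, u) \<notin> E" and ab: "a \<noteq> v" "b \<noteq> v"
  obtains r where "path_between E a b r" "open_path E (insert v C) r"
proof -
  have "\<exists>x\<in>set p. x \<in> set q"
  proof (rule bexI[of _ v])
    show "v \<in> set p" using p by (auto simp: path_between_def)
    show "v \<in> set q" using q by (auto simp: path_between_def)
  qed
  from split_list_first_prop[OF this]
  obtain xs x ys where pe: "p = xs @ x # ys" "x \<in> set q" "\<forall>y\<in>set xs. y \<notin> set q" by blast
  obtain us ws where qe: "q = us @ x # ws" using split_list[OF pe(2)] by blast
  define r where "r = xs @ x # ws"
  have dp: "distinct p" "distinct q" using p q by (auto simp: path_between_def)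
  have anc: "ancestors E C \<subseteq> ancestors E (insert v C)" by (rule ancestors_mono) auto
  have hdp: "hd p = a" "last p = v" "hd q = v" "last q = b" using p q by (auto simp: path_between_def)
  have path: "path_between E a b r"
    unfolding path_between_def
  proof (intro conjI allI impI)
    show "r \<noteq> []" by (simp add: r_def)
    show "hd r = a" using hdp pe(1) by (cases xs) (auto simp: r_def)
    show "last r = b" using hdp qe by (auto simp: r_def)
    show "distinct r" using dp pe qe by (auto simp: r_def)
    fix i assume i: "Suc i < length r"
    show "(r ! i, r ! Suc i) \<in> E \<or> (r ! Suc i, r ! i) \<in> E"
    proof (cases "Suc i \<le> length xs")
      case True
      hence "r ! i = p ! i" "r ! Suc i = p ! Suc i" "Suc i < length p"
        using pe(1) by (auto simp: r_def nth_append le_less_Suc_eq)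
      thus ?thesis using p by (auto simp: path_between_def)
    next
      case False
      then obtain j where j: "i = length xs + j" by (metis le_Suc_ex not_less_eq_eq)
      have "r ! i = q ! (length us + j)" "r ! Suc i = q ! Suc (length us + j)"
        "Suc (length us + j) < length q"
        using i j qe by (auto simp: r_def nth_append)
      thus ?thesis using q by (auto simp: path_between_def)
    qed
  qed
  have vr: "y \<notin> C \<Longrightarrow> y \<noteq> v \<Longrightarrow> y \<notin> insert v C" for y by blast
  have "open_path E (insert v C) r"
    unfolding open_path_def
  proof (intro allI impI)
    fix i assume i: "i < length r"
    consider "i < length xs" | "i = length xs" | j where "j > 0" "i = length xs + j"
      by (metis less_imp_add_positive linorder_neqE_nat)
    thus "if collider_at E r i then r ! i \<in> ancestors E (insert v C) else r ! i \<notin> insert v C"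
    proof cases
      case 1
      hence c: "collider_at E r i \<longleftrightarrow> collider_at E p i"
        unfolding r_def pe(1) by (rule collider_at_append_left)
      have e: "r ! i = p ! i" "i < length p" using 1 pe(1) by (auto simp: r_def nth_append)
      have "p ! i \<noteq> v"
      proof
        assume "p ! i = v"
        hence "v \<in> set xs" using 1 pe(1) by (metis nth_append nth_mem)
        thus False using pe(3) q by (auto simp: path_between_def)
      qed
      thus ?thesis using c e p(2) anc unfolding open_path_def by auto
    next
      case 3
      have c: "collider_at E r i \<longleftrightarrow> collider_at E q (length us + j)"
        unfolding r_def qe 3 using collider_at_append_right[OF 3(1)] by metis
      have e: "r ! i = q ! (length us + j)" "length us + j < length q"
        using i 3 qe by (auto simp: r_def nth_append)
      have "q ! (length us + j) \<noteq> v"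
      proof
        assume "q ! (length us + j) = v"
        hence "q ! (length us + j) = q ! 0" using hdp q by (auto simp: hd_conv_nth path_between_def)
        thus False using dp(2) e 3 q
          by (metis add_is_0 gr_implies_not0 nth_eq_iff_index_eq path_between_def length_greater_0_conv)
      qed
      thus ?thesis using c e q(2) anc unfolding open_path_def by auto
    next
      case 2
      have rx: "r ! i = x" using 2 by (simp add: r_def)
      have cr: "collider_at E r i \<longleftrightarrow> xs \<noteq> [] \<and> ws \<noteq> [] \<and> (last xs, x) \<in> E \<and> (hd ws, x) \<in> E"
        unfolding 2 r_def by (rule collider_at_append)
      have po: "if collider_at E p (length xs) then x \<in> ancestors E C else x \<notin> C"
        using open_path_at[of E C xs x ys] p(2) pe by simp
      have qo: "if collider_at E q (length us) then x \<in> ancestors E C else x \<notin> C"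
        using open_path_at[of E C us x ws] q(2) qe by simp
      have pc: "collider_at E p (length xs) \<longleftrightarrow> xs \<noteq> [] \<and> ys \<noteq> [] \<and> (last xs, x) \<in> E \<and> (hd ys, x) \<in> E"
        unfolding pe(1) by (rule collider_at_append)
      have qc: "collider_at E q (length us) \<longleftrightarrow> us \<noteq> [] \<and> ws \<noteq> [] \<and> (last us, x) \<in> E \<and> (hd ws, x) \<in> E"
        unfolding qe by (rule collider_at_append)
      show ?thesis
      proof (cases "x = v")
        case True
        have "xs \<noteq> []" using hdp pe(1) ab True by auto
        then obtain xs' u where xs: "xs = xs' @ [u]" by (metis rev_exhaust)
        have "ws \<noteq> []" using hdp qe ab True by auto
        then obtain w ws' where ws: "ws = w # ws'" by (meson neq_Nil_conv)
        have "(u, v) \<in> E" using path_between_edge[of E a v xs' u x ys] p pe xs sink True by auto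
        moreover have "(w, v) \<in> E" using path_between_edge[of E v b us x w ws'] q qe ws sink True by auto
        ultimately have "collider_at E r i" using cr xs ws True by simp
        moreover have "v \<in> ancestors E (insert v C)" by (auto simp: ancestors_def)
        ultimately show ?thesis using rx True by simp
      next
        case False
        show ?thesis
        proof (cases "collider_at E r i")
          case False
          hence "x \<notin> C" using po qo pc qc cr by (auto split: if_splits)
          thus ?thesis using False rx \<open>x \<noteq> v\<close> by simp
        next
          case True
          have "x \<in> ancestors E (insert v C)"
          proof (cases "collider_at E p (length xs)")
            case True thus ?thesis using po anc by auto
          next
            case nc: False
            have ys: "ys \<noteq> []" using \<open>x \<noteq> v\<close> hdp pe(1) by auto
            hence "(hd ys, x) \<notin> E" using nc pc cr True by auto
            hence "(x, hd ys) \<in> E" using path_between_edge[of E a v xs x "hd ys" "tl ys"] p pe ys by auto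
            thus ?thesis using open_path_forward_ancestor[of E C xs x ys a v "insert v C"] p pe ys by auto
          qed
          thus ?thesis using True rx by simp
        qed
      qed
    qed
  qed
  with path show ?thesis by (rule that)
qed

text \<open>Otherwise there are open paths from both sides to \<open>v\<close>; spliced together they are open once \<open>v\<close> is
  conditioned on.\<close>

lemma d_sep_sink_conditioned:
  assumes d: "d_sep E A B (insert v C)" and v: "v \<notin> A" "v \<notin> B" "v \<notin> C"
    and sink: "\<And>u. (v, u) \<notin> E"
  shows "d_sep E A (insert v B) C \<or> d_sep E (insert v A) B C"
proof (rule ccontr)
  have anc: "ancestors E C \<subseteq> ancestors E (insert v C)" by (rule ancestors_mono) auto
  have no: False if "a \<in> A" "b \<in> B" "path_between E a b p" "open_path E C p" for a b p
  proof -
    have "v \<notin> set p" by (rule sink_not_on_open_path[OF that(3,4) sink]) (use that v in auto)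
    hence "open_path E (insert v C) p" using that(4) anc unfolding open_path_def
      by (auto split: if_splits)
    thus False using d that unfolding d_sep_iff_no_open_path by blast
  qed
  assume dep: "\<not> ?thesis"
  then obtain a p where ap: "a \<in> A" "path_between E a v p" "open_path E C p"
    unfolding d_sep_iff_no_open_path using no by blast
  obtain b q where bq: "b \<in> B" "path_between E v b q" "open_path E C q"
    using dep unfolding d_sep_iff_no_open_path using no by blast
  obtain r where "path_between E a b r" "open_path E (insert v C) r"
    by (rule splice_open_paths[OF ap(2,3) bq(2,3) sink]) (use ap bq v in auto)
  thus False using d ap bq unfolding d_sep_iff_no_open_path by blast
qed

section \<open>Conditional probabilities as screening\<close>

abbreviation cond_prob_given :: "'a measure \<Rightarrow> 'a measure \<Rightarrow> 'a set \<Rightarrow> 'a \<Rightarrow> real" where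
  "cond_prob_given M F S \<equiv> real_cond_exp M F (indicator S)"

lemma subalgebra_prob: "prob_space M \<Longrightarrow> subalgebra M F \<Longrightarrow> sigma_finite_subalgebra M F"
  by (intro finite_measure_subalgebra_is_sigma_finite finite_measure_subalgebra.intro)
     (auto simp: finite_measure_subalgebra_axioms_def prob_space.finite_measure)

lemma set_integral_indicator_prob:
  assumes "prob_space M" "S \<in> sets M" "U \<in> sets M"
  shows "(LINT x:U|M. indicator S x :: real) = measure M (S \<inter> U)"
proof -
  have "(LINT x:U|M. indicator S x :: real) = (LINT x|M. indicator (S \<inter> U) x)"
    unfolding set_lebesgue_integral_def by (auto intro!: Bochner_Integration.integral_cong simp: indicator_def)
  also have "\<dots> = measure M (S \<inter> U)" using assms(2,3) by (simp add: Int_absorb2 sets.sets_into_space)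
  finally show ?thesis .
qed

lemma integrable_indicator_prob: "prob_space M \<Longrightarrow> S \<in> sets M \<Longrightarrow> integrable M (indicator S :: _ \<Rightarrow> real)"
  by (simp add: prob_space.finite_measure finite_measure.emeasure_finite less_top[symmetric])

lemma cond_prob_given_eqI:
  assumes "prob_space M" "subalgebra M F" "S \<in> sets M" "g \<in> borel_measurable F" "integrable M g"
    "\<And>U. U \<in> sets F \<Longrightarrow> (LINT x:U|M. g x) = measure M (S \<inter> U)"
  shows "AE x in M. cond_prob_given M F S x = g x"
proof -
  interpret sigma_finite_subalgebra M F by (rule subalgebra_prob[OF assms(1,2)])
  show ?thesis
    by (rule real_cond_exp_charact)
      (use assms set_integral_indicator_prob[OF assms(1,3)] integrable_indicator_prob in
        \<open>auto simp: subalgebra_def\<close>)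
qed

lemma cond_prob_given_bounds:
  assumes "prob_space M" "subalgebra M F" "S \<in> sets M"
  shows "AE x in M. 0 \<le> cond_prob_given M F S x \<and> cond_prob_given M F S x \<le> 1"
proof -
  interpret prob_space M by fact
  interpret sigma_finite_subalgebra M F by (rule subalgebra_prob[OF assms(1,2)])
  have "AE x in M. 0 \<le> cond_prob_given M F S x"
    by (rule real_cond_exp_pos) (use assms in auto)
  moreover have "AE x in M. cond_prob_given M F S x \<le> real_cond_exp M F (\<lambda>_. 1) x"
    by (rule real_cond_exp_mono) (use assms integrable_indicator_prob[OF assms(1)] in \<open>auto simp: indicator_def\<close>)
  moreover have "AE x in M. real_cond_exp M F (\<lambda>_. 1) x = (1::real)"
    by (rule real_cond_exp_F_meas) auto
  ultimately show ?thesis by eventually_elim auto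
qed

definition cond_prob_version :: "'a measure \<Rightarrow> 'a measure \<Rightarrow> 'a set \<Rightarrow> ('a \<Rightarrow> real) \<Rightarrow> bool" where
  "cond_prob_version M F S g \<longleftrightarrow> g \<in> borel_measurable F \<and> (\<forall>x. 0 \<le> g x \<and> g x \<le> 1) \<and>
     (\<forall>U\<in>sets F. (LINT x:U|M. g x) = measure M (S \<inter> U))"

text \<open>Truncation to the unit interval changes a conditional probability on a null set only.\<close>

lemma ex_cond_prob_version:
  assumes M: "prob_space M" and F: "subalgebra M F" and S: "S \<in> sets M"
  shows "\<exists>g. cond_prob_version M F S g \<and> (AE x in M. cond_prob_given M F S x = g x)"
proof -
  interpret prob_space M by fact
  interpret sigma_finite_subalgebra M F by (rule subalgebra_prob[OF M F])
  define g where "g x = max 0 (min 1 (cond_prob_given M F S x))" for x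
  have m: "g \<in> borel_measurable F" unfolding g_def by measurable
  have mM: "g \<in> borel_measurable M" by (rule measurable_from_subalg[OF F m])
  have ae: "AE x in M. cond_prob_given M F S x = g x"
    using cond_prob_given_bounds[OF M F S] by eventually_elim (simp add: g_def)
  have "(LINT x:U|M. g x) = measure M (S \<inter> U)" if U: "U \<in> sets F" for U
  proof -
    have UM: "U \<in> sets M" using U F by (auto simp: subalgebra_def)
    have "(LINT x:U|M. g x) = (LINT x:U|M. cond_prob_given M F S x)"
      unfolding set_lebesgue_integral_def
      by (rule integral_cong_AE) (use ae mM UM in auto)
    also have "\<dots> = (LINT x:U|M. indicator S x)"
      by (rule real_cond_exp_intA[symmetric]) (use U integrable_indicator_prob[OF M S] in auto)
    finally show ?thesis using set_integral_indicator_prob[OF M S UM] by simp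
  qed
  with m ae show ?thesis
    by (intro exI[of _ g]) (auto simp: g_def cond_prob_version_def)
qed

definition indep_given :: "'a measure \<Rightarrow> 'a measure \<Rightarrow> 'a measure \<Rightarrow> 'a measure \<Rightarrow> bool" where
  "indep_given M F G H \<longleftrightarrow> (\<forall>S\<in>sets F. \<forall>T\<in>sets G. AE x in M.
     cond_prob_given M H (S \<inter> T) x = cond_prob_given M H S x * cond_prob_given M H T x)"

lemma indep_given_sym: "indep_given M F G H \<Longrightarrow> indep_given M G F H"
  unfolding indep_given_def by (metis (no_types, lifting) AE_cong Int_commute mult.commute)

lemma indicator_times_real: "(indicator (S \<inter> T) :: _ \<Rightarrow> real) = (\<lambda>x. indicator T x * indicator S x)"
  by (auto simp: indicator_def fun_eq_iff)

text \<open>The events \<open>T \<inter> U\<close> form an intersection-stable generator of \<open>J\<close>, and on them the screening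
  identity is the product rule integrated over \<open>U\<close>. Screening is the form of conditional independence
  in which decomposition, weak union and contraction are instances of the tower property.\<close>

lemma indep_given_iff_screening:
  assumes M: "prob_space M" and F: "subalgebra M F" and G: "subalgebra M G" and H: "subalgebra M H"
    and J: "subalgebra M J" "sets J = sigma_sets (space M) {T \<inter> U |T U. T \<in> sets G \<and> U \<in> sets H}"
  shows "indep_given M F G H \<longleftrightarrow>
    (\<forall>S\<in>sets F. AE x in M. cond_prob_given M J S x = cond_prob_given M H S x)"
proof -
  interpret prob_space M by fact
  interpret H: sigma_finite_subalgebra M H by (rule subalgebra_prob[OF M H])
  interpret J: sigma_finite_subalgebra M J by (rule subalgebra_prob[OF M J(1)])
  have sp: "space F = space M" "space G = space M" "space H = space M" "space J = space M"
    using F G H J(1) by (auto simp: subalgebra_def)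
  have FM: "S \<in> sets M" if "S \<in> sets F" for S using that F by (auto simp: subalgebra_def)
  have GM: "S \<in> sets M" if "S \<in> sets G" for S using that G by (auto simp: subalgebra_def)
  have HM: "S \<in> sets M" if "S \<in> sets H" for S using that H by (auto simp: subalgebra_def)
  have HJ: "sets H \<subseteq> sets J"
  proof
    fix U assume U: "U \<in> sets H"
    have "space M \<in> sets G" using sets.top[of G] sp by simp
    moreover have "U = space M \<inter> U" using sets.sets_into_space[OF U] sp by auto
    ultimately show "U \<in> sets J" unfolding J(2) using U by blast
  qed
  have GJ: "sets G \<subseteq> sets J"
  proof
    fix T assume T: "T \<in> sets G"
    have "space M \<in> sets H" using sets.top[of H] sp by simp
    moreover have "T = T \<inter> space M" using sets.sets_into_space[OF T] sp by auto
    ultimately show "T \<in> sets J" unfolding J(2) using T by blast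
  qed
  have HJs: "subalgebra J H" using HJ sp by (auto simp: subalgebra_def)
  show ?thesis
  proof
    assume ci: "indep_given M F G H"
    show "\<forall>S\<in>sets F. AE x in M. cond_prob_given M J S x = cond_prob_given M H S x"
    proof
      fix S assume S: "S \<in> sets F"
      let ?r = "cond_prob_given M H S"
      have ri: "integrable M ?r" by (rule H.real_cond_exp_int(1)) (rule integrable_indicator_prob[OF M FM[OF S]])
      have rm: "?r \<in> borel_measurable M" using ri by auto
      have rJ: "?r \<in> borel_measurable J" by (rule measurable_from_subalg[OF HJs]) simp
      have gen: "(LINT x:T \<inter> U|M. ?r x) = measure M (S \<inter> (T \<inter> U))"
        if T: "T \<in> sets G" and U: "U \<in> sets H" for T U
      proof -
        have i: "integrable M (\<lambda>x. ?r x * indicator T x)"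
          using integrable_mult_indicator[OF GM[OF T] ri] by (simp add: mult.commute)
        have "(LINT x:T \<inter> U|M. ?r x) = (LINT x:U|M. ?r x * indicator T x)"
          unfolding set_lebesgue_integral_def by (auto intro!: Bochner_Integration.integral_cong simp: indicator_def)
        also have "\<dots> = (LINT x:U|M. real_cond_exp M H (\<lambda>x. ?r x * indicator T x) x)"
          by (rule H.real_cond_exp_intA[OF i U])
        also have "\<dots> = (LINT x:U|M. cond_prob_given M H (S \<inter> T) x)"
        proof -
          have "AE x in M. real_cond_exp M H (\<lambda>x. ?r x * indicator T x) x = ?r x * cond_prob_given M H T x"
            by (rule H.real_cond_exp_mult) (use i GM[OF T] in auto)
          moreover have "AE x in M. cond_prob_given M H (S \<inter> T) x = ?r x * cond_prob_given M H T x"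
            using ci S T unfolding indep_given_def by blast
          ultimately have "AE x in M. indicator U x *\<^sub>R real_cond_exp M H (\<lambda>x. ?r x * indicator T x) x
             = indicator U x *\<^sub>R cond_prob_given M H (S \<inter> T) x" by eventually_elim simp
          thus ?thesis unfolding set_lebesgue_integral_def
            by (intro integral_cong_AE) (use HM[OF U] in auto)
        qed
        also have "\<dots> = (LINT x:U|M. indicator (S \<inter> T) x)"
          by (rule H.real_cond_exp_intA[symmetric])
            (use U integrable_indicator_prob[OF M, of "S \<inter> T"] FM[OF S] GM[OF T] in auto)
        also have "\<dots> = measure M (S \<inter> T \<inter> U)"
          by (rule set_integral_indicator_prob[OF M]) (use FM[OF S] GM[OF T] HM[OF U] in auto)
        finally show ?thesis by (simp add: Int_assoc)
      qed
      have si: "set_integrable M W ?r" if "W \<in> sets M" for W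
        unfolding set_integrable_def using integrable_mult_indicator[OF that ri] by simp
      let ?A = "{T \<inter> U |T U. T \<in> sets G \<and> U \<in> sets H}"
      have stable: "Int_stable ?A"
      proof (rule Int_stableI, clarify)
        fix T U T' U' assume "T \<in> sets G" "U \<in> sets H" "T' \<in> sets G" "U' \<in> sets H"
        hence "T \<inter> T' \<in> sets G" "U \<inter> U' \<in> sets H" by auto
        moreover have "T \<inter> U \<inter> (T' \<inter> U') = T \<inter> T' \<inter> (U \<inter> U')" by auto
        ultimately show "\<exists>T'' U''. T \<inter> U \<inter> (T' \<inter> U') = T'' \<inter> U'' \<and> T'' \<in> sets G \<and> U'' \<in> sets H" by blast
      qed
      have sub: "?A \<subseteq> Pow (space M)" using GM sets.sets_into_space by blast
      have JM: "sigma_sets (space M) ?A \<subseteq> sets M" using J by (auto simp: subalgebra_def)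
      have all: "(LINT x:W|M. ?r x) = measure M (S \<inter> W)" if W: "W \<in> sigma_sets (space M) ?A" for W
        using stable sub W
      proof (induction rule: sigma_sets_induct_disjoint)
        case (basic A) thus ?case using gen by blast
      next
        case empty show ?case by (simp add: set_lebesgue_integral_def)
      next
        case (compl A)
        have A: "A \<in> sets M" using compl JM by blast
        have "space M \<in> sets G" "space M \<in> sets H" using sets.top[of G] sets.top[of H] sp by auto
        hence "(LINT x:space M|M. ?r x) = measure M S"
          using gen[of "space M" "space M"] sets.sets_into_space[OF FM[OF S]] by (simp add: Int_absorb2)
        moreover have "(LINT x:space M|M. ?r x) = (LINT x:A|M. ?r x) + (LINT x:space M - A|M. ?r x)"
          using set_integral_Un[of A "space M - A" M ?r] si[OF A] si[of "space M - A"] A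
            sets.sets_into_space[OF A] by (simp add: Un_absorb1)
        moreover have "measure M S = measure M (S \<inter> A) + measure M (S \<inter> (space M - A))"
        proof -
          have "S \<inter> (space M - A) = S - A" using sets.sets_into_space[OF FM[OF S]] by auto
          moreover have "measure M (S \<inter> A \<union> (S - A)) = measure M (S \<inter> A) + measure M (S - A)"
            by (rule finite_measure_Union) (use FM[OF S] A in auto)
          moreover have "S \<inter> A \<union> (S - A) = S" by auto
          ultimately show ?thesis by simp
        qed
        ultimately show ?case using compl by simp
      next
        case (union A)
        have A: "A i \<in> sets M" for i using union JM by auto
        have "(LINT x:(\<Union>i. A i)|M. ?r x) = (\<Sum>i. LINT x:A i|M. ?r x)"
          by (rule lebesgue_integral_countable_add) (use A union in \<open>auto simp: disjoint_family_on_def intro!: si\<close>)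
        also have "\<dots> = (\<Sum>i. measure M (S \<inter> A i))" using union by simp
        also have "\<dots> = measure M (\<Union>i. S \<inter> A i)"
          by (rule sums_unique[symmetric], rule finite_measure_UNION)
            (use A FM[OF S] union in \<open>auto simp: disjoint_family_on_def\<close>)
        finally show ?case by simp
      qed
      show "AE x in M. cond_prob_given M J S x = ?r x"
        by (rule cond_prob_given_eqI[OF M J(1) FM[OF S] rJ ri]) (use all J(2) in auto)
    qed
  next
    assume scr: "\<forall>S\<in>sets F. AE x in M. cond_prob_given M J S x = cond_prob_given M H S x"
    show "indep_given M F G H"
      unfolding indep_given_def
    proof (intro ballI)
      fix S T assume S: "S \<in> sets F" and T: "T \<in> sets G"
      let ?r = "cond_prob_given M H S" and ?rJ = "cond_prob_given M J S"
      have ri: "integrable M ?r" by (rule H.real_cond_exp_int(1)) (rule integrable_indicator_prob[OF M FM[OF S]])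
      have TJ: "indicator T \<in> borel_measurable J" using T GJ by auto
      have ST: "integrable M (indicator (S \<inter> T) :: _ \<Rightarrow> real)"
        by (rule integrable_indicator_prob[OF M]) (use FM[OF S] GM[OF T] in auto)
      have a1: "AE x in M. real_cond_exp M H (cond_prob_given M J (S \<inter> T)) x = cond_prob_given M H (S \<inter> T) x"
        by (rule H.real_cond_exp_nested_subalg[OF J(1) HJs ST])
      have a2: "AE x in M. cond_prob_given M J (S \<inter> T) x = indicator T x * ?rJ x"
        unfolding indicator_times_real
        by (rule J.real_cond_exp_mult[OF TJ]) (use FM[OF S] ST in \<open>auto simp: indicator_times_real\<close>)
      have "AE x in M. ?rJ x = ?r x" using scr S by blast
      with a2 have "AE x in M. cond_prob_given M J (S \<inter> T) x = ?r x * indicator T x"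
        by eventually_elim simp
      hence a3: "AE x in M. real_cond_exp M H (cond_prob_given M J (S \<inter> T)) x
          = real_cond_exp M H (\<lambda>x. ?r x * indicator T x) x"
        by (rule H.real_cond_exp_cong) (use GM[OF T] in auto)
      have a4: "AE x in M. real_cond_exp M H (\<lambda>x. ?r x * indicator T x) x = ?r x * cond_prob_given M H T x"
        by (rule H.real_cond_exp_mult)
          (use integrable_mult_indicator[OF GM[OF T] ri] GM[OF T] in \<open>auto simp: mult.commute\<close>)
      from a1 a3 a4 show "AE x in M. cond_prob_given M H (S \<inter> T) x = ?r x * cond_prob_given M H T x"
        by eventually_elim simp
    qed
  qed
qed

section \<open>Conditional independence along mixtures\<close>

text \<open>Bayes' rule for a change of measure: all conditional probabilities under \<open>P\<close> have the
  denominator \<open>E\<^sub>Q[h | H]\<close>, which clears to an identity that is quadratic in \<open>h\<close> and holds almost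
  everywhere with respect to \<open>Q\<close>.\<close>

lemma cond_prob_product_density_iff:
  fixes h :: "'a \<Rightarrow> real"
  assumes Q: "prob_space Q" and P: "prob_space P" "P = density Q (\<lambda>x. ennreal (h x))"
    and h: "h \<in> borel_measurable Q" "\<And>x. 0 \<le> h x" "integrable Q h"
    and H: "subalgebra Q H" and ST: "S \<in> sets Q" "T \<in> sets Q"
  defines "e \<equiv> \<lambda>A. real_cond_exp Q H (\<lambda>x. h x * indicator A x)"
  shows "(AE x in P. cond_prob_given P H (S \<inter> T) x = cond_prob_given P H S x * cond_prob_given P H T x) \<longleftrightarrow>
    (AE x in Q. e (S \<inter> T) x * e (space Q) x = e S x * e T x)"
proof -
  have HP: "subalgebra P H" using H P by (auto simp: subalgebra_def)
  interpret Q: sigma_finite_subalgebra Q H by (rule subalgebra_prob[OF Q H])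
  interpret P: sigma_finite_subalgebra P H by (rule subalgebra_prob[OF P(1) HP])
  define d where "d = real_cond_exp Q H h"
  have sp: "space P = space Q" "sets P = sets Q" "space H = space Q" using P H by (auto simp: subalgebra_def)
  have HQ: "U \<in> sets Q" if "U \<in> sets H" for U using that H by (auto simp: subalgebra_def)
  have hi: "integrable Q (\<lambda>x. h x * indicator A x)" if "A \<in> sets Q" for A
    using integrable_mult_indicator[OF that h(3)] by (simp add: mult.commute)
  have intP: "(LINT x:U|P. f x) = (LINT x:U|Q. h x * f x)" if "f \<in> borel_measurable Q" "U \<in> sets Q" for f :: "'a \<Rightarrow> real" and U
    unfolding set_lebesgue_integral_def P(2)
    by (subst integral_real_density) (use that h in \<open>auto intro!: Bochner_Integration.integral_cong simp: mult_ac\<close>)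
  have key: "AE x in Q. cond_prob_given P H A x * d x = e A x" if A: "A \<in> sets Q" for A
  proof -
    let ?r = "cond_prob_given P H A"
    have rH: "?r \<in> borel_measurable H" by simp
    have rQ: "?r \<in> borel_measurable Q" by (rule measurable_from_subalg[OF H rH])
    have "integrable P ?r"
      by (rule P.real_cond_exp_int(1)) (use integrable_indicator_prob[OF P(1)] A sp in auto)
    hence i: "integrable Q (\<lambda>x. ?r x * h x)"
      unfolding P(2) by (subst (asm) integrable_real_density) (use rQ h in \<open>auto simp: mult.commute P(2)\<close>)
    have a: "AE x in Q. real_cond_exp Q H (\<lambda>x. ?r x * h x) x = ?r x * d x"
      unfolding d_def by (rule Q.real_cond_exp_mult) (use i rH h in auto)
    have "AE x in Q. real_cond_exp Q H (\<lambda>x. ?r x * h x) x = e A x"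
    proof (rule Q.real_cond_exp_charact)
      fix U assume U: "U \<in> sets H"
      have "(LINT x:U|Q. ?r x * h x) = (LINT x:U|P. ?r x)"
        using intP[OF rQ HQ[OF U]] by (simp add: mult.commute)
      also have "\<dots> = (LINT x:U|P. indicator A x)"
        by (rule P.real_cond_exp_intA[symmetric]) (use U integrable_indicator_prob[OF P(1)] A sp in auto)
      also have "\<dots> = (LINT x:U|Q. h x * indicator A x)"
        by (rule intP) (use A HQ[OF U] in auto)
      also have "\<dots> = (LINT x:U|Q. e A x)"
        unfolding e_def by (rule Q.real_cond_exp_intA[OF hi[OF A] U])
      finally show "(LINT x:U|Q. ?r x * h x) = (LINT x:U|Q. e A x)" .
    qed (use i Q.real_cond_exp_int(1)[OF hi[OF A]] in \<open>auto simp: e_def\<close>)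
    with a show ?thesis by eventually_elim simp
  qed
  have eS: "AE x in Q. e (space Q) x = d x"
    unfolding e_def d_def by (rule Q.real_cond_exp_cong) (use h in auto)
  have STm: "S \<inter> T \<in> sets Q" using ST by auto
  let ?r = "\<lambda>A. cond_prob_given P H A"
  have AEP: "(AE x in P. \<phi> x) \<longleftrightarrow> (AE x in Q. h x > 0 \<longrightarrow> \<phi> x)" for \<phi>
    unfolding P(2) by (subst AE_density) (use h in auto)
  show ?thesis
  proof
    assume ci: "AE x in P. ?r (S \<inter> T) x = ?r S x * ?r T x"
    \<comment> \<open>\<open>N\<close> belongs to \<open>H\<close> and is null for \<open>P\<close>, so the denominator \<open>d\<close> vanishes almost everywhere on it.\<close>
    define N where "N = {x \<in> space H. ?r (S \<inter> T) x \<noteq> ?r S x * ?r T x}"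
    have NH: "N \<in> sets H" unfolding N_def by measurable
    have z: "AE x in Q. indicator N x * h x = 0"
      using ci[unfolded AEP] by eventually_elim (use h(2) in \<open>auto simp: N_def indicator_def order.order_iff_strict\<close>)
    have "AE x in Q. real_cond_exp Q H (\<lambda>x. indicator N x * h x) x = real_cond_exp Q H (\<lambda>x. 0) x"
      by (rule Q.real_cond_exp_cong[OF z]) (use h HQ[OF NH] in auto)
    moreover have "AE x in Q. real_cond_exp Q H (\<lambda>x. 0) x = (0::real)"
      by (rule Q.real_cond_exp_F_meas) auto
    moreover have "AE x in Q. real_cond_exp Q H (\<lambda>x. indicator N x * h x) x = indicator N x * d x"
      unfolding d_def by (rule Q.real_cond_exp_mult) (use h NH hi[OF HQ[OF NH]] in \<open>auto simp: mult.commute\<close>)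
    ultimately have dN: "AE x in Q. indicator N x * d x = 0" by eventually_elim simp
    show "AE x in Q. e (S \<inter> T) x * e (space Q) x = e S x * e T x"
      using dN key[OF STm] key[OF ST(1)] key[OF ST(2)] eS AE_space
    proof eventually_elim
      case (elim x)
      show ?case
      proof (cases "x \<in> N")
        case True
        hence "d x = 0" using elim by simp
        thus ?thesis unfolding elim(5) elim(2-4)[symmetric] by simp
      next
        case False
        hence "?r (S \<inter> T) x = ?r S x * ?r T x" using elim sp by (simp add: N_def)
        thus ?thesis unfolding elim(5) elim(2-4)[symmetric] by simp
      qed
    qed
  next
    assume id: "AE x in Q. e (S \<inter> T) x * e (space Q) x = e S x * e T x"
    \<comment> \<open>Division by \<open>d\<close> is possible off \<open>Z\<close>, which is null for \<open>P\<close>.\<close>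
    define Z where "Z = {x \<in> space H. d x = 0}"
    have ZH: "Z \<in> sets H" unfolding Z_def d_def by measurable
    have "(\<integral>x. indicator Z x * d x \<partial>Q) = (\<integral>x. indicator Z x * h x \<partial>Q)"
      unfolding d_def by (rule Q.real_cond_exp_intg(2)) (use h ZH hi[OF HQ[OF ZH]] in \<open>auto simp: mult.commute\<close>)
    moreover have "(\<lambda>x. indicator Z x * d x) = (\<lambda>x. 0)" by (auto simp: Z_def indicator_def fun_eq_iff)
    ultimately have "(\<integral>x. h x * indicator Z x \<partial>Q) = 0" by (simp add: mult.commute)
    hence hZ: "AE x in Q. h x * indicator Z x = 0"
      using integral_nonneg_eq_0_iff_AE[OF hi[OF HQ[OF ZH]]] h(2) by simp
    show "AE x in P. ?r (S \<inter> T) x = ?r S x * ?r T x"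
      unfolding AEP using id hZ key[OF STm] key[OF ST(1)] key[OF ST(2)] eS AE_space
    proof eventually_elim
      case (elim x)
      show ?case
      proof
        assume "0 < h x"
        hence "d x \<noteq> 0" using elim sp by (auto simp: Z_def indicator_def)
        moreover have "?r (S \<inter> T) x * d x * d x = ?r S x * d x * (?r T x * d x)"
          unfolding elim(3-5) using elim(1) unfolding elim(6) .
        ultimately show "?r (S \<inter> T) x = ?r S x * ?r T x" by simp
      qed
    qed
  qed
qed

lemma quadratic_identity_extends:
  fixes a0 a1 b0 b1 c0 c1 d0 d1 :: real
  assumes "r \<noteq> s" "r \<noteq> t" "s \<noteq> t"
    and z: "\<And>u. u \<in> {r, s, t} \<Longrightarrow>
      ((1 - u) * a0 + u * a1) * ((1 - u) * d0 + u * d1) = ((1 - u) * b0 + u * b1) * ((1 - u) * c0 + u * c1)"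
  shows "a1 * d1 = b1 * c1"
proof -
  define A where "A = a0 * d0 - b0 * c0"
  define B where "B = a0 * (d1 - d0) + (a1 - a0) * d0 - b0 * (c1 - c0) - (b1 - b0) * c0"
  define C where "C = (a1 - a0) * (d1 - d0) - (b1 - b0) * (c1 - c0)"
  have q: "((1 - u) * a0 + u * a1) * ((1 - u) * d0 + u * d1) - ((1 - u) * b0 + u * b1) * ((1 - u) * c0 + u * c1)
    = A + B * u + C * (u * u)" for u
    by (simp add: A_def B_def C_def algebra_simps)
  have q0: "A + B * u + C * (u * u) = 0" if "u \<in> {r, s, t}" for u
    using z[OF that] q[of u] by simp
  have "(r - s) * (B + C * (r + s)) = 0"
    using q0[of r] q0[of s] by (simp add: algebra_simps)
  moreover have "(r - t) * (B + C * (r + t)) = 0"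
    using q0[of r] q0[of t] by (simp add: algebra_simps)
  ultimately have bc: "B + C * (r + s) = 0" "B + C * (r + t) = 0" using assms(1,2) by auto
  moreover have "C * (s - t) = (B + C * (r + s)) - (B + C * (r + t))" by (simp add: algebra_simps)
  ultimately have "C * (s - t) = 0" by simp
  hence "C = 0" using assms(3) by simp
  moreover have "B = 0" using bc \<open>C = 0\<close> by simp
  moreover have "A = 0" using q0[of r] bc \<open>C = 0\<close> by simp
  ultimately show ?thesis using q[of 1] by simp
qed

lemma RN_density_real:
  assumes Q: "prob_space Q" and P: "prob_space P" "sets P = sets Q" "absolutely_continuous Q P"
  obtains h :: "'a \<Rightarrow> real" where "h \<in> borel_measurable Q" "\<And>x. 0 \<le> h x" "integrable Q h"
    "P = density Q (\<lambda>x. ennreal (h x))"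
proof -
  interpret Q: prob_space Q by fact
  interpret P: prob_space P by fact
  obtain h where h: "h \<in> borel_measurable Q" "AE x in Q. RN_deriv Q P x = ennreal (h x)" "\<And>x. 0 \<le> h x"
    using Q.real_RN_deriv[OF P.finite_measure_axioms P(3,2)] by metis
  have e: "P = density Q (\<lambda>x. ennreal (h x))"
  proof -
    have "density Q (RN_deriv Q P) = density Q (\<lambda>x. ennreal (h x))"
      by (rule density_cong) (use h in auto)
    thus ?thesis using Q.density_RN_deriv[OF P(3,2)] by simp
  qed
  have "(\<integral>\<^sup>+ x. ennreal (h x) \<partial>Q) = emeasure P (space Q)"
    using h unfolding e by (subst emeasure_density) (auto intro!: nn_integral_cong)
  also have "\<dots> = 1" using P.emeasure_space_1 sets_eq_imp_space_eq[OF P(2)] by simp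
  finally have "integrable Q h" using h by (intro integrableI_nonneg) auto
  with h e show ?thesis by (intro that[of h]) auto
qed

text \<open>Relative to the midpoint \<open>Q\<close>, conditional independence at \<open>t\<close> is the vanishing almost everywhere
  of a random polynomial of degree two in \<open>t\<close>. If it vanishes for three values, it vanishes at 1.\<close>

theorem finite_indep_given_mixture:
  assumes P: "\<And>t. t \<in> {0..1} \<Longrightarrow> prob_space (P t)" "\<And>t. t \<in> {0..1} \<Longrightarrow> sets (P t) = sets M"
    and aff: "\<And>t S. t \<in> {0..1} \<Longrightarrow> S \<in> sets M \<Longrightarrow>
        measure (P t) S = (1 - t) * measure (P 0) S + t * measure (P 1) S"
    and sub: "subalgebra M F" "subalgebra M G" "subalgebra M H"
    and not1: "\<not> indep_given (P 1) F G H"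
  shows "finite {t \<in> {0..1::real}. indep_given (P t) F G H}"
proof (rule ccontr)
  assume inf: "infinite {t \<in> {0..1::real}. indep_given (P t) F G H}" (is "infinite ?B")
  obtain R where R: "R \<subseteq> ?B" "card R = 3" using infinite_arbitrarily_large[OF inf] by blast
  then obtain r s t where rst: "R = {r, s, t}" "r \<noteq> s" "r \<noteq> t" "s \<noteq> t"
    by (auto simp: card_3_iff)
  define Q where "Q = P (1/2)"
  have Q: "prob_space Q" "sets Q = sets M" using P[of "1/2"] by (auto simp: Q_def)
  have spM: "space Q = space M" "space (P u) = space M" if "u \<in> {0..1}" for u
    using Q(2) P(2)[OF that] by (auto dest: sets_eq_imp_space_eq)
  have ac: "absolutely_continuous Q (P u)" if u: "u \<in> {0, 1}" for u
    unfolding absolutely_continuous_def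
  proof
    fix N assume N: "N \<in> null_sets Q"
    hence NM: "N \<in> sets M" using Q by auto
    have "measure Q N = 0" using N by (auto simp: null_sets_def measure_def)
    hence "measure (P 0) N + measure (P 1) N = 0" using aff[of "1/2" N] NM by (simp add: Q_def)
    hence "measure (P 0) N = 0" "measure (P 1) N = 0"
      using measure_nonneg[of "P 0" N] measure_nonneg[of "P 1" N] by linarith+
    hence "measure (P u) N = 0" using u by auto
    moreover have "prob_space (P u)" "sets (P u) = sets M" using P[of u] u by auto
    ultimately show "N \<in> null_sets (P u)" using NM
      by (auto simp: null_sets_def finite_measure.emeasure_eq_measure[OF prob_space.finite_measure])
  qed
  have P01: "prob_space (P 0)" "prob_space (P 1)" "sets (P 0) = sets Q" "sets (P 1) = sets Q"
    using P[of 0] P[of 1] Q by auto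
  obtain h0 where h0: "h0 \<in> borel_measurable Q" "\<And>x. 0 \<le> (h0 x :: real)" "integrable Q h0"
    "P 0 = density Q (\<lambda>x. ennreal (h0 x))"
    by (rule RN_density_real[OF Q(1) P01(1,3) ac]) auto
  obtain h1 where h1: "h1 \<in> borel_measurable Q" "\<And>x. 0 \<le> (h1 x :: real)" "integrable Q h1"
    "P 1 = density Q (\<lambda>x. ennreal (h1 x))"
    by (rule RN_density_real[OF Q(1) P01(2,4) ac]) auto
  define h where "h u x = (1 - u) * h0 x + u * h1 x" for u x
  have h: "h u \<in> borel_measurable Q" "integrable Q (h u)" for u
    unfolding h_def using h0 h1 by auto
  have hpos: "0 \<le> h u x" if "u \<in> {0..1}" for u x using that h0 h1 by (auto simp: h_def)
  have dens: "P u = density Q (\<lambda>x. ennreal (h u x))" if u: "u \<in> {0..1}" for u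
  proof (rule measure_eqI)
    show "sets (P u) = sets (density Q (\<lambda>x. ennreal (h u x)))" using P(2)[OF u] Q by simp
    fix S assume "S \<in> sets (P u)"
    hence S: "S \<in> sets M" "S \<in> sets Q" using P(2)[OF u] Q by auto
    have m: "ennreal (measure (P v) S) = emeasure (P v) S" if "v \<in> {0..1}" for v
      using finite_measure.emeasure_eq_measure[OF prob_space.finite_measure[OF P(1)[OF that]]] by simp
    have "emeasure (P u) S = ennreal ((1 - u) * measure (P 0) S + u * measure (P 1) S)"
      using aff[OF u S(1)] m[OF u] by simp
    also have "\<dots> = ennreal (1 - u) * emeasure (P 0) S + ennreal u * emeasure (P 1) S"
      using u m[of 0] m[of 1] by (simp add: ennreal_plus ennreal_mult)
    also have "\<dots> = (\<integral>\<^sup>+x. ennreal (1 - u) * (ennreal (h0 x) * indicator S x) \<partial>Q)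
        + (\<integral>\<^sup>+x. ennreal u * (ennreal (h1 x) * indicator S x) \<partial>Q)"
      unfolding h0(4) h1(4) using S h0 h1 by (simp add: emeasure_density nn_integral_cmult)
    also have "\<dots> = (\<integral>\<^sup>+x. ennreal (1 - u) * (ennreal (h0 x) * indicator S x)
        + ennreal u * (ennreal (h1 x) * indicator S x) \<partial>Q)"
      by (rule nn_integral_add[symmetric]) (use S h0 h1 in auto)
    also have "\<dots> = (\<integral>\<^sup>+x. ennreal (h u x) * indicator S x \<partial>Q)"
      by (rule nn_integral_cong)
        (use u h0 h1 in \<open>auto simp: h_def indicator_def ennreal_mult ennreal_plus\<close>)
    also have "\<dots> = emeasure (density Q (\<lambda>x. ennreal (h u x))) S"
      using S h by (simp add: emeasure_density)
    finally show "emeasure (P u) S = emeasure (density Q (\<lambda>x. ennreal (h u x))) S" .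
  qed
  have HQ: "subalgebra Q H" using sub(3) Q spM(1)[of 0] by (auto simp: subalgebra_def)
  interpret Q: sigma_finite_subalgebra Q H by (rule subalgebra_prob[OF Q(1) HQ])
  define e where "e u A = real_cond_exp Q H (\<lambda>x. h u x * indicator A x)" for u A
  have hi: "integrable Q (\<lambda>x. f x * indicator A x)" if "A \<in> sets Q" "integrable Q f" for A and f :: "_ \<Rightarrow> real"
    using integrable_mult_indicator[OF that] by (simp add: mult.commute)
  have eaff: "AE x in Q. e u A x = (1 - u) * e 0 A x + u * e 1 A x" if A: "A \<in> sets Q" for u A
  proof -
    have i: "integrable Q (\<lambda>x. h v x * indicator A x)" for v by (rule hi[OF A h(2)])
    have eq: "(\<lambda>x. h u x * indicator A x) = (\<lambda>x. (1 - u) * (h 0 x * indicator A x) + u * (h 1 x * indicator A x))"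
      by (auto simp: h_def fun_eq_iff algebra_simps)
    have "AE x in Q. e u A x = real_cond_exp Q H (\<lambda>x. (1 - u) * (h 0 x * indicator A x)) x
        + real_cond_exp Q H (\<lambda>x. u * (h 1 x * indicator A x)) x"
      unfolding e_def eq by (rule Q.real_cond_exp_add) (use i in auto)
    moreover have "AE x in Q. real_cond_exp Q H (\<lambda>x. (1 - u) * (h 0 x * indicator A x)) x = (1 - u) * e 0 A x"
      unfolding e_def by (rule Q.real_cond_exp_cmult) (rule i)
    moreover have "AE x in Q. real_cond_exp Q H (\<lambda>x. u * (h 1 x * indicator A x)) x = u * e 1 A x"
      unfolding e_def by (rule Q.real_cond_exp_cmult) (rule i)
    ultimately show ?thesis by eventually_elim simp
  qed
  have "indep_given (P 1) F G H"
    unfolding indep_given_def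
  proof (intro ballI)
    fix S T assume S: "S \<in> sets F" and T: "T \<in> sets G"
    have SQ: "S \<in> sets Q" "T \<in> sets Q" "S \<inter> T \<in> sets Q" "space Q \<in> sets Q"
      using S T sub Q by (auto simp: subalgebra_def)
    note iff = cond_prob_product_density_iff[OF Q(1) P(1) dens h(1) hpos h(2) HQ SQ(1,2), folded e_def]
    have z: "AE x in Q. e u (S \<inter> T) x * e u (space Q) x = e u S x * e u T x" if "u \<in> {r, s, t}" for u
    proof -
      have u: "u \<in> {0..1}" "indep_given (P u) F G H" using that R rst by auto
      show ?thesis
        using iff[OF u(1) u(1) u(1)] u(2) S T unfolding indep_given_def by blast
    qed
    have "AE x in Q. e 1 (S \<inter> T) x * e 1 (space Q) x = e 1 S x * e 1 T x"
    proof -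
      have "AE x in Q. \<forall>u\<in>{r, s, t}. e u (S \<inter> T) x * e u (space Q) x = e u S x * e u T x"
        by (subst AE_finite_all) (use z in auto)
      moreover have "AE x in Q. \<forall>A\<in>{S, T, S \<inter> T, space Q}. \<forall>u\<in>{r, s, t}. e u A x = (1 - u) * e 0 A x + u * e 1 A x"
        by (subst AE_finite_all, simp, intro ballI, subst AE_finite_all, simp)
           (use eaff SQ in blast)
      ultimately show ?thesis
      proof eventually_elim
        case (elim x)
        show ?case
          by (rule quadratic_identity_extends[OF rst(2-4), where ?a0.0 = "e 0 (S \<inter> T) x" and ?d0.0 = "e 0 (space Q) x"
              and ?b0.0 = "e 0 S x" and ?c0.0 = "e 0 T x"]) (use elim in auto)
      qed
    qed
    thus "AE x in P 1. cond_prob_given (P 1) H (S \<inter> T) x = cond_prob_given (P 1) H S x * cond_prob_given (P 1) H T x"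
      using iff[of 1] by auto
  qed
  with not1 show False by blast
qed

section \<open>Conditional independence and total variation\<close>

text \<open>A function with values in the unit interval is, up to \<open>1 / k\<close>, the average of the
  indicators of its superlevel sets at the levels \<open>j / k\<close>.\<close>

lemma integral_diff_le_of_events:
  fixes g :: "'a \<Rightarrow> real"
  assumes P: "prob_space P" and Q: "prob_space Q" "sets Q = sets P"
    and ev: "\<And>S. S \<in> sets P \<Longrightarrow> \<bar>measure P S - measure Q S\<bar> \<le> \<epsilon>"
    and g: "g \<in> borel_measurable P" "\<And>x. x \<in> space P \<Longrightarrow> 0 \<le> g x" "\<And>x. x \<in> space P \<Longrightarrow> g x \<le> 1"
  shows "\<bar>(\<integral>x. g x \<partial>P) - (\<integral>x. g x \<partial>Q)\<bar> \<le> \<epsilon>"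
proof (rule field_le_epsilon)
  interpret P: prob_space P by fact
  interpret Q: prob_space Q by fact
  have sp: "space Q = space P" using Q by (auto dest: sets_eq_imp_space_eq)
  fix \<eta> :: real assume "\<eta> > 0"
  then obtain k :: nat where k: "2 / \<eta> < real k" using reals_Archimedean2 by blast
  have k0: "k > 0" using k \<open>\<eta> > 0\<close> by (cases k) (auto simp: field_simps)
  define A where "A j = {x \<in> space P. real j / real k \<le> g x}" for j
  have A: "A j \<in> sets P" for j unfolding A_def using g by measurable
  define s where "s x = (\<Sum>j=1..k. indicator (A j) x / real k)" for x
  have close: "\<bar>g x - s x\<bar> \<le> 1 / real k" if x: "x \<in> space P" for x
  proof -
    define l where "l = nat \<lfloor>g x * k\<rfloor>"
    have l0: "real l \<le> g x * k" "g x * k < real l + 1"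
      using g(2)[OF x] by (auto simp: l_def)
    have "g x * real k \<le> 1 * real k" by (rule mult_right_mono) (use g(3)[OF x] in auto)
    hence lk: "l \<le> k" using l0 by linarith
    have "indicator (A j) x = (if j \<le> l then 1 else 0 :: real)" for j
    proof -
      have "x \<in> A j \<longleftrightarrow> real j \<le> g x * k" using x k0 by (simp add: A_def field_simps)
      also have "\<dots> \<longleftrightarrow> j \<le> l" using l0 by linarith
      finally show ?thesis by (simp add: indicator_def)
    qed
    hence "s x = (\<Sum>j\<in>{1..k}. (if j \<le> l then 1 else 0) / real k)" by (simp add: s_def)
    also have "\<dots> = (\<Sum>j\<in>{1..l}. 1 / real k)"
      by (rule sum.mono_neutral_cong_right) (use lk in auto)
    also have "\<dots> = real l / real k" by simp
    finally have "s x = real l / real k" .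
    thus ?thesis using l0 k0 by (simp add: field_simps abs_le_iff)
  qed
  have close_int: "\<bar>(\<integral>x. g x \<partial>N) - (\<Sum>j=1..k. measure N (A j) / real k)\<bar> \<le> 1 / real k"
    if N: "prob_space N" "sets N = sets P" for N
  proof -
    interpret N: prob_space N by fact
    have sN: "space N = space P" using N by (auto dest: sets_eq_imp_space_eq)
    have gi: "integrable N g"
      by (rule N.integrable_const_bound[of _ 1]) (use g sN N in \<open>auto cong: measurable_cong_sets\<close>)
    have AN: "A j \<in> sets N" for j using A N by simp
    have si: "integrable N s" unfolding s_def using AN by (auto simp: less_top[symmetric])
    have "(\<integral>x. s x \<partial>N) = (\<Sum>j=1..k. measure N (A j) / real k)"
      unfolding s_def using AN sets.sets_into_space[OF AN] by (simp add: less_top[symmetric] Int_absorb2)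
    hence "(\<integral>x. g x \<partial>N) - (\<Sum>j=1..k. measure N (A j) / real k) = (\<integral>x. g x - s x \<partial>N)"
      using gi si by simp
    also have "\<bar>\<dots>\<bar> \<le> (\<integral>x. \<bar>g x - s x\<bar> \<partial>N)" by (rule integral_abs_bound)
    also have "\<dots> \<le> (\<integral>x. 1 / real k \<partial>N)"
      by (rule integral_mono) (use gi si close sN in auto)
    also have "\<dots> = 1 / real k" by (simp add: N.prob_space)
    finally show ?thesis .
  qed
  have "\<bar>(\<Sum>j=1..k. measure P (A j) / real k) - (\<Sum>j=1..k. measure Q (A j) / real k)\<bar>
     \<le> (\<Sum>j=1..k. \<bar>measure P (A j) / real k - measure Q (A j) / real k\<bar>)"
    unfolding sum_subtractf[symmetric] by (rule sum_abs)
  also have "\<dots> \<le> (\<Sum>j=1..k. \<epsilon> / real k)"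
  proof (rule sum_mono)
    fix j show "\<bar>measure P (A j) / real k - measure Q (A j) / real k\<bar> \<le> \<epsilon> / real k"
      using ev[OF A] k0 by (simp flip: diff_divide_distrib add: divide_right_mono)
  qed
  also have "\<dots> = \<epsilon>" using k0 by simp
  finally have "\<bar>(\<integral>x. g x \<partial>P) - (\<integral>x. g x \<partial>Q)\<bar> \<le> \<epsilon> + 1 / real k + 1 / real k"
    using close_int[OF P refl] close_int[OF Q] by linarith
  moreover have "1 / real k + 1 / real k \<le> \<eta>" using k k0 \<open>\<eta> > 0\<close> by (simp add: field_simps)
  ultimately show "\<bar>(\<integral>x. g x \<partial>P) - (\<integral>x. g x \<partial>Q)\<bar> \<le> \<epsilon> + \<eta>" by linarith
qed

text \<open>Versions of the conditional probability of \<open>S\<close> under two measures are tested against the event on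
  which one exceeds the other; both integrate there to the probability of \<open>S\<close>, up to the distance.\<close>

lemma cond_prob_L1_continuous:
  fixes f g :: "'a \<Rightarrow> real"
  assumes P: "prob_space P" and Q: "prob_space Q" "sets Q = sets P"
    and ev: "\<And>S. S \<in> sets P \<Longrightarrow> \<bar>measure P S - measure Q S\<bar> \<le> \<epsilon>"
    and F: "subalgebra P F" and S: "S \<in> sets P"
    and fv: "cond_prob_version P F S f" and gv: "cond_prob_version Q F S g"
  shows "(\<integral>x. \<bar>f x - g x\<bar> \<partial>P) \<le> 4 * \<epsilon>"
proof -
  interpret P: prob_space P by fact
  have f: "f \<in> borel_measurable F" "\<And>x. 0 \<le> f x" "\<And>x. f x \<le> 1"
       "\<And>U. U \<in> sets F \<Longrightarrow> (LINT x:U|P. f x) = measure P (S \<inter> U)"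
    and g: "g \<in> borel_measurable F" "\<And>x. 0 \<le> g x" "\<And>x. g x \<le> 1"
       "\<And>U. U \<in> sets F \<Longrightarrow> (LINT x:U|Q. g x) = measure Q (S \<inter> U)"
    using fv gv by (auto simp: cond_prob_version_def)
  have fg[measurable]: "f \<in> borel_measurable P" "g \<in> borel_measurable P"
    by (rule measurable_from_subalg[OF F f(1)], rule measurable_from_subalg[OF F g(1)])
  have fi: "integrable P f" "integrable P g"
    by (rule P.integrable_const_bound[of _ 1]; use f g in auto)+
  have spF: "space F = space P" using F by (simp add: subalgebra_def)
  have diff: "\<bar>LINT x:U|P. f x - g x\<bar> \<le> 2 * \<epsilon>" if U: "U \<in> sets F" for U
  proof -
    have UP: "U \<in> sets P" using U F by (auto simp: subalgebra_def)
    have "\<bar>(\<integral>x. indicator U x * g x \<partial>P) - (\<integral>x. indicator U x * g x \<partial>Q)\<bar> \<le> \<epsilon>"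
      by (rule integral_diff_le_of_events[OF P Q ev]) (use UP g in \<open>auto simp: indicator_def\<close>)
    hence "\<bar>(LINT x:U|P. g x) - measure Q (S \<inter> U)\<bar> \<le> \<epsilon>"
      using g(4)[OF U] by (simp add: set_lebesgue_integral_def)
    moreover have "\<bar>measure P (S \<inter> U) - measure Q (S \<inter> U)\<bar> \<le> \<epsilon>" by (rule ev) (use S UP in auto)
    moreover have "(LINT x:U|P. f x - g x) = (LINT x:U|P. f x) - (LINT x:U|P. g x)"
      by (rule set_integral_diff) (use integrable_mult_indicator[OF UP fi(1)] integrable_mult_indicator[OF UP fi(2)] in \<open>auto simp: set_integrable_def\<close>)
    ultimately show ?thesis using f(4)[OF U] by linarith
  qed
  define D where "D = {x \<in> space F. g x \<le> f x}"
  have D: "D \<in> sets F" "space F - D \<in> sets F" unfolding D_def using f(1) g(1) by measurable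
  have DP: "D \<in> sets P" "space F - D \<in> sets P" using D F by (auto simp: subalgebra_def)
  have i: "integrable P (\<lambda>x. indicator U x * (f x - g x))" if "U \<in> sets P" for U
    using integrable_mult_indicator[OF that, of "\<lambda>x. f x - g x"] fi by simp
  have "(\<integral>x. \<bar>f x - g x\<bar> \<partial>P)
     = (\<integral>x. indicator D x * (f x - g x) - indicator (space F - D) x * (f x - g x) \<partial>P)"
    by (rule Bochner_Integration.integral_cong) (auto simp: D_def indicator_def spF)
  also have "\<dots> = (LINT x:D|P. f x - g x) - (LINT x:space F - D|P. f x - g x)"
    using i[OF DP(1)] i[OF DP(2)] by (simp add: set_lebesgue_integral_def)
  also have "\<dots> \<le> 4 * \<epsilon>" using diff[OF D(1)] diff[OF D(2)] by linarith
  finally show ?thesis .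
qed

text \<open>The defect \<open>P(S \<inter> T | H) - P(S | H) P(T | H)\<close> is continuous in mean: passing to \<open>Q\<close> costs
  \<open>4 \<epsilon>\<close> for each of the three conditional probabilities, and the null set of \<open>Q\<close> on which its own product
  rule fails has \<open>P\<close>-measure at most \<open>\<epsilon>\<close>.\<close>

theorem indep_given_tv_closed:
  assumes P: "prob_space P" and sub: "subalgebra P F" "subalgebra P G" "subalgebra P H"
    and lim: "\<And>\<epsilon>. \<epsilon> > 0 \<Longrightarrow> \<exists>Q. prob_space Q \<and> sets Q = sets P \<and> indep_given Q F G H \<and>
       (\<forall>S\<in>sets P. \<bar>measure P S - measure Q S\<bar> \<le> \<epsilon>)"
  shows "indep_given P F G H"
  unfolding indep_given_def
proof (intro ballI)
  fix S T assume "S \<in> sets F" "T \<in> sets G"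
  hence S: "S \<in> sets P" and T: "T \<in> sets P" and ST: "S \<inter> T \<in> sets P"
    using sub by (auto simp: subalgebra_def)
  interpret P: prob_space P by fact
  obtain f where f: "cond_prob_version P H S f" "AE x in P. cond_prob_given P H S x = f x"
      using ex_cond_prob_version[OF P sub(3) S] by blast
  obtain g where g: "cond_prob_version P H T g" "AE x in P. cond_prob_given P H T x = g x"
      using ex_cond_prob_version[OF P sub(3) T] by blast
  obtain k where k: "cond_prob_version P H (S \<inter> T) k" "AE x in P. cond_prob_given P H (S \<inter> T) x = k x"
      using ex_cond_prob_version[OF P sub(3) ST] by blast
  have fgk[measurable]: "f \<in> borel_measurable P" "g \<in> borel_measurable P" "k \<in> borel_measurable P"
    using f(1) g(1) k(1) measurable_from_subalg[OF sub(3)] unfolding cond_prob_version_def by blast+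
  have rng: "0 \<le> f x" "f x \<le> 1" "0 \<le> g x" "g x \<le> 1" "0 \<le> k x" "k x \<le> 1" for x
    using f(1) g(1) k(1) by (auto simp: cond_prob_version_def)
  have bd: "\<bar>u - v * w\<bar> \<le> 1" if "0 \<le> u" "u \<le> 1" "0 \<le> v" "v \<le> 1" "0 \<le> w" "w \<le> 1" for u v w :: real
    using that mult_le_one[of v w] mult_nonneg_nonneg[of v w] by linarith
  have bound: "(\<integral>x. \<bar>k x - f x * g x\<bar> \<partial>P) \<le> 13 * \<epsilon>" if e: "\<epsilon> > 0" for \<epsilon>
  proof -
    obtain Q where Q: "prob_space Q" "sets Q = sets P" "indep_given Q F G H"
       and ev: "\<And>S. S\<in>sets P \<Longrightarrow> \<bar>measure P S - measure Q S\<bar> \<le> \<epsilon>" using lim[OF e] by blast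
    have spQ: "space Q = space P" using Q(2) by (auto dest: sets_eq_imp_space_eq)
    have HQ: "subalgebra Q H" using sub(3) Q spQ by (auto simp: subalgebra_def)
    have SQ: "S \<in> sets Q" "T \<in> sets Q" "S \<inter> T \<in> sets Q" using S T ST Q by auto
    obtain f' where f': "cond_prob_version Q H S f'" "AE x in Q. cond_prob_given Q H S x = f' x"
      using ex_cond_prob_version[OF Q(1) HQ SQ(1)] by blast
    obtain g' where g': "cond_prob_version Q H T g'" "AE x in Q. cond_prob_given Q H T x = g' x"
      using ex_cond_prob_version[OF Q(1) HQ SQ(2)] by blast
    obtain k' where k': "cond_prob_version Q H (S \<inter> T) k'" "AE x in Q. cond_prob_given Q H (S \<inter> T) x = k' x"
      using ex_cond_prob_version[OF Q(1) HQ SQ(3)] by blast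
    have [measurable]: "f' \<in> borel_measurable P" "g' \<in> borel_measurable P" "k' \<in> borel_measurable P"
      using f'(1) g'(1) k'(1) measurable_from_subalg[OF sub(3)] unfolding cond_prob_version_def by blast+
    have rng': "0 \<le> f' x" "f' x \<le> 1" "0 \<le> g' x" "g' x \<le> 1" "0 \<le> k' x" "k' x \<le> 1" for x
      using f'(1) g'(1) k'(1) by (auto simp: cond_prob_version_def)
    have "AE x in Q. cond_prob_given Q H (S \<inter> T) x = cond_prob_given Q H S x * cond_prob_given Q H T x"
      using Q(3) \<open>S \<in> sets F\<close> \<open>T \<in> sets G\<close> unfolding indep_given_def by blast
    hence aeQ: "AE x in Q. k' x = f' x * g' x" using f'(2) g'(2) k'(2) by eventually_elim simp
    define N where "N = {x \<in> space P. k' x \<noteq> f' x * g' x}"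
    have NP: "N \<in> sets P" unfolding N_def by measurable
    have "measure Q N = 0"
      using aeQ unfolding N_def spQ[symmetric] by (intro measure_eq_0_null_sets AE_iff_null_sets[THEN iffD2])
         (use NP Q spQ in \<open>auto simp: N_def\<close>)
    hence N: "measure P N \<le> \<epsilon>" using ev[OF NP] by simp
    have iI: "integrable P (\<lambda>x. \<bar>u x - v x\<bar>)" if "u \<in> borel_measurable P" "v \<in> borel_measurable P"
      "\<And>x. 0 \<le> u x" "\<And>x. u x \<le> (1::real)" "\<And>x. 0 \<le> v x" "\<And>x. v x \<le> 1" for u v
    proof (rule P.integrable_const_bound[of _ 1])
      have "\<bar>u x - v x\<bar> \<le> 1" for x using that(3-6)[of x] by linarith
      thus "AE x in P. norm \<bar>u x - v x\<bar> \<le> 1" by simp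
    qed (use that in auto)
    have kf: "(\<integral>x. \<bar>k x - k' x\<bar> \<partial>P) \<le> 4 * \<epsilon>"
      by (rule cond_prob_L1_continuous[OF P Q(1,2) ev sub(3) ST k(1) k'(1)])
    have ff: "(\<integral>x. \<bar>f x - f' x\<bar> \<partial>P) \<le> 4 * \<epsilon>"
      by (rule cond_prob_L1_continuous[OF P Q(1,2) ev sub(3) S f(1) f'(1)])
    have gg: "(\<integral>x. \<bar>g x - g' x\<bar> \<partial>P) \<le> 4 * \<epsilon>"
      by (rule cond_prob_L1_continuous[OF P Q(1,2) ev sub(3) T g(1) g'(1)])
    have ii: "integrable P (\<lambda>x. \<bar>k x - k' x\<bar>)" "integrable P (\<lambda>x. \<bar>f x - f' x\<bar>)" "integrable P (\<lambda>x. \<bar>g x - g' x\<bar>)"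
      by (rule iI; use rng rng' in auto)+
    have iN: "integrable P (indicator N :: _ \<Rightarrow> real)" by (rule integrable_indicator_prob[OF P NP])
    have "(\<integral>x. \<bar>k x - f x * g x\<bar> \<partial>P)
       \<le> (\<integral>x. \<bar>k x - k' x\<bar> + \<bar>f x - f' x\<bar> + \<bar>g x - g' x\<bar> + indicator N x \<partial>P)"
    proof (rule integral_mono)
      show "integrable P (\<lambda>x. \<bar>k x - f x * g x\<bar>)"
        by (rule P.integrable_const_bound[of _ 1]) (use bd rng in auto)
      show "integrable P (\<lambda>x. \<bar>k x - k' x\<bar> + \<bar>f x - f' x\<bar> + \<bar>g x - g' x\<bar> + indicator N x)"
        using ii iN by auto
      fix x assume x: "x \<in> space P"
      have "f x * g x - f' x * g' x = (f x - f' x) * g x + f' x * (g x - g' x)" by (simp add: algebra_simps)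
      moreover have "\<bar>(f x - f' x) * g x\<bar> \<le> \<bar>f x - f' x\<bar>"
        unfolding abs_mult using rng[of x] by (simp add: mult_left_le)
      moreover have "\<bar>f' x * (g x - g' x)\<bar> \<le> \<bar>g x - g' x\<bar>"
        unfolding abs_mult using rng'[of x] by (simp add: mult_left_le_one_le)
      moreover have "\<bar>k' x - f' x * g' x\<bar> \<le> indicator N x"
        using bd[OF rng'(5,6,1-4)[of x]] x by (auto simp: N_def indicator_def)
      ultimately show "\<bar>k x - f x * g x\<bar> \<le> \<bar>k x - k' x\<bar> + \<bar>f x - f' x\<bar> + \<bar>g x - g' x\<bar> + indicator N x"
        by linarith
    qed
    also have "\<dots> = (\<integral>x. \<bar>k x - k' x\<bar> \<partial>P) + (\<integral>x. \<bar>f x - f' x\<bar> \<partial>P) + (\<integral>x. \<bar>g x - g' x\<bar> \<partial>P) + measure P N"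
      using ii iN sets.sets_into_space[OF NP] by (simp add: Int_absorb2)
    also have "\<dots> \<le> 13 * \<epsilon>" using kf ff gg N by linarith
    finally show ?thesis .
  qed
  have "(\<integral>x. \<bar>k x - f x * g x\<bar> \<partial>P) \<le> 0"
  proof (rule field_le_epsilon)
    fix e :: real assume "e > 0" thus "(\<integral>x. \<bar>k x - f x * g x\<bar> \<partial>P) \<le> 0 + e" using bound[of "e / 13"] by simp
  qed
  moreover have "(\<integral>x. \<bar>k x - f x * g x\<bar> \<partial>P) \<ge> 0" by simp
  ultimately have "(\<integral>x. \<bar>k x - f x * g x\<bar> \<partial>P) = 0" by linarith
  moreover have "integrable P (\<lambda>x. \<bar>k x - f x * g x\<bar>)"
    by (rule P.integrable_const_bound[of _ 1]) (use bd rng in auto)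
  ultimately have "AE x in P. \<bar>k x - f x * g x\<bar> = 0"
    using integral_nonneg_eq_0_iff_AE[of P "\<lambda>x. \<bar>k x - f x * g x\<bar>"] by simp
  thus "AE x in P. cond_prob_given P H (S \<inter> T) x = cond_prob_given P H S x * cond_prob_given P H T x"
    using f(2) g(2) k(2) by eventually_elim simp
qed

section \<open>Conditional independence of coordinates\<close>

definition coord_algebra :: "('v \<Rightarrow> 'x metric) \<Rightarrow> 'v set \<Rightarrow> 'v set \<Rightarrow> ('v \<Rightarrow> 'x) measure" where
  "coord_algebra X V A = vimage_algebra (space (prod_space X V)) (\<lambda>x. restrict x A) (prod_space X A)"

lemma space_prod_space: "space (prod_space X A) = (\<Pi>\<^sub>E v\<in>A. mspace (X v))"
  by (simp add: prod_space_def space_PiM space_borel_metric)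

lemma space_coord_algebra [simp]: "space (coord_algebra X V A) = space (prod_space X V)"
  by (simp add: coord_algebra_def)

lemma restrict_measurable_prod_space:
  "A \<subseteq> V \<Longrightarrow> (\<lambda>x. restrict x A) \<in> prod_space X V \<rightarrow>\<^sub>M prod_space X A"
  unfolding prod_space_def by (rule measurable_restrict_subset)

lemma sets_coord_algebra:
  assumes "A \<subseteq> V"
  shows "sets (coord_algebra X V A) =
    {{x \<in> space (prod_space X V). restrict x A \<in> S} |S. S \<in> sets (prod_space X A)}"
proof -
  have "(\<lambda>x. restrict x A) \<in> space (prod_space X V) \<rightarrow> space (prod_space X A)"
    using measurable_space[OF restrict_measurable_prod_space[OF assms]] by blast
  moreover have "(\<lambda>x. restrict x A) -` S \<inter> space (prod_space X V) = {x \<in> space (prod_space X V). restrict x A \<in> S}" for S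
    by auto
  ultimately show ?thesis unfolding coord_algebra_def by (subst sets_vimage_algebra2) auto
qed

lemma restrict_measurable_coord_algebra:
  assumes "A \<subseteq> B" "B \<subseteq> V"
  shows "(\<lambda>x. restrict x A) \<in> coord_algebra X V B \<rightarrow>\<^sub>M prod_space X A"
proof -
  have "(\<lambda>x. restrict x B) \<in> coord_algebra X V B \<rightarrow>\<^sub>M prod_space X B"
    unfolding coord_algebra_def
    by (rule measurable_vimage_algebra1)
      (use measurable_space[OF restrict_measurable_prod_space[OF assms(2)]] in blast)
  from measurable_compose[OF this restrict_measurable_prod_space[OF assms(1)]]
  have "(\<lambda>x. restrict (restrict x B) A) \<in> coord_algebra X V B \<rightarrow>\<^sub>M prod_space X A" .
  moreover have "B \<inter> A = A" using assms by auto
  ultimately show ?thesis by (simp add: restrict_restrict)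
qed

lemma sets_coord_algebra_mono:
  assumes "A \<subseteq> B" "B \<subseteq> V"
  shows "sets (coord_algebra X V A) \<subseteq> sets (coord_algebra X V B)"
  using sets_image_in_sets[OF space_coord_algebra restrict_measurable_coord_algebra[OF assms]]
  by (simp add: coord_algebra_def)

lemma subalgebra_coord_algebra:
  assumes "A \<subseteq> V" "sets P = sets (prod_space X V)"
  shows "subalgebra P (coord_algebra X V A)"
proof -
  have sp: "space P = space (prod_space X V)" using assms(2) by (rule sets_eq_imp_space_eq)
  have "sets (coord_algebra X V A) \<subseteq> sets (prod_space X V)"
    using sets_image_in_sets[OF refl restrict_measurable_prod_space[OF assms(1)], of X]
    by (simp add: coord_algebra_def)
  thus ?thesis using assms sp by (simp add: subalgebra_def)
qed

lemma subalgebra_coord_algebra_mono: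
  "A \<subseteq> B \<Longrightarrow> B \<subseteq> V \<Longrightarrow> subalgebra (coord_algebra X V B) (coord_algebra X V A)"
  using sets_coord_algebra_mono[of A B V X] by (simp add: subalgebra_def)

lemma sets_coord_algebra_Un:
  assumes "B \<subseteq> V" "C \<subseteq> V"
  shows "sets (coord_algebra X V (B \<union> C)) = sigma_sets (space (prod_space X V))
    {T \<inter> U |T U. T \<in> sets (coord_algebra X V B) \<and> U \<in> sets (coord_algebra X V C)}"
    (is "_ = sigma_sets ?\<Omega> ?A")
proof
  have B: "sets (coord_algebra X V B) \<subseteq> sets (coord_algebra X V (B \<union> C))"
    by (rule sets_coord_algebra_mono) (use assms in auto)
  have C: "sets (coord_algebra X V C) \<subseteq> sets (coord_algebra X V (B \<union> C))"
    by (rule sets_coord_algebra_mono) (use assms in auto)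
  have "?A \<subseteq> sets (coord_algebra X V (B \<union> C))" using B C by blast
  from sets.sigma_sets_subset[OF this]
  show "sigma_sets ?\<Omega> ?A \<subseteq> sets (coord_algebra X V (B \<union> C))" by simp
  have A: "?A \<subseteq> Pow ?\<Omega>"
    using sets.sets_into_space[of _ "coord_algebra X V B"] by auto
  define N where "N = sigma ?\<Omega> ?A"
  have N: "space N = ?\<Omega>" "sets N = sigma_sets ?\<Omega> ?A" using A by (auto simp: N_def)
  have BN: "sets (coord_algebra X V B) \<subseteq> sets N"
  proof
    fix T assume T: "T \<in> sets (coord_algebra X V B)"
    have "T = T \<inter> ?\<Omega>" using sets.sets_into_space[OF T] by auto
    moreover have "?\<Omega> \<in> sets (coord_algebra X V C)" using sets.top[of "coord_algebra X V C"] by simp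
    ultimately have "T \<in> ?A" using T by blast
    thus "T \<in> sets N" unfolding N(2) by (rule sigma_sets.Basic)
  qed
  have CN: "sets (coord_algebra X V C) \<subseteq> sets N"
  proof
    fix U assume U: "U \<in> sets (coord_algebra X V C)"
    have "U = ?\<Omega> \<inter> U" using sets.sets_into_space[OF U] by auto
    moreover have "?\<Omega> \<in> sets (coord_algebra X V B)" using sets.top[of "coord_algebra X V B"] by simp
    ultimately have "U \<in> ?A" using U by blast
    thus "U \<in> sets N" unfolding N(2) by (rule sigma_sets.Basic)
  qed
  have comp: "(\<lambda>x. x v) \<in> N \<rightarrow>\<^sub>M borel_metric (X v)" if "v \<in> D" "D \<subseteq> V" "sets (coord_algebra X V D) \<subseteq> sets N" for v D
  proof -
    have "(\<lambda>x. restrict x D v) \<in> coord_algebra X V D \<rightarrow>\<^sub>M borel_metric (X v)"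
      by (rule measurable_compose[OF restrict_measurable_coord_algebra[OF order_refl that(2)]])
        (use that in \<open>auto simp: prod_space_def intro: measurable_component_singleton\<close>)
    hence "(\<lambda>x. x v) \<in> coord_algebra X V D \<rightarrow>\<^sub>M borel_metric (X v)" using that(1) by simp
    thus ?thesis using that(3) N(1) by (auto simp: measurable_def)
  qed
  have "(\<lambda>x. restrict x (B \<union> C)) \<in> N \<rightarrow>\<^sub>M prod_space X (B \<union> C)"
    unfolding prod_space_def
  proof (rule measurable_restrict)
    fix v assume "v \<in> B \<union> C"
    thus "(\<lambda>x. x v) \<in> N \<rightarrow>\<^sub>M borel_metric (X v)" using comp BN CN assms by blast
  qed
  from sets_image_in_sets[OF N(1) this]
  show "sets (coord_algebra X V (B \<union> C)) \<subseteq> sigma_sets ?\<Omega> ?A" by (simp add: coord_algebra_def N(2))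
qed

lemma cond_indep_iff_indep_given:
  assumes "sets P = sets (prod_space X V)" "A \<subseteq> V" "B \<subseteq> V"
  shows "cond_indep X P A B C \<longleftrightarrow>
    indep_given P (coord_algebra X V A) (coord_algebra X V B) (coord_algebra X V C)"
proof -
  have sp: "space P = space (prod_space X V)" using assms(1) by (rule sets_eq_imp_space_eq)
  have "{y \<in> \<Omega>. restrict y A \<in> S \<and> restrict y B \<in> T} = {y \<in> \<Omega>. restrict y A \<in> S} \<inter> {y \<in> \<Omega>. restrict y B \<in> T}"
    for S T and \<Omega> :: "('a \<Rightarrow> 'b) set" by auto
  thus ?thesis
    unfolding cond_indep_def indep_given_def sets_coord_algebra[OF assms(2)] sets_coord_algebra[OF assms(3)]
      Let_def sp coord_algebra_def[symmetric]
    by (simp add: setcompr_eq_image)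
qed

definition screened_off :: "('v \<Rightarrow> 'x metric) \<Rightarrow> 'v set \<Rightarrow> ('v \<Rightarrow> 'x) measure \<Rightarrow> 'v set \<Rightarrow> 'v set \<Rightarrow> 'v set \<Rightarrow> bool" where
  "screened_off X V P A B C \<longleftrightarrow> (\<forall>S\<in>sets (coord_algebra X V A). AE x in P.
     cond_prob_given P (coord_algebra X V (B \<union> C)) S x = cond_prob_given P (coord_algebra X V C) S x)"

text \<open>Tower property: if the finest of three algebras gives nothing beyond the coarsest, neither does the
  one in the middle.\<close>

lemma cond_prob_given_between:
  assumes P: "prob_space P" and J: "subalgebra P J" "subalgebra J J'" "subalgebra J' H" and S: "S \<in> sets P"
    and e: "AE x in P. cond_prob_given P J S x = cond_prob_given P H S x"
  shows "AE x in P. cond_prob_given P J' S x = cond_prob_given P H S x"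
proof -
  have J': "subalgebra P J'" and H: "subalgebra P H" using J by (auto simp: subalgebra_def)
  interpret J: sigma_finite_subalgebra P J by (rule subalgebra_prob[OF P J(1)])
  interpret H: sigma_finite_subalgebra P H by (rule subalgebra_prob[OF P H])
  show ?thesis
  proof (rule cond_prob_given_eqI[OF P J' S])
    show "cond_prob_given P H S \<in> borel_measurable J'"
      by (rule measurable_from_subalg[OF J(3)]) simp
    show "integrable P (cond_prob_given P H S)"
      by (rule H.real_cond_exp_int(1)) (rule integrable_indicator_prob[OF P S])
    fix U assume "U \<in> sets J'"
    hence U: "U \<in> sets J" "U \<in> sets P" using J by (auto simp: subalgebra_def)
    have "(LINT x:U|P. cond_prob_given P H S x) = (LINT x:U|P. cond_prob_given P J S x)"
      unfolding set_lebesgue_integral_def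
      by (rule integral_cong_AE) (use e U in auto)
    also have "\<dots> = (LINT x:U|P. indicator S x)"
      by (rule J.real_cond_exp_intA[symmetric]) (use U integrable_indicator_prob[OF P S] in auto)
    finally show "(LINT x:U|P. cond_prob_given P H S x) = measure P (S \<inter> U)"
      using set_integral_indicator_prob[OF P S U(2)] by simp
  qed
qed

context
  fixes X :: "'v \<Rightarrow> 'x metric" and V :: "'v set" and P :: "('v \<Rightarrow> 'x) measure"
  assumes P: "P \<in> space (prob_algebra (prod_space X V))"
begin

lemma prob_space_P: "prob_space P" and sets_P: "sets P = sets (prod_space X V)"
  using P by (auto simp: space_prob_algebra)

lemma sets_coord_algebra_P: "A \<subseteq> V \<Longrightarrow> S \<in> sets (coord_algebra X V A) \<Longrightarrow> S \<in> sets P"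
  using subalgebra_coord_algebra[OF _ sets_P] by (auto simp: subalgebra_def)

lemma cond_indep_iff_screened_off:
  assumes "A \<subseteq> V" "B \<subseteq> V" "C \<subseteq> V"
  shows "cond_indep X P A B C \<longleftrightarrow> screened_off X V P A B C"
  unfolding cond_indep_iff_indep_given[OF sets_P assms(1,2)] screened_off_def
proof (rule indep_given_iff_screening[OF prob_space_P])
  show "sets (coord_algebra X V (B \<union> C)) = sigma_sets (space P)
      {T \<inter> U |T U. T \<in> sets (coord_algebra X V B) \<and> U \<in> sets (coord_algebra X V C)}"
    unfolding sets_eq_imp_space_eq[OF sets_P] by (rule sets_coord_algebra_Un[OF assms(2,3)])
qed (intro subalgebra_coord_algebra sets_P Un_least assms)+

lemma screened_off_sym:
  assumes "A \<subseteq> V" "B \<subseteq> V" "C \<subseteq> V" "screened_off X V P A B C"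
  shows "screened_off X V P B A C"
  using assms indep_given_sym
  unfolding cond_indep_iff_screened_off[symmetric, OF assms(1-3)]
    cond_indep_iff_screened_off[symmetric, OF assms(2,1,3)]
    cond_indep_iff_indep_given[OF sets_P assms(1,2)] cond_indep_iff_indep_given[OF sets_P assms(2,1)]
  by blast

lemma screened_off_mono:
  assumes "screened_off X V P A B C" "A \<subseteq> V" "B \<subseteq> V" "C \<subseteq> V" "A' \<subseteq> A" "B' \<subseteq> B \<union> C"
  shows "screened_off X V P A' B' C"
  unfolding screened_off_def
proof
  fix S assume "S \<in> sets (coord_algebra X V A')"
  hence S: "S \<in> sets (coord_algebra X V A)" using sets_coord_algebra_mono[OF assms(5,2)] by blast
  show "AE x in P. cond_prob_given P (coord_algebra X V (B' \<union> C)) S x = cond_prob_given P (coord_algebra X V C) S x"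
  proof (rule cond_prob_given_between[OF prob_space_P])
    show "subalgebra P (coord_algebra X V (B \<union> C))"
      by (rule subalgebra_coord_algebra[OF _ sets_P]) (use assms in auto)
    show "subalgebra (coord_algebra X V (B \<union> C)) (coord_algebra X V (B' \<union> C))"
      by (rule subalgebra_coord_algebra_mono) (use assms in auto)
    show "subalgebra (coord_algebra X V (B' \<union> C)) (coord_algebra X V C)"
      by (rule subalgebra_coord_algebra_mono) (use assms in auto)
    show "S \<in> sets P" by (rule sets_coord_algebra_P[OF assms(2) S])
    show "AE x in P. cond_prob_given P (coord_algebra X V (B \<union> C)) S x = cond_prob_given P (coord_algebra X V C) S x"
      using assms(1) S by (auto simp: screened_off_def)
  qed
qed

lemma screened_off_contraction:
  assumes "screened_off X V P A B (D \<union> C)" "screened_off X V P A D C"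
  shows "screened_off X V P A (B \<union> D) C"
  unfolding screened_off_def
proof
  fix S assume S: "S \<in> sets (coord_algebra X V A)"
  have "AE x in P. cond_prob_given P (coord_algebra X V (B \<union> (D \<union> C))) S x = cond_prob_given P (coord_algebra X V (D \<union> C)) S x"
    using assms(1) S by (auto simp: screened_off_def)
  moreover have "AE x in P. cond_prob_given P (coord_algebra X V (D \<union> C)) S x = cond_prob_given P (coord_algebra X V C) S x"
    using assms(2) S by (auto simp: screened_off_def)
  ultimately show "AE x in P. cond_prob_given P (coord_algebra X V (B \<union> D \<union> C)) S x = cond_prob_given P (coord_algebra X V C) S x"
    unfolding Un_assoc by eventually_elim simp
qed

lemma screened_off_weak_union:
  assumes "screened_off X V P A (B \<union> D) C" "A \<subseteq> V" "B \<subseteq> V" "C \<subseteq> V" "D \<subseteq> V"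
  shows "screened_off X V P A B (D \<union> C)"
  unfolding screened_off_def
proof
  fix S assume S: "S \<in> sets (coord_algebra X V A)"
  have "screened_off X V P A D C" by (rule screened_off_mono[OF assms(1)]) (use assms in auto)
  hence "AE x in P. cond_prob_given P (coord_algebra X V (D \<union> C)) S x = cond_prob_given P (coord_algebra X V C) S x"
    using S by (auto simp: screened_off_def)
  moreover have "AE x in P. cond_prob_given P (coord_algebra X V (B \<union> D \<union> C)) S x = cond_prob_given P (coord_algebra X V C) S x"
    using assms(1) S by (auto simp: screened_off_def)
  ultimately show "AE x in P. cond_prob_given P (coord_algebra X V (B \<union> (D \<union> C))) S x = cond_prob_given P (coord_algebra X V (D \<union> C)) S x"
    unfolding Un_assoc by eventually_elim simp
qed

lemma screened_off_redundant:
  assumes "screened_off X V P (A - C) (B - C) C" "A \<subseteq> V" "B \<subseteq> V" "C \<subseteq> V"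
  shows "screened_off X V P A B C"
proof -
  have 1: "screened_off X V P (A - C) B C"
    using assms(1) unfolding screened_off_def by (simp add: Un_commute)
  have "screened_off X V P B (A - C) C" by (rule screened_off_sym[OF _ _ _ 1]) (use assms in auto)
  hence "screened_off X V P B A C" unfolding screened_off_def by (simp add: Un_commute)
  thus ?thesis by (rule screened_off_sym[OF assms(3,2,4)])
qed

section \<open>The global Markov property\<close>

text \<open>Stated through a version that is measurable in the parents, so that it passes to every
  intermediate conditioning set.\<close>

definition predecessor_markov :: "('v \<times> 'v) set \<Rightarrow> 'v \<Rightarrow> 'v set \<Rightarrow> bool" where
  "predecessor_markov E v W \<longleftrightarrow> (\<forall>S\<in>sets (coord_algebra X V {v}).
     \<exists>g\<in>borel_measurable (coord_algebra X V (parents E v)). integrable P g \<and>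
       (\<forall>U\<in>sets (coord_algebra X V W). (LINT x:U|P. g x) = measure P (S \<inter> U)))"

lemma predecessor_markov_screened_off:
  assumes m: "predecessor_markov E v W" and v: "v \<in> V" "W \<subseteq> V" "parents E v \<subseteq> C" "B \<subseteq> W" "C \<subseteq> W"
  shows "screened_off X V P {v} B C"
  unfolding screened_off_def
proof
  fix S assume S: "S \<in> sets (coord_algebra X V {v})"
  then obtain g where g: "g \<in> borel_measurable (coord_algebra X V (parents E v))" "integrable P g"
    "\<And>U. U\<in>sets (coord_algebra X V W) \<Longrightarrow> (LINT x:U|P. g x) = measure P (S \<inter> U)"
    using m unfolding predecessor_markov_def by blast
  have SP: "S \<in> sets P" by (rule sets_coord_algebra_P[OF _ S]) (use v in auto)
  have "AE x in P. cond_prob_given P (coord_algebra X V D) S x = g x" if D: "parents E v \<subseteq> D" "D \<subseteq> W" for D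
  proof (rule cond_prob_given_eqI[OF prob_space_P _ SP _ g(2)])
    show "subalgebra P (coord_algebra X V D)"
      by (rule subalgebra_coord_algebra[OF _ sets_P]) (use D v in auto)
    show "g \<in> borel_measurable (coord_algebra X V D)"
      by (rule measurable_from_subalg[OF subalgebra_coord_algebra_mono g(1)]) (use D v in auto)
    show "(LINT x:U|P. g x) = measure P (S \<inter> U)" if "U \<in> sets (coord_algebra X V D)" for U
      using g(3) that sets_coord_algebra_mono[OF D(2) v(2)] by blast
  qed
  hence "AE x in P. cond_prob_given P (coord_algebra X V (B \<union> C)) S x = g x"
    "AE x in P. cond_prob_given P (coord_algebra X V C) S x = g x"
    using v by (meson Un_least le_supI2)+
  thus "AE x in P. cond_prob_given P (coord_algebra X V (B \<union> C)) S x
      = cond_prob_given P (coord_algebra X V C) S x"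
    by eventually_elim simp
qed

end

primrec parents_later :: "('v \<times> 'v) set \<Rightarrow> 'v list \<Rightarrow> bool" where
  "parents_later E [] \<longleftrightarrow> True"
| "parents_later E (v # vs) \<longleftrightarrow> v \<notin> set vs \<and> parents E v \<subseteq> set vs \<and> parents_later E vs"

lemma parents_later_no_edge_from:
  assumes "parents_later E ws" "v \<notin> set ws" "u \<in> set ws"
  shows "(v, u) \<notin> E"
  using assms by (induction ws) (auto simp: parents_def)

lemma parents_later_append: "parents_later E (us @ ws) \<Longrightarrow> parents_later E ws"
  by (induction us) auto

text \<open>Induction along the order, removing the first vertex \<open>v\<close>, which is a sink of the graph on the
  remaining vertices. If \<open>v\<close> is not conditioned on, it is exchanged for its parents, given which it is
  independent of all other remaining vertices; if \<open>v\<close> is conditioned on, it can be moved to one of the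
  two sides and returns to the conditioning set by weak union.\<close>

theorem ordered_markov_imp_global_markov:
  assumes P: "P \<in> space (prob_algebra (prod_space X V))" and vs: "parents_later E vs" "set vs \<subseteq> V"
    and loc: "\<And>us v ws. vs = us @ v # ws \<Longrightarrow> predecessor_markov X V P E v (set ws)"
    and d: "d_sep (E \<inter> set vs \<times> set vs) A B C" and ABC: "A \<subseteq> set vs" "B \<subseteq> set vs" "C \<subseteq> set vs"
  shows "screened_off X V P A B C"
  using vs loc d ABC
proof (induction vs arbitrary: A B C)
  case Nil
  hence "C = {}" "B = {}" by auto
  thus ?case by (simp add: screened_off_def)
next
  case (Cons v ws)
  define E' where "E' = E \<inter> set (v # ws) \<times> set (v # ws)"
  have sink: "(v, u) \<notin> E'" for u
    using Cons.prems(1) parents_later_no_edge_from[of E ws v u] by (auto simp: E'_def parents_def)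
  have pa: "parents E' v = parents E v" "parents E v \<subseteq> set ws"
    using Cons.prems(1) by (auto simp: E'_def parents_def)
  have V: "v \<in> V" "set ws \<subseteq> V" using Cons.prems(2) by auto
  have pm: "predecessor_markov X V P E v (set ws)" using Cons.prems(3)[of "[]"] by simp
  have IH: "screened_off X V P A B C"
    if "d_sep E' A B C" "A \<subseteq> set ws" "B \<subseteq> set ws" "C \<subseteq> set ws" for A B C
  proof (rule Cons.IH)
    show "parents_later E ws" using Cons.prems(1) by simp
    show "predecessor_markov X V P E v' (set ws')" if "ws = us @ v' # ws'" for us v' ws'
      using Cons.prems(3)[of "v # us"] that by simp
    show "d_sep (E \<inter> set ws \<times> set ws) A B C"
      by (rule d_sep_subgraph[OF that(1)[unfolded E'_def]]) (use that in auto)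
  qed (use V that in auto)
  have inA: "screened_off X V P A B C"
    if d: "d_sep E' A B C" and v: "v \<in> A" "v \<notin> C" and sub: "A \<subseteq> set (v # ws)" "B \<subseteq> set (v # ws)" "C \<subseteq> set ws" for A B C
  proof -
    define W where "W = (A - {v}) \<union> (parents E v - C)"
    have vB: "v \<notin> B"
    proof
      assume "v \<in> B"
      moreover have "path_between E' v v [v]" by (simp add: path_between_def)
      moreover have "open_path E' C [v]" using v by (simp add: open_path_def collider_at_def)
      ultimately show False using d v unfolding d_sep_iff_no_open_path by blast
    qed
    hence B: "B \<subseteq> set ws" using sub by auto
    have W: "W \<subseteq> set ws" using sub pa by (auto simp: W_def)
    have "d_sep E' (A \<union> (parents E' v - C)) B C" by (rule d_sep_sink_parents[OF d v sink])
    hence "d_sep E' W B C" by (rule d_sep_mono) (auto simp: W_def pa)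
    hence "screened_off X V P W B C" by (rule IH[OF _ W B sub(3)])
    hence BW: "screened_off X V P B W C"
      by (rule screened_off_sym[OF P, rotated 3]) (use W B sub V in auto)
    have "screened_off X V P {v} B (W \<union> C)"
      by (rule predecessor_markov_screened_off[OF P pm V]) (use W B sub in \<open>auto simp: W_def\<close>)
    hence "screened_off X V P B {v} (W \<union> C)"
      by (rule screened_off_sym[OF P, rotated 3]) (use W B sub V in auto)
    hence "screened_off X V P B ({v} \<union> W) C" by (rule screened_off_contraction[OF P _ BW])
    hence "screened_off X V P B A C"
      by (rule screened_off_mono[OF P]) (use W B sub V v in \<open>auto simp: W_def\<close>)
    thus ?thesis by (rule screened_off_sym[OF P, rotated 3]) (use B sub V in auto)
  qed
  have notC: "screened_off X V P A B C"
    if d: "d_sep E' A B C" and v: "v \<notin> C" and sub: "A \<subseteq> set (v # ws)" "B \<subseteq> set (v # ws)" "C \<subseteq> set (v # ws)" for A B C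
  proof -
    have C: "C \<subseteq> set ws" using v sub by auto
    consider "v \<in> A" | "v \<in> B" | "v \<notin> A" "v \<notin> B" by blast
    thus ?thesis
    proof cases
      case 1 thus ?thesis using inA[OF d _ v sub(1,2) C] by blast
    next
      case 2
      hence "screened_off X V P B A C" using inA[OF d_sep_sym[OF d] _ v sub(2,1) C] by blast
      thus ?thesis by (rule screened_off_sym[OF P, rotated 3]) (use sub V C in auto)
    next
      case 3 thus ?thesis by (intro IH[OF d]) (use sub C in auto)
    qed
  qed
  have d: "d_sep E' A B C" using Cons.prems(4) by (simp add: E'_def)
  note ABC = Cons.prems(5-7)
  show ?case
  proof (cases "v \<in> C")
    case False thus ?thesis by (rule notC[OF d _ ABC])
  next
    case True
    define D where "D = C - {v}"
    have C: "C = insert v D" "v \<notin> D" "D \<subseteq> set (v # ws)" using True ABC by (auto simp: D_def)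
    have sub: "A - C \<subseteq> V" "B - C \<subseteq> V" "D \<subseteq> V" "A \<subseteq> V" "B \<subseteq> V" "C \<subseteq> V"
      using ABC V C by auto
    have "d_sep E' (A - C) (B - C) (insert v D)"
      by (rule d_sep_mono[OF d[unfolded C(1)]]) auto
    from d_sep_sink_conditioned[OF this _ _ C(2) sink] True
    consider "d_sep E' (A - C) (insert v (B - C)) D" | "d_sep E' (insert v (A - C)) (B - C) D" by blast
    hence "screened_off X V P (A - C) (B - C) ({v} \<union> D)"
    proof cases
      case 1
      have "screened_off X V P (A - C) (insert v (B - C)) D"
        by (rule notC[OF 1 C(2)]) (use ABC C in auto)
      hence "screened_off X V P (A - C) (B - C \<union> {v}) D" by simp
      thus ?thesis by (rule screened_off_weak_union[OF P]) (use sub V in auto)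
    next
      case 2
      have "screened_off X V P (insert v (A - C)) (B - C) D"
        by (rule notC[OF 2 C(2)]) (use ABC C in auto)
      hence "screened_off X V P (A - C \<union> {v}) (B - C) D" by simp
      hence "screened_off X V P (B - C) (A - C \<union> {v}) D"
        by (rule screened_off_sym[OF P, rotated 3]) (use sub V in auto)
      hence "screened_off X V P (B - C) (A - C) ({v} \<union> D)"
        by (rule screened_off_weak_union[OF P]) (use sub V in auto)
      thus ?thesis by (rule screened_off_sym[OF P, rotated 3]) (use sub V in auto)
    qed
    hence "screened_off X V P (A - C) (B - C) C" using C by simp
    thus ?thesis by (rule screened_off_redundant[OF P]) (use sub in auto)
  qed
qed

section \<open>The product of the kernels\<close>

lemma parents_later_kernel_product:
  assumes "parents_later E vs"
  shows "distinct vs" "\<forall>i<length vs. parents E (vs ! i) \<subseteq> set (drop (Suc i) vs)"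
  using assms
proof (induction vs)
  case (Cons v vs)
  { case 1 thus ?case using Cons by simp
  next
    case 2
    show ?case
    proof (intro allI impI)
      fix i assume "i < length (v # vs)"
      thus "parents E ((v # vs) ! i) \<subseteq> set (drop (Suc i) (v # vs))"
        using Cons(2) 2 by (cases i) auto
    qed }
qed auto

definition kernels_on :: "('v \<Rightarrow> 'x metric) \<Rightarrow> ('v \<times> 'v) set \<Rightarrow> 'v set \<Rightarrow> ('v, 'x) kernels \<Rightarrow> bool" where
  "kernels_on X E W m \<longleftrightarrow>
     (\<forall>v\<in>W. m v \<in> prod_space X (parents E v) \<rightarrow>\<^sub>M prob_algebra (borel_metric (X v)))"

lemma kernel_product_in_prob_algebra:
  assumes "parents_later E vs" "kernels_on X E (set vs) m"
  shows "kernel_product X E m vs \<in> space (prob_algebra (prod_space X (set vs)))"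
  by (rule kernel_product_prob[OF parents_later_kernel_product[OF assms(1)]])
    (use assms(2) in \<open>simp add: kernels_on_def\<close>)

lemma fun_upd_measurable_prod_space:
  assumes "x \<in> space (prod_space X A)"
  shows "(\<lambda>y. x(v := y)) \<in> borel_metric (X v) \<rightarrow>\<^sub>M prod_space X (insert v A)"
proof -
  have "(\<lambda>(x, y). x(v := y)) \<in> prod_space X A \<Otimes>\<^sub>M borel_metric (X v) \<rightarrow>\<^sub>M prod_space X (insert v A)"
    unfolding prod_space_def by (rule measurable_add_dim)
  from measurable_compose[OF measurable_Pair1'[OF assms] this] show ?thesis by simp
qed

definition slice :: "('v \<Rightarrow> 'x metric) \<Rightarrow> 'v \<Rightarrow> ('v \<Rightarrow> 'x) set \<Rightarrow> ('v \<Rightarrow> 'x) \<Rightarrow> 'x set" where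
  "slice X v W x = {y \<in> mspace (X v). x(v := y) \<in> W}"

lemma slice_measurable:
  assumes "W \<in> sets (prod_space X (insert v A))" "x \<in> space (prod_space X A)"
  shows "slice X v W x \<in> sets (borel_metric (X v))"
proof -
  have "slice X v W x = (\<lambda>y. x(v := y)) -` W \<inter> space (borel_metric (X v))"
    by (auto simp: slice_def space_borel_metric)
  thus ?thesis using measurable_sets[OF fun_upd_measurable_prod_space[OF assms(2), of v] assms(1)] by simp
qed

lemma
  assumes vs: "parents_later E (v # vs)" and m: "kernels_on X E (set (v # vs)) m"
    and W: "W \<in> sets (prod_space X (set (v # vs)))"
  shows emeasure_kernel_product_Cons: "emeasure (kernel_product X E m (v # vs)) W =
      (\<integral>\<^sup>+x. emeasure (m v (restrict x (parents E v))) (slice X v W x) \<partial>kernel_product X E m vs)" (is ?A)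
    and slice_prob_measurable: "(\<lambda>x. emeasure (m v (restrict x (parents E v))) (slice X v W x))
      \<in> borel_measurable (prod_space X (set vs))" (is ?B)
    and kernel_space: "x \<in> space (prod_space X (set vs)) \<Longrightarrow>
      m v (restrict x (parents E v)) \<in> space (prob_algebra (borel_metric (X v)))"
proof -
  let ?N = "prod_space X (set vs)" and ?L = "prod_space X (set (v # vs))"
  have P: "kernel_product X E m vs \<in> space (prob_algebra ?N)"
    by (rule kernel_product_in_prob_algebra) (use vs m in \<open>auto simp: kernels_on_def\<close>)
  have pa: "parents E v \<subseteq> set vs" using vs by simp
  have mv[measurable]: "m v \<in> prod_space X (parents E v) \<rightarrow>\<^sub>M prob_algebra (borel_metric (X v))"
    using m by (auto simp: kernels_on_def)
  have r[measurable]: "(\<lambda>x. restrict x (parents E v)) \<in> ?N \<rightarrow>\<^sub>M prod_space X (parents E v)"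
    unfolding prod_space_def using pa by (rule measurable_restrict_subset)
  have u: "(\<lambda>(x, y). x(v := y)) \<in> ?N \<Otimes>\<^sub>M borel_metric (X v) \<rightarrow>\<^sub>M ?L"
    unfolding prod_space_def using measurable_add_dim[of v "set vs" "\<lambda>v. borel_metric (X v)"] by simp
  let ?k = "\<lambda>x. distr (m v (restrict x (parents E v))) ?L (\<lambda>y. x(v := y))"
  have k: "?k \<in> ?N \<rightarrow>\<^sub>M prob_algebra ?L"
    by (rule measurable_distr_prob_space2[OF _ u]) measurable
  show ks: "m v (restrict x (parents E v)) \<in> space (prob_algebra (borel_metric (X v)))"
    if "x \<in> space ?N" for x
    using measurable_space[OF measurable_compose[OF r mv] that] .
  have sets_m: "sets (m v (restrict x (parents E v))) = sets (borel_metric (X v))" if "x \<in> space ?N" for x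
    using ks[OF that] by (simp add: space_prob_algebra)
  have e: "emeasure (?k x) W = emeasure (m v (restrict x (parents E v))) (slice X v W x)"
    if x: "x \<in> space ?N" for x
  proof -
    have "(\<lambda>y. x(v := y)) \<in> m v (restrict x (parents E v)) \<rightarrow>\<^sub>M ?L"
      using fun_upd_measurable_prod_space[OF x, of v] sets_m[OF x] by (simp cong: measurable_cong_sets)
    hence "emeasure (?k x) W = emeasure (m v (restrict x (parents E v)))
        ((\<lambda>y. x(v := y)) -` W \<inter> space (m v (restrict x (parents E v))))"
      by (rule emeasure_distr[OF _ W])
    also have "(\<lambda>y. x(v := y)) -` W \<inter> space (m v (restrict x (parents E v))) = slice X v W x"
      using sets_eq_imp_space_eq[OF sets_m[OF x]] by (auto simp: slice_def space_borel_metric)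
    finally show ?thesis .
  qed
  have sP: "sets (kernel_product X E m vs) = sets ?N" "prob_space (kernel_product X E m vs)"
    using P by (auto simp: space_prob_algebra)
  have spP: "space (kernel_product X E m vs) = space ?N" by (rule sets_eq_imp_space_eq[OF sP(1)])
  have k': "?k \<in> kernel_product X E m vs \<rightarrow>\<^sub>M subprob_algebra ?L"
    using measurable_prob_algebraD[OF k] sP by (simp cong: measurable_cong_sets)
  have "emeasure (kernel_product X E m (v # vs)) W = (\<integral>\<^sup>+x. emeasure (?k x) W \<partial>kernel_product X E m vs)"
    unfolding kernel_product.simps
    by (rule emeasure_bind[OF prob_space.not_empty[OF sP(2)] k' W])
  also have "\<dots> = (\<integral>\<^sup>+x. emeasure (m v (restrict x (parents E v))) (slice X v W x) \<partial>kernel_product X E m vs)"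
    by (rule nn_integral_cong) (use e spP in auto)
  finally show ?A .
  have "(\<lambda>x. emeasure (?k x) W) \<in> borel_measurable ?N"
    by (rule measurable_emeasure_kernel[OF measurable_prob_algebraD[OF k] W])
  thus ?B by (rule measurable_cong[THEN iffD1, rotated]) (rule e)
qed

lemma
  assumes vs: "parents_later E (v # vs)" and m: "kernels_on X E (set (v # vs)) m"
    and W: "W \<in> sets (prod_space X (set (v # vs)))"
  shows measure_kernel_product_Cons: "measure (kernel_product X E m (v # vs)) W =
      (\<integral>x. measure (m v (restrict x (parents E v))) (slice X v W x) \<partial>kernel_product X E m vs)" (is ?A)
    and slice_prob_measurable_real: "(\<lambda>x. measure (m v (restrict x (parents E v))) (slice X v W x))
      \<in> borel_measurable (prod_space X (set vs))" (is ?B)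
proof -
  let ?g = "\<lambda>x. measure (m v (restrict x (parents E v))) (slice X v W x)"
  have P: "kernel_product X E m vs \<in> space (prob_algebra (prod_space X (set vs)))"
    by (rule kernel_product_in_prob_algebra) (use vs m in \<open>auto simp: kernels_on_def\<close>)
  hence sP: "sets (kernel_product X E m vs) = sets (prod_space X (set vs))" by (simp add: space_prob_algebra)
  show B: ?B using slice_prob_measurable[OF vs m W] unfolding measure_def by simp
  have e: "emeasure (m v (restrict x (parents E v))) (slice X v W x) = ennreal (?g x)"
    if "x \<in> space (kernel_product X E m vs)" for x
    using kernel_space[OF vs m W, of x] that sets_eq_imp_space_eq[OF sP]
    by (auto simp: space_prob_algebra intro!: finite_measure.emeasure_eq_measure prob_space.finite_measure)
  have "emeasure (kernel_product X E m (v # vs)) W = (\<integral>\<^sup>+x. ennreal (?g x) \<partial>kernel_product X E m vs)"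
    unfolding emeasure_kernel_product_Cons[OF vs m W] by (rule nn_integral_cong) (rule e)
  moreover have "(\<integral>x. ?g x \<partial>kernel_product X E m vs) = enn2real (\<integral>\<^sup>+x. ennreal (?g x) \<partial>kernel_product X E m vs)"
    by (rule integral_eq_nn_integral) (use B sP in \<open>auto cong: measurable_cong_sets\<close>)
  ultimately show ?A by (simp add: measure_def)
qed

lemma space_insert_fun_upd:
  assumes "x \<in> space (prod_space X A)" "y \<in> mspace (X v)"
  shows "x(v := y) \<in> space (prod_space X (insert v A))"
  using assms by (auto simp: space_prod_space PiE_def Pi_def extensional_def)

lemma emeasure_kernel_product_rectangle:
  assumes vs: "parents_later E (v # vs)" and m: "kernels_on X E (set (v # vs)) m"
    and S: "S \<in> sets (borel_metric (X v))" and U: "U \<in> sets (prod_space X (set vs))"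
  shows "{x \<in> space (prod_space X (set (v # vs))). x v \<in> S \<and> restrict x (set vs) \<in> U}
      \<in> sets (prod_space X (set (v # vs)))" (is "?W \<in> _")
    and "emeasure (kernel_product X E m (v # vs))
        {x \<in> space (prod_space X (set (v # vs))). x v \<in> S \<and> restrict x (set vs) \<in> U} =
      (\<integral>\<^sup>+x. indicator U x * emeasure (m v (restrict x (parents E v))) S \<partial>kernel_product X E m vs)"
proof -
  have c: "(\<lambda>x. x v) \<in> prod_space X (set (v # vs)) \<rightarrow>\<^sub>M borel_metric (X v)"
    unfolding prod_space_def by (rule measurable_component_singleton) simp
  have r: "(\<lambda>x. restrict x (set vs)) \<in> prod_space X (set (v # vs)) \<rightarrow>\<^sub>M prod_space X (set vs)"
    by (rule restrict_measurable_prod_space) auto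
  have "?W = ((\<lambda>x. x v) -` S \<inter> space (prod_space X (set (v # vs)))) \<inter>
      ((\<lambda>x. restrict x (set vs)) -` U \<inter> space (prod_space X (set (v # vs))))" by auto
  thus W: "?W \<in> sets (prod_space X (set (v # vs)))"
    using measurable_sets[OF c S] measurable_sets[OF r U] by auto
  have P: "kernel_product X E m vs \<in> space (prob_algebra (prod_space X (set vs)))"
    by (rule kernel_product_in_prob_algebra) (use vs m in \<open>auto simp: kernels_on_def\<close>)
  have sp: "space (kernel_product X E m vs) = space (prod_space X (set vs))"
    using P by (auto simp: space_prob_algebra dest: sets_eq_imp_space_eq)
  have "slice X v ?W x = (if x \<in> U then S else {})" if x: "x \<in> space (prod_space X (set vs))" for x
  proof -
    have "v \<notin> set vs" using vs by simp
    hence "restrict (x(v := y)) (set vs) = x" for y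
      using x by (auto simp: space_prod_space PiE_def extensional_def fun_eq_iff)
    moreover have "S \<subseteq> mspace (X v)" using sets.sets_into_space[OF S] by (simp add: space_borel_metric)
    ultimately show ?thesis using space_insert_fun_upd[OF x, of _ v] by (auto simp: slice_def)
  qed
  thus "emeasure (kernel_product X E m (v # vs)) ?W =
      (\<integral>\<^sup>+x. indicator U x * emeasure (m v (restrict x (parents E v))) S \<partial>kernel_product X E m vs)"
    unfolding emeasure_kernel_product_Cons[OF vs m W]
    by (intro nn_integral_cong) (auto simp: sp indicator_def)
qed

text \<open>Dropping the last kernels in the order of generation marginalises them out, since each has
  total mass one.\<close>

lemma distr_kernel_product_append:
  assumes "parents_later E (us @ ws)" "kernels_on X E (set (us @ ws)) m"
  shows "distr (kernel_product X E m (us @ ws)) (prod_space X (set ws)) (\<lambda>x. restrict x (set ws))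
    = kernel_product X E m ws"
  using assms
proof (induction us)
  case Nil
  have P: "kernel_product X E m ws \<in> space (prob_algebra (prod_space X (set ws)))"
    by (rule kernel_product_in_prob_algebra) (use Nil in auto)
  hence s: "sets (kernel_product X E m ws) = sets (prod_space X (set ws))" by (simp add: space_prob_algebra)
  have "distr (kernel_product X E m ws) (prod_space X (set ws)) (\<lambda>x. restrict x (set ws))
     = distr (kernel_product X E m ws) (kernel_product X E m ws) (\<lambda>x. x)"
    by (rule distr_cong) (use s sets_eq_imp_space_eq[OF s] in \<open>auto simp: space_prod_space PiE_def extensional_restrict\<close>)
  thus ?case by (simp only: append_Nil distr_id)
next
  case (Cons v us)
  let ?vs = "us @ ws"
  have vs: "parents_later E (v # ?vs)" "kernels_on X E (set (v # ?vs)) m" using Cons.prems by auto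
  have vs': "parents_later E ?vs" "kernels_on X E (set ?vs) m" using Cons.prems by (auto simp: kernels_on_def)
  note IH = Cons.IH[OF vs']
  have P: "kernel_product X E m (v # ?vs) \<in> space (prob_algebra (prod_space X (set (v # ?vs))))"
    by (rule kernel_product_in_prob_algebra[OF vs])
  have P': "kernel_product X E m ?vs \<in> space (prob_algebra (prod_space X (set ?vs)))"
    by (rule kernel_product_in_prob_algebra[OF vs'])
  have s: "sets (kernel_product X E m (v # ?vs)) = sets (prod_space X (set (v # ?vs)))"
    "sets (kernel_product X E m ?vs) = sets (prod_space X (set ?vs))"
    using P P' by (auto simp: space_prob_algebra)
  have sp: "space (kernel_product X E m (v # ?vs)) = space (prod_space X (set (v # ?vs)))"
     "space (kernel_product X E m ?vs) = space (prod_space X (set ?vs))"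
    using s by (auto dest: sets_eq_imp_space_eq)
  have r: "(\<lambda>x. restrict x (set ws)) \<in> kernel_product X E m (v # ?vs) \<rightarrow>\<^sub>M prod_space X (set ws)"
    using restrict_measurable_prod_space[of "set ws" "set (v # ?vs)" X] s by (auto cong: measurable_cong_sets)
  have r': "(\<lambda>x. restrict x (set ws)) \<in> kernel_product X E m ?vs \<rightarrow>\<^sub>M prod_space X (set ws)"
    using restrict_measurable_prod_space[of "set ws" "set ?vs" X] s by (auto cong: measurable_cong_sets)
  have "distr (kernel_product X E m (v # ?vs)) (prod_space X (set ws)) (\<lambda>x. restrict x (set ws))
    = distr (kernel_product X E m ?vs) (prod_space X (set ws)) (\<lambda>x. restrict x (set ws))"
  proof (rule measure_eqI)
    fix U assume "U \<in> sets (distr (kernel_product X E m (v # ?vs)) (prod_space X (set ws)) (\<lambda>x. restrict x (set ws)))"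
    hence U: "U \<in> sets (prod_space X (set ws))" by simp
    define U' where "U' = (\<lambda>x. restrict x (set ws)) -` U \<inter> space (prod_space X (set ?vs))"
    have U': "U' \<in> sets (prod_space X (set ?vs))" using measurable_sets[OF r' U] by (simp add: U'_def s sp)
    have top: "mspace (X v) \<in> sets (borel_metric (X v))"
      using sets.top[of "borel_metric (X v)"] by (simp add: space_borel_metric)
    have "emeasure (distr (kernel_product X E m (v # ?vs)) (prod_space X (set ws)) (\<lambda>x. restrict x (set ws))) U
      = emeasure (kernel_product X E m (v # ?vs)) ((\<lambda>x. restrict x (set ws)) -` U \<inter> space (prod_space X (set (v # ?vs))))"
      using emeasure_distr[OF r U] by (simp only: sp)
    also have "(\<lambda>x. restrict x (set ws)) -` U \<inter> space (prod_space X (set (v # ?vs)))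
      = {x \<in> space (prod_space X (set (v # ?vs))). x v \<in> mspace (X v) \<and> restrict x (set ?vs) \<in> U'}"
    proof -
      have "restrict (restrict x (set ?vs)) (set ws) = restrict x (set ws)" for x :: "'a \<Rightarrow> 'b"
        by (auto simp: restrict_def fun_eq_iff)
      thus ?thesis by (auto simp: U'_def space_prod_space)
    qed
    also have "emeasure (kernel_product X E m (v # ?vs)) \<dots> =
       (\<integral>\<^sup>+x. indicator U' x * emeasure (m v (restrict x (parents E v))) (mspace (X v)) \<partial>kernel_product X E m ?vs)"
      by (rule emeasure_kernel_product_rectangle(2)[OF vs top U'])
    also have "\<dots> = (\<integral>\<^sup>+x. indicator U' x \<partial>kernel_product X E m ?vs)"
    proof (rule nn_integral_cong)
      fix x assume "x \<in> space (kernel_product X E m ?vs)"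
      hence "m v (restrict x (parents E v)) \<in> space (prob_algebra (borel_metric (X v)))"
        using kernel_space[OF vs, of "{}" x] sp by simp
      hence "emeasure (m v (restrict x (parents E v))) (mspace (X v)) = 1"
        using prob_space.emeasure_space_1[of "m v (restrict x (parents E v))"]
        by (auto simp: space_prob_algebra space_borel_metric dest!: sets_eq_imp_space_eq)
      thus "indicator U' x * emeasure (m v (restrict x (parents E v))) (mspace (X v)) = indicator U' x" by simp
    qed
    also have "\<dots> = emeasure (kernel_product X E m ?vs) U'" using U' s by simp
    also have "\<dots> = emeasure (distr (kernel_product X E m ?vs) (prod_space X (set ws)) (\<lambda>x. restrict x (set ws))) U"
      unfolding U'_def using emeasure_distr[OF r' U] by (simp only: sp)
    finally show "emeasure (distr (kernel_product X E m (v # ?vs)) (prod_space X (set ws)) (\<lambda>x. restrict x (set ws))) U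
      = emeasure (distr (kernel_product X E m ?vs) (prod_space X (set ws)) (\<lambda>x. restrict x (set ws))) U" .
  qed simp
  thus ?case unfolding append_Cons by (rule trans) (rule IH)
qed

text \<open>The kernel at \<open>v\<close>, evaluated at the parents, is the conditional probability given all vertices
  generated before \<open>v\<close>.\<close>

lemma kernel_product_predecessor_markov:
  assumes vs: "parents_later E vs" and m: "kernels_on X E (set vs) m" and e: "vs = us @ v # ws"
  shows "predecessor_markov X (set vs) (kernel_product X E m vs) E v (set ws)"
proof -
  let ?P = "kernel_product X E m vs" and ?V = "set vs"
  have P: "?P \<in> space (prob_algebra (prod_space X ?V))" by (rule kernel_product_in_prob_algebra[OF vs m])
  have vw: "parents_later E (v # ws)" "kernels_on X E (set (v # ws)) m"
    using parents_later_append[OF vs[unfolded e]] m e by (simp, simp add: kernels_on_def)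
  have w: "parents_later E ws" "kernels_on X E (set ws) m" using vw by (auto simp: kernels_on_def)
  have pa: "parents E v \<subseteq> set ws" using vw by simp
  have sub: "set ws \<subseteq> ?V" "v \<in> ?V" "set (v # ws) \<subseteq> ?V" "parents E v \<subseteq> ?V" using e pa by auto
  have sP: "sets ?P = sets (prod_space X ?V)" and pP: "prob_space ?P" using P by (auto simp: space_prob_algebra)
  have sp: "space ?P = space (prod_space X ?V)" using sP by (rule sets_eq_imp_space_eq)
  interpret prob_space ?P by (rule pP)
  have mv: "m v \<in> prod_space X (parents E v) \<rightarrow>\<^sub>M prob_algebra (borel_metric (X v))"
    using vw by (simp add: kernels_on_def)
  show ?thesis
    unfolding predecessor_markov_def[OF P]
  proof
    fix S assume "S \<in> sets (coord_algebra X ?V {v})"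
    then obtain S0 where S0: "S0 \<in> sets (prod_space X {v})" "S = {x \<in> space (prod_space X ?V). restrict x {v} \<in> S0}"
      using sets_coord_algebra[of "{v}" ?V X] sub by auto
    define S1 where "S1 = (\<lambda>y. \<lambda>i\<in>{v}. y) -` S0 \<inter> space (borel_metric (X v))"
    have "(\<lambda>y. \<lambda>i\<in>{v}. y) \<in> borel_metric (X v) \<rightarrow>\<^sub>M prod_space X {v}"
      unfolding prod_space_def by (rule measurable_restrict) auto
    hence S1: "S1 \<in> sets (borel_metric (X v))" unfolding S1_def by (rule measurable_sets) (rule S0)
    have SS1: "S = {x \<in> space (prod_space X ?V). x v \<in> S1}"
    proof -
      have "restrict x {v} = (\<lambda>i\<in>{v}. x v)" for x :: "'a \<Rightarrow> 'b" by (auto simp: restrict_def fun_eq_iff)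
      thus ?thesis using sub(2) unfolding S0(2) S1_def by (auto simp: space_prod_space space_borel_metric PiE_mem)
    qed
    define g0 where "g0 z = measure (m v z) S1" for z
    define g where "g x = g0 (restrict x (parents E v))" for x
    have g0m: "g0 \<in> borel_measurable (prod_space X (parents E v))"
      unfolding g0_def
      using measurable_emeasure_kernel[OF measurable_prob_algebraD[OF mv] S1]
      unfolding measure_def by (rule measurable_compose) simp
    have gm: "g \<in> borel_measurable (coord_algebra X ?V (parents E v))"
      unfolding g_def
      by (rule measurable_compose[OF restrict_measurable_coord_algebra[OF order_refl sub(4)] g0m])
    have gP: "g \<in> borel_measurable ?P"
      by (rule measurable_from_subalg[OF subalgebra_coord_algebra[OF sub(4) sP] gm])
    have kern: "m v (restrict x (parents E v)) \<in> space (prob_algebra (borel_metric (X v)))"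
      if "x \<in> space ?P" for x
      using measurable_space[OF mv] measurable_space[OF restrict_measurable_prod_space[OF sub(4)]] that sp by blast
    have g1: "0 \<le> g x" "g x \<le> 1" if "x \<in> space ?P" for x
      using kern[OF that] prob_space.prob_le_1 by (auto simp: g_def g0_def space_prob_algebra)
    have gi: "integrable ?P g" by (rule integrable_const_bound[of _ 1]) (use g1 gP in auto)
    have "(LINT x:U|?P. g x) = measure ?P (S \<inter> U)" if U: "U \<in> sets (coord_algebra X ?V (set ws))" for U
    proof -
      obtain U0 where U0: "U0 \<in> sets (prod_space X (set ws))" "U = {x \<in> space (prod_space X ?V). restrict x (set ws) \<in> U0}"
        using U sets_coord_algebra[OF sub(1), of X] by auto
      have UP: "U \<in> sets ?P" using U subalgebra_coord_algebra[OF sub(1) sP] by (auto simp: subalgebra_def)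
      let ?f = "\<lambda>x. indicator U0 x * emeasure (m v (restrict x (parents E v))) S1"
      have fm: "?f \<in> borel_measurable (prod_space X (set ws))"
      proof -
        have "(\<lambda>x. emeasure (m v (restrict x (parents E v))) S1) \<in> borel_measurable (prod_space X (set ws))"
          by (rule measurable_compose[OF restrict_measurable_prod_space[OF pa]
             measurable_emeasure_kernel[OF measurable_prob_algebraD[OF mv] S1]])
        thus ?thesis using U0 by measurable
      qed
      have rV: "(\<lambda>x. restrict x (set ws)) \<in> ?P \<rightarrow>\<^sub>M prod_space X (set ws)"
        using restrict_measurable_prod_space[OF sub(1), of X] sP by (simp cong: measurable_cong_sets)
      have rV': "(\<lambda>x. restrict x (set (v # ws))) \<in> ?P \<rightarrow>\<^sub>M prod_space X (set (v # ws))"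
        using restrict_measurable_prod_space[OF sub(3), of X] sP by (simp cong: measurable_cong_sets)
      let ?R = "{x \<in> space (prod_space X (set (v # ws))). x v \<in> S1 \<and> restrict x (set ws) \<in> U0}"
      have R: "?R \<in> sets (prod_space X (set (v # ws)))" by (rule emeasure_kernel_product_rectangle(1)[OF vw S1 U0(1)])
      have "emeasure ?P (S \<inter> U) = emeasure ?P ((\<lambda>x. restrict x (set (v # ws))) -` ?R \<inter> space ?P)"
      proof (rule arg_cong[where f = "emeasure ?P"])
        have "restrict x (set (v # ws)) v = x v" "restrict (restrict x (set (v # ws))) (set ws) = restrict x (set ws)"
          for x :: "'a \<Rightarrow> 'b" by (auto simp: restrict_def fun_eq_iff)
        moreover have "restrict x (set (v # ws)) \<in> space (prod_space X (set (v # ws)))"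
          if "x \<in> space (prod_space X ?V)" for x
          using measurable_space[OF restrict_measurable_prod_space[OF sub(3)] that] .
        ultimately show "S \<inter> U = (\<lambda>x. restrict x (set (v # ws))) -` ?R \<inter> space ?P"
          unfolding SS1 U0(2) sp by auto
      qed
      also have "\<dots> = emeasure (distr ?P (prod_space X (set (v # ws))) (\<lambda>x. restrict x (set (v # ws)))) ?R"
        by (rule emeasure_distr[OF rV' R, symmetric])
      also have "distr ?P (prod_space X (set (v # ws))) (\<lambda>x. restrict x (set (v # ws))) = kernel_product X E m (v # ws)"
        unfolding e by (rule distr_kernel_product_append) (use vs m e in auto)
      also have "emeasure (kernel_product X E m (v # ws)) ?R = (\<integral>\<^sup>+x. ?f x \<partial>kernel_product X E m ws)"
        by (rule emeasure_kernel_product_rectangle(2)[OF vw S1 U0(1)])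
      also have "kernel_product X E m ws = distr ?P (prod_space X (set ws)) (\<lambda>x. restrict x (set ws))"
        using distr_kernel_product_append[of E "us @ [v]" ws X m] vs m e by simp
      also have "(\<integral>\<^sup>+x. ?f x \<partial>distr ?P (prod_space X (set ws)) (\<lambda>x. restrict x (set ws)))
          = (\<integral>\<^sup>+x. ?f (restrict x (set ws)) \<partial>?P)"
        by (rule nn_integral_distr[OF rV]) (use fm in simp)
      also have "\<dots> = (\<integral>\<^sup>+x. ennreal (indicator U x * g x) \<partial>?P)"
      proof (rule nn_integral_cong)
        fix x assume x: "x \<in> space ?P"
        have "restrict (restrict x (set ws)) (parents E v) = restrict x (parents E v)"
          using pa by (auto simp: restrict_def fun_eq_iff)
        moreover have "emeasure (m v (restrict x (parents E v))) S1 = ennreal (g x)"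
          using kern[OF x] by (auto simp: g_def g0_def space_prob_algebra
             intro!: finite_measure.emeasure_eq_measure prob_space.finite_measure)
        moreover have "indicator U0 (restrict x (set ws)) = (indicator U x :: real)"
          using x sp by (simp add: U0(2) indicator_def)
        ultimately show "?f (restrict x (set ws)) = ennreal (indicator U x * g x)"
          using x sp by (auto simp: U0(2) indicator_def)
      qed
      finally have "emeasure ?P (S \<inter> U) = (\<integral>\<^sup>+x. ennreal (indicator U x * g x) \<partial>?P)" .
      moreover have "(LINT x:U|?P. g x) = enn2real (\<integral>\<^sup>+x. ennreal (indicator U x * g x) \<partial>?P)"
        unfolding set_lebesgue_integral_def real_scaleR_def
        by (rule integral_eq_nn_integral) (use gP UP g1 in \<open>auto simp: indicator_def\<close>)
      ultimately show ?thesis by (simp add: measure_def)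
    qed
    thus "\<exists>g\<in>borel_measurable (coord_algebra X ?V (parents E v)). integrable ?P g \<and>
       (\<forall>U\<in>sets (coord_algebra X ?V (set ws)). (LINT x:U|?P. g x) = measure ?P (S \<inter> U))"
      using gm gi by blast
  qed
qed

theorem kernel_product_markov:
  assumes vs: "parents_later E vs" and m: "kernels_on X E (set vs) m" and E: "E \<subseteq> set vs \<times> set vs"
    and d: "d_sep E A B C" "A \<subseteq> set vs" "B \<subseteq> set vs" "C \<subseteq> set vs"
  shows "cond_indep X (kernel_product X E m vs) A B C"
proof -
  have P: "kernel_product X E m vs \<in> space (prob_algebra (prod_space X (set vs)))"
    by (rule kernel_product_in_prob_algebra[OF vs m])
  have "E \<inter> set vs \<times> set vs = E" using E by auto
  thus ?thesis unfolding cond_indep_iff_screened_off[OF P d(2-4)]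
    using d by (intro ordered_markov_imp_global_markov[OF P vs order_refl]
        kernel_product_predecessor_markov[OF vs m]) auto
qed

section \<open>Densities of products of kernels\<close>

lemma parents_later_parents:
  "parents_later E vs \<Longrightarrow> u \<in> set vs \<Longrightarrow> parents E u \<subseteq> set vs"
  by (induction vs) auto

lemma kernel_product_density:
  fixes p :: "'v \<Rightarrow> ('v \<Rightarrow> 'x) \<Rightarrow> real"
  assumes sf: "product_sigma_finite \<mu>"
    and vs: "parents_later E vs" and m: "kernels_on X E (set vs) m"
    and \<mu>: "\<And>v. v \<in> set vs \<Longrightarrow> sets (\<mu> v) = sets (borel_metric (X v))"
    and p: "\<And>v. v \<in> set vs \<Longrightarrow> p v \<in> borel_measurable (prod_space X (insert v (parents E v)))"
    and d: "\<And>v x. v \<in> set vs \<Longrightarrow> x \<in> space (prod_space X (parents E v)) \<Longrightarrow>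
        m v x = density (\<mu> v) (\<lambda>y. ennreal (p v (x(v := y))))"
  shows "kernel_product X E m vs =
    density (Pi\<^sub>M (set vs) \<mu>) (\<lambda>x. \<Prod>v\<in>set vs. ennreal (p v (restrict x (insert v (parents E v)))))"
  using vs m \<mu> p d
proof (induction vs)
  case Nil
  interpret product_sigma_finite \<mu> by fact
  show ?case
  proof (rule measure_eqI)
    show "sets (kernel_product X E m []) = sets (density (Pi\<^sub>M (set []) \<mu>)
       (\<lambda>x. \<Prod>v\<in>set []. ennreal (p v (restrict x (insert v (parents E v))))))"
      by (simp add: prod_space_def sets_PiM_empty)
    fix W assume "W \<in> sets (kernel_product X E m [])"
    hence W: "W \<in> sets (prod_space X {})" by simp
    have "W \<subseteq> {\<lambda>_. undefined}"
      using sets.sets_into_space[OF W] by (simp add: space_prod_space)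
    hence "W = {} \<or> W = {\<lambda>_. undefined}" by (rule subset_singletonD)
    moreover have "emeasure (kernel_product X E m []) W = indicator W (\<lambda>_. undefined)"
      using W by simp
    moreover have "density (Pi\<^sub>M (set []) \<mu>) (\<lambda>x. \<Prod>v\<in>set []. ennreal (p v (restrict x (insert v (parents E v)))))
        = Pi\<^sub>M {} \<mu>" by (simp add: density_1)
    ultimately show "emeasure (kernel_product X E m []) W = emeasure (density (Pi\<^sub>M (set []) \<mu>)
       (\<lambda>x. \<Prod>v\<in>set []. ennreal (p v (restrict x (insert v (parents E v)))))) W"
      by (elim disjE) simp_all
  qed
next
  case (Cons v vs)
  interpret product_sigma_finite \<mu> by fact
  let ?vs = "v # vs" and ?q = "\<lambda>v x. ennreal (p v (restrict x (insert v (parents E v))))"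
  let ?f = "\<lambda>ws x. \<Prod>u\<in>set ws. ?q u x"
  have vs: "parents_later E vs" "v \<notin> set vs" "parents E v \<subseteq> set vs" using Cons.prems by auto
  have m: "kernels_on X E (set vs) m" using Cons.prems by (auto simp: kernels_on_def)
  have IH: "kernel_product X E m vs = density (Pi\<^sub>M (set vs) \<mu>) (?f vs)"
    by (rule Cons.IH[OF vs(1) m]) (use Cons.prems in auto)
  have sets_eq: "sets (Pi\<^sub>M A \<mu>) = sets (prod_space X A)" if "A \<subseteq> set ?vs" for A
    unfolding prod_space_def by (rule sets_PiM_cong) (use Cons.prems(3) that in auto)
  have sp_eq: "space (Pi\<^sub>M A \<mu>) = space (prod_space X A)" if "A \<subseteq> set ?vs" for A
    by (rule sets_eq_imp_space_eq[OF sets_eq[OF that]])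
  have par: "insert u (parents E u) \<subseteq> set ?vs" if "u \<in> set ?vs" for u
    using parents_later_parents[OF Cons.prems(1) that] that by auto
  have par': "insert u (parents E u) \<subseteq> set vs" if "u \<in> set vs" for u
    using parents_later_parents[OF vs(1) that] that by auto
  have qm: "?q u \<in> borel_measurable (prod_space X A)" if "u \<in> set ?vs" "insert u (parents E u) \<subseteq> A" for u A
    by (rule measurable_compose[OF measurable_compose[OF restrict_measurable_prod_space[OF that(2)]
          Cons.prems(4)[OF that(1)]] measurable_ennreal])
  have fm: "?f ws \<in> borel_measurable (prod_space X (set ws))" if "ws = vs \<or> ws = ?vs" for ws
  proof (rule borel_measurable_prod_ennreal)
    fix u assume u: "u \<in> set ws"
    show "?q u \<in> borel_measurable (prod_space X (set ws))"
    proof (rule qm)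
      show "u \<in> set ?vs" using u that by auto
      show "insert u (parents E u) \<subseteq> set ws" using u that par[of u] par'[of u] by blast
    qed
  qed
  have fmP: "?f ws \<in> borel_measurable (Pi\<^sub>M (set ws) \<mu>)" if "ws = vs \<or> ws = ?vs" for ws
  proof -
    have "set ws \<subseteq> set ?vs" using that by auto
    from measurable_cong_sets[OF sets_eq[OF this] refl] fm[OF that] show ?thesis by blast
  qed
  show ?case
  proof (rule measure_eqI)
    show "sets (kernel_product X E m ?vs) = sets (density (Pi\<^sub>M (set ?vs) \<mu>) (?f ?vs))"
      using kernel_product_in_prob_algebra[OF Cons.prems(1,2)] sets_eq[of "set ?vs"]
      by (simp add: space_prob_algebra)
    fix W assume "W \<in> sets (kernel_product X E m ?vs)"
    hence W: "W \<in> sets (prod_space X (set ?vs))"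
      using kernel_product_in_prob_algebra[OF Cons.prems(1,2)] by (simp add: space_prob_algebra)
    hence WP: "W \<in> sets (Pi\<^sub>M (insert v (set vs)) \<mu>)" using sets_eq[of "set ?vs"] by simp
    have sm: "(\<lambda>x. emeasure (m v (restrict x (parents E v))) (slice X v W x)) \<in> borel_measurable (Pi\<^sub>M (set vs) \<mu>)"
      unfolding measurable_cong_sets[OF sets_eq[OF set_subset_Cons] refl]
      by (rule slice_prob_measurable[OF Cons.prems(1,2) W])
    have "emeasure (kernel_product X E m ?vs) W =
        (\<integral>\<^sup>+x. ?f vs x * emeasure (m v (restrict x (parents E v))) (slice X v W x) \<partial>Pi\<^sub>M (set vs) \<mu>)"
      unfolding emeasure_kernel_product_Cons[OF Cons.prems(1,2) W] IH
      by (rule nn_integral_density) (use fmP sm in auto)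
    also have "\<dots> = (\<integral>\<^sup>+x. \<integral>\<^sup>+y. ?f ?vs (x(v := y)) * indicator W (x(v := y)) \<partial>\<mu> v \<partial>Pi\<^sub>M (set vs) \<mu>)"
    proof (rule nn_integral_cong)
      fix x assume "x \<in> space (Pi\<^sub>M (set vs) \<mu>)"
      hence x: "x \<in> space (prod_space X (set vs))" using sp_eq[of "set vs"] by auto
      have xp: "restrict x (parents E v) \<in> space (prod_space X (parents E v))"
        using measurable_space[OF restrict_measurable_prod_space[OF vs(3)] x] .
      have smu: "sets (\<mu> v) = sets (borel_metric (X v))" using Cons.prems(3) by simp
      have spmu: "space (\<mu> v) = mspace (X v)" using sets_eq_imp_space_eq[OF smu] by (simp add: space_borel_metric)
      let ?g = "\<lambda>y. ennreal (p v ((restrict x (parents E v))(v := y)))"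
      have gm: "?g \<in> borel_measurable (\<mu> v)"
        unfolding measurable_cong_sets[OF smu refl]
        by (rule measurable_compose[OF measurable_compose[OF fun_upd_measurable_prod_space[OF xp] Cons.prems(4)] measurable_ennreal]) simp
      have sl: "slice X v W x \<in> sets (\<mu> v)" using slice_measurable[of W X v "set vs" x] W x smu by simp
      have mvx: "m v (restrict x (parents E v)) = density (\<mu> v) ?g"
        by (rule Cons.prems(5)[OF _ xp]) simp
      have "?f vs x * emeasure (m v (restrict x (parents E v))) (slice X v W x)
        = ?f vs x * (\<integral>\<^sup>+y. ?g y * indicator (slice X v W x) y \<partial>\<mu> v)"
        unfolding mvx emeasure_density[OF gm sl] ..
      also have "\<dots> = (\<integral>\<^sup>+y. ?f vs x * (?g y * indicator (slice X v W x) y) \<partial>\<mu> v)"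
        by (rule nn_integral_cmult[symmetric]) (use gm sl in auto)
      also have "\<dots> = (\<integral>\<^sup>+y. ?f ?vs (x(v := y)) * indicator W (x(v := y)) \<partial>\<mu> v)"
      proof (rule nn_integral_cong)
        fix y assume "y \<in> space (\<mu> v)"
        hence y: "y \<in> mspace (X v)" using spmu by simp
        have "restrict (x(v := y)) (insert v (parents E v)) = (restrict x (parents E v))(v := y)"
          using vs(2,3) by (auto simp: restrict_def fun_eq_iff)
        moreover have "?q u (x(v := y)) = ?q u x" if "u \<in> set vs" for u
        proof -
          have "restrict (x(v := y)) (insert u (parents E u)) = restrict x (insert u (parents E u))"
            using par'[OF that] vs(2) by (auto simp: restrict_def fun_eq_iff)
          thus ?thesis by simp
        qed
        ultimately have "?f ?vs (x(v := y)) = ?g y * ?f vs x" using vs(2) by simp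
        moreover have "indicator (slice X v W x) y = (indicator W (x(v := y)) :: ennreal)"
          using y by (simp add: slice_def indicator_def)
        ultimately show "?f vs x * (?g y * indicator (slice X v W x) y) = ?f ?vs (x(v := y)) * indicator W (x(v := y))"
          by (simp add: mult_ac)
      qed
      finally show "?f vs x * emeasure (m v (restrict x (parents E v))) (slice X v W x)
        = (\<integral>\<^sup>+y. ?f ?vs (x(v := y)) * indicator W (x(v := y)) \<partial>\<mu> v)" .
    qed
    also have "\<dots> = (\<integral>\<^sup>+z. ?f ?vs z * indicator W z \<partial>Pi\<^sub>M (insert v (set vs)) \<mu>)"
      by (rule product_nn_integral_insert[symmetric]) (use vs(2) fmP[of ?vs] WP in auto)
    also have "\<dots> = emeasure (density (Pi\<^sub>M (set ?vs) \<mu>) (?f ?vs)) W"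
      using fmP[of ?vs] WP by (simp add: emeasure_density)
    finally show "emeasure (kernel_product X E m ?vs) W = emeasure (density (Pi\<^sub>M (set ?vs) \<mu>) (?f ?vs)) W" .
  qed
qed

section \<open>Total variation continuity of the product\<close>

text \<open>In each step the kernel is exchanged under the same measure, then the measure under the same
  kernel; the second change integrates a function with values in the unit interval.\<close>

lemma kernel_product_tv:
  assumes vs: "parents_later E vs" and m: "kernels_on X E (set vs) m" "kernels_on X E (set vs) m'"
    and e: "\<And>v x S. v \<in> set vs \<Longrightarrow> x \<in> space (prod_space X (parents E v)) \<Longrightarrow> S \<in> sets (borel_metric (X v)) \<Longrightarrow>
      \<bar>measure (m v x) S - measure (m' v x) S\<bar> \<le> e v"
    and W: "W \<in> sets (prod_space X (set vs))"
  shows "\<bar>measure (kernel_product X E m vs) W - measure (kernel_product X E m' vs) W\<bar> \<le> (\<Sum>v\<in>set vs. e v)"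
  using vs m e W
proof (induction vs arbitrary: W)
  case Nil thus ?case by simp
next
  case (Cons v vs)
  let ?vs = "v # vs"
  have vs: "parents_later E vs" "v \<notin> set vs" "parents E v \<subseteq> set vs" using Cons.prems by auto
  have m: "kernels_on X E (set vs) m" "kernels_on X E (set vs) m'" using Cons.prems by (auto simp: kernels_on_def)
  let ?P = "kernel_product X E m vs" and ?Q = "kernel_product X E m' vs"
  have PQ: "prob_space ?P" "prob_space ?Q" "sets ?P = sets (prod_space X (set vs))" "sets ?Q = sets (prod_space X (set vs))"
    using kernel_product_in_prob_algebra[OF vs(1) m(1)] kernel_product_in_prob_algebra[OF vs(1) m(2)]
    by (auto simp: space_prob_algebra)
  have sp: "space ?P = space (prod_space X (set vs))" by (rule sets_eq_imp_space_eq[OF PQ(3)])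
  interpret P: prob_space ?P by fact
  have IH: "\<bar>measure ?P S - measure ?Q S\<bar> \<le> (\<Sum>v\<in>set vs. e v)" if "S \<in> sets ?P" for S
    by (rule Cons.IH[OF vs(1) m]) (use Cons.prems that PQ in auto)
  define g where "g k x = measure (k v (restrict x (parents E v))) (slice X v W x)" for k :: "('a, 'b) kernels" and x
  have gm: "g m \<in> borel_measurable ?P" "g m' \<in> borel_measurable ?P"
    unfolding measurable_cong_sets[OF PQ(3) refl] g_def[abs_def]
    by (rule slice_prob_measurable_real[OF Cons.prems(1,2,5)], rule slice_prob_measurable_real[OF Cons.prems(1,3,5)])
  have g1: "0 \<le> g k x" "g k x \<le> 1" if "x \<in> space ?P" "kernels_on X E (set ?vs) k" for k x
    using kernel_space[OF Cons.prems(1) that(2) Cons.prems(5), of x] that sp prob_space.prob_le_1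
    by (auto simp: g_def space_prob_algebra)
  have gi: "integrable ?P (g m)" "integrable ?P (g m')"
    by (rule P.integrable_const_bound[of _ 1]; use g1 gm Cons.prems in auto)+
  have "\<bar>(\<integral>x. g m x \<partial>?P) - (\<integral>x. g m' x \<partial>?P)\<bar> = \<bar>\<integral>x. g m x - g m' x \<partial>?P\<bar>" using gi by simp
  also have "\<dots> \<le> (\<integral>x. \<bar>g m x - g m' x\<bar> \<partial>?P)" by (rule integral_abs_bound)
  also have "\<dots> \<le> (\<integral>x. e v \<partial>?P)"
  proof (rule integral_mono)
    fix x assume "x \<in> space ?P"
    hence x: "x \<in> space (prod_space X (set vs))" using sp by simp
    show "\<bar>g m x - g m' x\<bar> \<le> e v" unfolding g_def
    proof (rule Cons.prems(4))
      show "restrict x (parents E v) \<in> space (prod_space X (parents E v))"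
        using measurable_space[OF restrict_measurable_prod_space[OF vs(3)] x] .
      show "slice X v W x \<in> sets (borel_metric (X v))"
        using slice_measurable[of W X v "set vs" x] Cons.prems(5) x by simp
    qed simp
  qed (use gi in auto)
  also have "\<dots> = e v" by (simp add: P.prob_space)
  finally have 1: "\<bar>(\<integral>x. g m x \<partial>?P) - (\<integral>x. g m' x \<partial>?P)\<bar> \<le> e v" .
  have 2: "\<bar>(\<integral>x. g m' x \<partial>?P) - (\<integral>x. g m' x \<partial>?Q)\<bar> \<le> (\<Sum>v\<in>set vs. e v)"
    by (rule integral_diff_le_of_events[OF PQ(1,2) _ IH gm(2)]) (use g1 PQ Cons.prems in auto)
  have "measure (kernel_product X E m ?vs) W = (\<integral>x. g m x \<partial>?P)"
    "measure (kernel_product X E m' ?vs) W = (\<integral>x. g m' x \<partial>?Q)"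
    unfolding g_def by (rule measure_kernel_product_Cons[OF Cons.prems(1,2,5)], rule measure_kernel_product_Cons[OF Cons.prems(1,3,5)])
  thus ?case using 1 2 vs(2) by simp
qed

section \<open>Topological orders and the observational distribution\<close>

lemma ex_order_of_acyclic:
  assumes "finite W" "acyclic E"
  shows "\<exists>vs. set vs = W \<and> distinct vs \<and> (\<forall>i<length vs. \<forall>j<length vs. (vs ! i, vs ! j) \<in> E \<longrightarrow> j < i)"
  using assms(1)
proof (induction "card W" arbitrary: W)
  case 0 thus ?case by (intro exI[of _ "[]"]) auto
next
  case (Suc n)
  have "acyclic ((E \<inter> W \<times> W)\<inverse>)" using assms(2) by (simp add: acyclic_subset[of E])
  hence "wf ((E \<inter> W \<times> W)\<inverse>)" using Suc.prems by (intro finite_acyclic_wf) auto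
  moreover have "W \<noteq> {}" using Suc.hyps(2) by auto
  ultimately obtain v where v: "v \<in> W" "\<And>u. (u, v) \<in> (E \<inter> W \<times> W)\<inverse> \<Longrightarrow> u \<notin> W"
    by (metis ex_in_conv wfE_min)
  have sink: "(v, u) \<notin> E" if "u \<in> W" for u using v(1) v(2)[of u] that by blast
  have "n = card (W - {v})" "finite (W - {v})" using Suc.hyps(2)[symmetric] Suc.prems v(1) by (simp_all add: card_Diff_singleton)
  from Suc.hyps(1)[OF this] obtain ws where ws: "set ws = W - {v}" "distinct ws"
    "\<And>i j. i < length ws \<Longrightarrow> j < length ws \<Longrightarrow> (ws ! i, ws ! j) \<in> E \<Longrightarrow> j < i" by blast
  have setW: "set (v # ws) = W" "distinct (v # ws)" using ws(1,2) v(1) by auto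
  have "j < i" if "i < length (v # ws)" "j < length (v # ws)" "((v # ws) ! i, (v # ws) ! j) \<in> E" for i j
  proof (cases i)
    case 0
    have "(v # ws) ! j \<in> set (v # ws)" using that(2) by (rule nth_mem)
    hence "(v # ws) ! j \<in> W" unfolding setW .
    from sink[OF this] show ?thesis using that(3) 0 by simp
  next
    case (Suc i')
    show ?thesis
    proof (cases j)
      case (Suc j')
      thus ?thesis using that ws(3)[of i' j'] \<open>i = Suc i'\<close> by simp
    qed (use Suc in simp)
  qed
  thus ?case using setW by blast
qed

lemma parents_later_of_order:
  assumes "distinct vs" "\<And>v. v \<in> set vs \<Longrightarrow> parents E v \<subseteq> set us \<union> set vs" "distinct (us @ vs)"
    "\<forall>i<length (us @ vs). \<forall>j<length (us @ vs). ((us @ vs) ! i, (us @ vs) ! j) \<in> E \<longrightarrow> j < i"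
  shows "parents_later E vs"
  using assms
proof (induction vs arbitrary: us)
  case (Cons v vs)
  let ?l = "us @ v # vs"
  have "parents E v \<subseteq> set vs"
  proof
    fix w assume w: "w \<in> parents E v"
    hence "w \<in> set ?l" using Cons.prems(2)[of v] by auto
    then obtain i where i: "i < length ?l" "?l ! i = w" by (metis in_set_conv_nth)
    have "(?l ! i, ?l ! length us) \<in> E" using w i by (simp add: parents_def)
    hence "length us < i" using Cons.prems(4) i by (metis length_append length_Cons less_add_Suc1 add_Suc_right)
    then obtain k where k: "i = Suc (length us + k)" using less_imp_Suc_add by blast
    thus "w \<in> set vs" using i by (auto simp: nth_append)
  qed
  moreover have "parents_later E vs"
    by (rule Cons.IH[of "us @ [v]"]) (use Cons.prems in auto)
  ultimately show ?case using Cons.prems by simp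
qed simp

lemma obs_dist_order:
  assumes "finite V" "dag V E"
  shows "\<exists>vs. set vs = V \<and> parents_later E vs \<and> (\<forall>m. obs_dist X V E m = kernel_product X E m vs)"
proof -
  define vs where "vs = (SOME vs. reverse_topological_order V E vs)"
  have E: "E \<subseteq> V \<times> V" "acyclic E" using assms by (auto simp: dag_def)
  have "\<exists>vs. reverse_topological_order V E vs"
    using ex_order_of_acyclic[OF assms(1) E(2)] unfolding reverse_topological_order_def by blast
  hence "reverse_topological_order V E vs" unfolding vs_def by (rule someI_ex)
  hence r: "set vs = V" "distinct vs" "\<forall>i<length vs. \<forall>j<length vs. (vs ! i, vs ! j) \<in> E \<longrightarrow> j < i"
    unfolding reverse_topological_order_def by blast+
  have "parents_later E vs"
  proof (rule parents_later_of_order[of _ _ "[]"])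
    show "parents E v \<subseteq> set [] \<union> set vs" if "v \<in> set vs" for v
      using E(1) r(1) by (auto simp: parents_def)
    show "distinct vs" "distinct ([] @ vs)" using r(2) by simp_all
    show "\<forall>i<length ([] @ vs). \<forall>j<length ([] @ vs). (([] @ vs) ! i, ([] @ vs) ! j) \<in> E \<longrightarrow> j < i"
      unfolding append_Nil by (rule r(3))
  qed
  thus ?thesis using r(1) by (intro exI[of _ vs]) (simp add: obs_dist_def vs_def)
qed

section \<open>Equicontinuous densities are determined by countably many events\<close>

text \<open>A countable family in which every point has arbitrarily small neighbours of finite measure. Balls
  around the points of a countable dense set form one, and so do products of such families. It
  witnesses \<open>\<sigma>\<close>-finiteness, makes uniformly continuous functions measurable, and its members are the events
  that the tests observe.\<close>

definition fine_cover :: "'a measure \<Rightarrow> ('a \<Rightarrow> 'a \<Rightarrow> real) \<Rightarrow> 'a set set \<Rightarrow> bool" where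
  "fine_cover M d \<C> \<longleftrightarrow> countable \<C> \<and> \<C> \<subseteq> sets M \<and>
     (\<forall>x\<in>space M. \<forall>r>0. \<exists>C\<in>\<C>. x \<in> C \<and> (\<forall>y\<in>C. \<forall>z\<in>C. d y z \<le> r) \<and> emeasure M C < \<infinity>)"

lemma fine_coverD:
  assumes "fine_cover M d \<C>"
  shows "countable \<C>" "\<C> \<subseteq> sets M"
    "\<And>x r. x \<in> space M \<Longrightarrow> r > 0 \<Longrightarrow> \<exists>C\<in>\<C>. x \<in> C \<and> (\<forall>y\<in>C. \<forall>z\<in>C. d y z \<le> r) \<and> emeasure M C < \<infinity>"
  using assms unfolding fine_cover_def by blast+

lemma ex_fine_cover_polish:
  assumes S: "polish_state_space S" and \<mu>: "locally_finite_on S \<mu>"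
  shows "\<exists>\<C>. fine_cover \<mu> (mdist S) \<C>"
proof -
  interpret Metric_space "mspace S" "mdist S" by (rule Metric_space_mspace_mdist)
  have top: "mtopology_of S = mtopology" by (simp add: mtopology_of_def)
  obtain D where D: "countable D" "D \<subseteq> mspace S" "mtopology closure_of D = mspace S"
    using S unfolding polish_state_space_def separable_space_def top by auto
  define \<C> where "\<C> = (\<lambda>(y, k). mball y (1 / real (Suc k))) ` (D \<times> UNIV)"
  have sets\<mu>: "sets \<mu> = sets (borel_metric S)" using \<mu> by (simp add: locally_finite_on_def)
  have sp: "space \<mu> = mspace S" using sets_eq_imp_space_eq[OF sets\<mu>] by (simp add: space_borel_metric)
  have openS: "U \<in> sets \<mu>" if "openin mtopology U" for U
  proof -
    have "{U. openin mtopology U} \<subseteq> Pow (mspace S)" using openin_subset by fastforce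
    thus ?thesis unfolding sets\<mu> borel_metric_def top using that
      by (auto intro: sigma_sets.Basic)
  qed
  have "countable \<C>" unfolding \<C>_def using D by auto
  moreover have "\<C> \<subseteq> sets \<mu>" unfolding \<C>_def using openS openin_mball by auto
  moreover have "\<exists>C\<in>\<C>. x \<in> C \<and> (\<forall>y\<in>C. \<forall>z\<in>C. mdist S y z \<le> r) \<and> emeasure \<mu> C < \<infinity>"
    if x: "x \<in> space \<mu>" and r: "r > 0" for x r
  proof -
    obtain U where U: "openin mtopology U" "x \<in> U" "emeasure \<mu> U < \<infinity>"
      using \<mu> x sp unfolding locally_finite_on_def top by auto
    then obtain r0 where r0: "r0 > 0" "mball x r0 \<subseteq> U"
      unfolding openin_mtopology by blast
    have "min r r0 / 2 > 0" using r r0 by simp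
    then obtain k where k: "1 / real (Suc k) < min r r0 / 2" using nat_approx_posE by blast
    have k0: "1 / real (Suc k) > 0" by simp
    have "x \<in> mtopology closure_of D" using D x sp by simp
    hence "\<exists>y\<in>D. y \<in> mball x (1 / real (Suc k))" using k0 unfolding metric_closure_of by blast
    then obtain y where y: "y \<in> D" "mdist S x y < 1 / real (Suc k)" unfolding in_mball by blast
    define C where "C = mball y (1 / real (Suc k))"
    have inC: "z \<in> C \<longleftrightarrow> z \<in> mspace S \<and> mdist S y z < 1 / real (Suc k)" for z
      using y D by (auto simp: C_def in_mball)
    have "C \<in> \<C>" using y by (auto simp: \<C>_def C_def)
    moreover have "x \<in> C" using y x sp commute by (simp add: inC)
    moreover have "mdist S z w \<le> r" if "z \<in> C" "w \<in> C" for z w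
      using triangle[of z y w] that y D k commute[of z y] by (auto simp: inC)
    moreover have "C \<subseteq> U"
    proof
      fix z assume z: "z \<in> C"
      have "mdist S x z \<le> mdist S x y + mdist S y z"
        using triangle[of x y z] z y D x sp by (auto simp: inC)
      hence "mdist S x z < r0" using z y k by (auto simp: inC)
      hence "z \<in> mball x r0" using z x sp by (auto simp: inC in_mball)
      thus "z \<in> U" using r0 by blast
    qed
    hence "emeasure \<mu> C < \<infinity>"
      using emeasure_mono[of C U \<mu>] openS[OF U(1)] U(3) by (auto intro: le_less_trans)
    ultimately show ?thesis by blast
  qed
  ultimately show ?thesis unfolding fine_cover_def by blast
qed

lemma fine_cover_sigma_finite:
  assumes "fine_cover M d \<C>" shows "sigma_finite_measure M"
proof
  have "space M \<subseteq> \<Union>{C \<in> \<C>. emeasure M C < \<infinity>}"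
  proof
    fix x assume "x \<in> space M"
    from fine_coverD(3)[OF assms this zero_less_one] show "x \<in> \<Union>{C \<in> \<C>. emeasure M C < \<infinity>}" by blast
  qed
  moreover have "\<Union>{C \<in> \<C>. emeasure M C < \<infinity>} \<subseteq> space M"
    using fine_coverD(2)[OF assms] sets.sets_into_space by blast
  ultimately have eq: "\<Union>{C \<in> \<C>. emeasure M C < \<infinity>} = space M" by (rule subset_antisym[rotated])
  show "\<exists>A. countable A \<and> A \<subseteq> sets M \<and> \<Union>A = space M \<and> (\<forall>a\<in>A. emeasure M a \<noteq> \<infinity>)"
  proof (intro exI conjI)
    show "countable {C \<in> \<C>. emeasure M C < \<infinity>}"
      by (rule countable_subset[OF _ fine_coverD(1)[OF assms]]) blast
    show "{C \<in> \<C>. emeasure M C < \<infinity>} \<subseteq> sets M" using fine_coverD(2)[OF assms] by blast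
    show "\<forall>a\<in>{C \<in> \<C>. emeasure M C < \<infinity>}. emeasure M a \<noteq> \<infinity>" by auto
  qed (rule eq)
qed

lemma prod_ennreal_less_top:
  fixes f :: "'a \<Rightarrow> ennreal"
  assumes "finite A" "\<And>v. v \<in> A \<Longrightarrow> f v < \<infinity>"
  shows "prod f A < \<infinity>"
  using assms by (induction A rule: finite_induct) (auto simp: ennreal_mult_less_top)

lemma ex_fine_cover_product:
  assumes A: "finite A" and sf: "product_sigma_finite \<mu>"
    and sp: "\<And>v. v \<in> A \<Longrightarrow> space (\<mu> v) = mspace (X v)"
    and fc: "\<And>v. v \<in> A \<Longrightarrow> \<exists>\<C>. fine_cover (\<mu> v) (mdist (X v)) \<C>"
  shows "\<exists>\<C>. fine_cover (Pi\<^sub>M A \<mu>) (prod_dist_on X A) \<C>"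
proof -
  interpret product_sigma_finite \<mu> by fact
  obtain \<C> where C: "\<And>v. v \<in> A \<Longrightarrow> fine_cover (\<mu> v) (mdist (X v)) (\<C> v)" using fc by metis
  define \<B> where "\<B> = Pi\<^sub>E A ` (\<Pi>\<^sub>E v\<in>A. \<C> v)"
  have "countable \<B>" unfolding \<B>_def
    by (intro countable_image countable_PiE A) (use C fine_coverD(1) in blast)
  moreover have "\<B> \<subseteq> sets (Pi\<^sub>M A \<mu>)"
  proof
    fix B assume "B \<in> \<B>"
    then obtain b where b: "b \<in> (\<Pi>\<^sub>E v\<in>A. \<C> v)" "B = Pi\<^sub>E A b" by (auto simp: \<B>_def)
    have "b v \<in> sets (\<mu> v)" if "v \<in> A" for v
      using PiE_mem[OF b(1) that] fine_coverD(2)[OF C[OF that]] by blast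
    thus "B \<in> sets (Pi\<^sub>M A \<mu>)" unfolding b(2) by (rule sets_PiM_I_finite[OF A])
  qed
  moreover have "\<exists>B\<in>\<B>. x \<in> B \<and> (\<forall>y\<in>B. \<forall>z\<in>B. prod_dist_on X A y z \<le> r) \<and> emeasure (Pi\<^sub>M A \<mu>) B < \<infinity>"
    if x: "x \<in> space (Pi\<^sub>M A \<mu>)" and r: "r > 0" for x r
  proof -
    define r' where "r' = r / real (Suc (card A))"
    have r': "r' > 0" using r by (simp add: r'_def)
    have "\<forall>v\<in>A. \<exists>C\<in>\<C> v. x v \<in> C \<and> (\<forall>y\<in>C. \<forall>z\<in>C. mdist (X v) y z \<le> r') \<and> emeasure (\<mu> v) C < \<infinity>"
    proof
      fix v assume v: "v \<in> A"
      have "x v \<in> space (\<mu> v)" using x v by (auto simp: space_PiM)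
      from fine_coverD(3)[OF C[OF v] this r']
      show "\<exists>C\<in>\<C> v. x v \<in> C \<and> (\<forall>y\<in>C. \<forall>z\<in>C. mdist (X v) y z \<le> r') \<and> emeasure (\<mu> v) C < \<infinity>" .
    qed
    then obtain B where B: "\<And>v. v \<in> A \<Longrightarrow> B v \<in> \<C> v" "\<And>v. v \<in> A \<Longrightarrow> x v \<in> B v"
      "\<And>v y z. v \<in> A \<Longrightarrow> y \<in> B v \<Longrightarrow> z \<in> B v \<Longrightarrow> mdist (X v) y z \<le> r'"
      "\<And>v. v \<in> A \<Longrightarrow> emeasure (\<mu> v) (B v) < \<infinity>"
      by (metis bchoice)
    have Bm: "B v \<in> sets (\<mu> v)" if "v \<in> A" for v using B(1) fine_coverD(2)[OF C] that by blast
    have b1: "Pi\<^sub>E A B \<in> \<B>" unfolding \<B>_def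
    proof (rule image_eqI[of _ _ "restrict B A"])
      show "Pi\<^sub>E A B = Pi\<^sub>E A (restrict B A)" by (rule PiE_cong) simp
      show "restrict B A \<in> (\<Pi>\<^sub>E v\<in>A. \<C> v)" using B(1) by simp
    qed
    have b2: "x \<in> Pi\<^sub>E A B" using x B(2) by (auto simp: space_PiM PiE_def)
    have b3: "prod_dist_on X A y z \<le> r" if "y \<in> Pi\<^sub>E A B" "z \<in> Pi\<^sub>E A B" for y z
    proof -
      have "prod_dist_on X A y z \<le> (\<Sum>v\<in>A. mdist (X v) (y v) (z v))"
        unfolding prod_dist_on_def by (rule L2_set_le_sum) simp
      also have "\<dots> \<le> (\<Sum>v\<in>A. r')" by (rule sum_mono) (rule B(3)[OF _ PiE_mem[OF that(1)] PiE_mem[OF that(2)]])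
      also have "\<dots> \<le> r" using r by (simp add: r'_def field_simps)
      finally show ?thesis .
    qed
    have b4: "emeasure (Pi\<^sub>M A \<mu>) (Pi\<^sub>E A B) < \<infinity>"
    proof -
      have "emeasure (Pi\<^sub>M A \<mu>) (Pi\<^sub>E A B) = (\<Prod>v\<in>A. emeasure (\<mu> v) (B v))"
        by (rule emeasure_PiM[OF A Bm])
      also have "\<dots> < \<infinity>" by (rule prod_ennreal_less_top[OF A B(4)])
      finally show ?thesis .
    qed
    show ?thesis by (intro bexI[of _ "Pi\<^sub>E A B"] conjI ballI b1 b2 b3 b4)
  qed
  ultimately show ?thesis unfolding fine_cover_def by blast
qed

definition equicontinuous_on :: "'a set \<Rightarrow> ('a \<Rightarrow> 'a \<Rightarrow> real) \<Rightarrow> ('a \<Rightarrow> real) set \<Rightarrow> bool" where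
  "equicontinuous_on S d \<F> \<longleftrightarrow>
     (\<forall>\<epsilon>>0. \<exists>r>0. \<forall>f\<in>\<F>. \<forall>x\<in>S. \<forall>y\<in>S. d x y \<le> r \<longrightarrow> \<bar>f x - f y\<bar> \<le> \<epsilon>)"

lemma equicontinuous_onE:
  assumes "equicontinuous_on S d \<F>" "\<epsilon> > 0"
  obtains r where "r > 0"
    "\<And>f x y. f \<in> \<F> \<Longrightarrow> x \<in> S \<Longrightarrow> y \<in> S \<Longrightarrow> d x y \<le> r \<Longrightarrow> \<bar>f x - f y\<bar> \<le> \<epsilon>"
proof -
  have "\<exists>r>0. \<forall>f\<in>\<F>. \<forall>x\<in>S. \<forall>y\<in>S. d x y \<le> r \<longrightarrow> \<bar>f x - f y\<bar> \<le> \<epsilon>"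
    using assms unfolding equicontinuous_on_def by simp
  then obtain r where "r > 0" "\<forall>f\<in>\<F>. \<forall>x\<in>S. \<forall>y\<in>S. d x y \<le> r \<longrightarrow> \<bar>f x - f y\<bar> \<le> \<epsilon>" by auto
  thus ?thesis by (intro that[of r]) blast+
qed

text \<open>A superlevel set is the union of the members of the cover that it contains.\<close>

lemma equicontinuous_on_measurable:
  assumes fc: "fine_cover M d \<C>" and eq: "equicontinuous_on (space M) d \<F>" and f: "f \<in> \<F>"
  shows "f \<in> borel_measurable M"
  unfolding borel_measurable_iff_greater
proof
  fix a
  let ?G = "{w \<in> space M. a < f w}" and ?U = "\<Union>{C \<in> \<C>. C \<subseteq> {w \<in> space M. a < f w}}"
  have "?G \<subseteq> ?U"
  proof
    fix w assume "w \<in> ?G"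
    hence w: "w \<in> space M" "(f w - a) / 2 > 0" by auto
    then obtain r where r: "r > 0" "\<And>x y. x \<in> space M \<Longrightarrow> y \<in> space M \<Longrightarrow> d x y \<le> r \<Longrightarrow> \<bar>f x - f y\<bar> \<le> (f w - a) / 2"
      using eq f unfolding equicontinuous_on_def by meson
    obtain C where C: "C \<in> \<C>" "w \<in> C" "\<And>y z. y \<in> C \<Longrightarrow> z \<in> C \<Longrightarrow> d y z \<le> r"
      using fine_coverD(3)[OF fc w(1) r(1)] by blast
    have sub: "C \<subseteq> space M" using C(1) fine_coverD(2)[OF fc] sets.sets_into_space by blast
    have "C \<subseteq> ?G"
    proof
      fix y assume y: "y \<in> C"
      hence "\<bar>f w - f y\<bar> \<le> (f w - a) / 2" using r(2)[of w y] C sub w by blast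
      hence "f w - f y \<le> (f w - a) / 2" by (rule order_trans[OF abs_ge_self])
      moreover have "a < f w" using w(2) by simp
      ultimately have "a < f y" by (simp add: field_simps)
      thus "y \<in> ?G" using y sub by auto
    qed
    thus "w \<in> ?U" using C by blast
  qed
  hence "?G = ?U" by blast
  moreover have "?U \<in> sets M"
    by (rule sets.countable_Union) (use fine_coverD(1,2)[OF fc] in auto)
  ultimately show "?G \<in> sets M" by simp
qed

text \<open>On a small set \<open>C\<close> of positive measure an equicontinuous density is nearly the quotient of the two
  measures of \<open>C\<close>. Convergence on the cover therefore yields pointwise convergence of the densities off a
  null set, and Scheffe's lemma turns this into convergence in total variation.\<close>

theorem equicontinuous_densities_tv_limit:
  fixes p :: "'a \<Rightarrow> real" and q :: "nat \<Rightarrow> 'a \<Rightarrow> real"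
  assumes fc: "fine_cover M d \<C>" and eq: "equicontinuous_on (space M) d \<F>"
    and p: "p \<in> \<F>" "\<And>x. x \<in> space M \<Longrightarrow> 0 \<le> p x" "prob_space (density M (\<lambda>x. ennreal (p x)))"
    and q: "\<And>k. q k \<in> \<F>" "\<And>k x. x \<in> space M \<Longrightarrow> 0 \<le> q k x" "\<And>k. prob_space (density M (\<lambda>x. ennreal (q k x)))"
    and lim: "\<And>C. C \<in> \<C> \<Longrightarrow> (\<lambda>k. measure (density M (\<lambda>x. ennreal (q k x))) C)
        \<longlonglongrightarrow> measure (density M (\<lambda>x. ennreal (p x))) C"
    and \<epsilon>: "\<epsilon> > 0"
  shows "\<exists>k. \<forall>S\<in>sets M. \<bar>measure (density M (\<lambda>x. ennreal (p x))) S - measure (density M (\<lambda>x. ennreal (q k x))) S\<bar> \<le> \<epsilon>"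
proof -
  let ?D = "\<lambda>f. density M (\<lambda>x. ennreal (f x))"
  have meas: "f \<in> borel_measurable M" if "f \<in> \<F>" for f by (rule equicontinuous_on_measurable[OF fc eq that])
  have nn1: "(\<integral>\<^sup>+x. ennreal (f x) \<partial>M) = 1" if "f \<in> \<F>" "prob_space (?D f)" for f
  proof -
    have "(\<integral>\<^sup>+x. ennreal (f x) \<partial>M) = emeasure (?D f) (space M)"
      using meas[OF that(1)] by (subst emeasure_density) (auto intro!: nn_integral_cong)
    also have "\<dots> = 1" using prob_space.emeasure_space_1[OF that(2)] by simp
    finally show ?thesis .
  qed
  have int: "integrable M f" if "f \<in> \<F>" "\<And>x. x \<in> space M \<Longrightarrow> 0 \<le> f x" "prob_space (?D f)" for f
    by (rule integrableI_nonneg) (use meas nn1 that in auto)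
  have ms: "measure (?D f) S = (\<integral>x. indicator S x * f x \<partial>M)"
    if "f \<in> \<F>" "\<And>x. x \<in> space M \<Longrightarrow> 0 \<le> f x" "S \<in> sets M" for f S
  proof -
    have "(\<integral>x. indicator S x * f x \<partial>M) = enn2real (\<integral>\<^sup>+x. ennreal (indicator S x * f x) \<partial>M)"
      by (rule integral_eq_nn_integral) (use meas that in \<open>auto simp: indicator_def\<close>)
    also have "(\<integral>\<^sup>+x. ennreal (indicator S x * f x) \<partial>M) = (\<integral>\<^sup>+x. ennreal (f x) * indicator S x \<partial>M)"
      by (rule nn_integral_cong) (simp add: indicator_def)
    also have "\<dots> = emeasure (?D f) S" using meas that by (simp add: emeasure_density)
    finally show ?thesis by (simp add: measure_def)
  qed
  have ip: "integrable M p" by (rule int[OF p])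
  have iq: "integrable M (q k)" for k by (rule int[OF q(1) q(2) q(3)])
  have msp: "measure (?D p) S = (\<integral>x. indicator S x * p x \<partial>M)" if "S \<in> sets M" for S
    by (rule ms[OF p(1,2) that])
  have msq: "measure (?D (q k)) S = (\<integral>x. indicator S x * q k x \<partial>M)" if "S \<in> sets M" for k S
    by (rule ms[OF q(1,2) that])
  \<comment> \<open>Off \<open>N\<close> every member of the cover around a point has positive measure.\<close>
  define N where "N = \<Union>{C \<in> \<C>. emeasure M C = 0}"
  have "N \<in> null_sets M" unfolding N_def
    by (rule null_sets_UN'[of _ "\<lambda>C. C", simplified]) (use fine_coverD(1,2)[OF fc] in auto)
  hence aeN: "AE x in M. x \<notin> N" by (rule AE_not_in)
  have conv: "(\<lambda>k. q k x) \<longlonglongrightarrow> p x" if x: "x \<in> space M" "x \<notin> N" for x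
  proof (rule LIMSEQ_I)
    fix e :: real assume e: "e > 0"
    hence "e / 4 > 0" by simp
    from equicontinuous_onE[OF eq this] obtain r where r: "r > 0"
      "\<And>f x y. f \<in> \<F> \<Longrightarrow> x \<in> space M \<Longrightarrow> y \<in> space M \<Longrightarrow> d x y \<le> r \<Longrightarrow> \<bar>f x - f y\<bar> \<le> e / 4" by metis
    obtain C where C: "C \<in> \<C>" "x \<in> C" "\<And>y z. y \<in> C \<Longrightarrow> z \<in> C \<Longrightarrow> d y z \<le> r" "emeasure M C < \<infinity>"
      using fine_coverD(3)[OF fc x(1) r(1)] by blast
    have CM: "C \<in> sets M" using C(1) fine_coverD(2)[OF fc] by blast
    define c where "c = measure M C"
    have "emeasure M C \<noteq> 0" using x C by (auto simp: N_def)
    hence c: "c > 0" using C(4) unfolding c_def measure_def by (simp add: enn2real_positive_iff zero_less_iff_neq_zero)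
    have close: "\<bar>measure (?D f) C - f x * c\<bar> \<le> e / 4 * c"
      if f: "f \<in> \<F>" "\<And>x. x \<in> space M \<Longrightarrow> 0 \<le> f x" "prob_space (?D f)" for f
    proof -
      have intf: "integrable M f" by (rule int[OF f])
      have i1: "integrable M (\<lambda>y. indicator C y * f y)"
        using integrable_mult_indicator[OF CM intf] by simp
      have mf: "measure (?D f) C = (\<integral>y. indicator C y * f y \<partial>M)" by (rule ms[OF f(1,2) CM])
      have i2: "integrable M (\<lambda>y. indicator C y :: real)" using CM C(4) by simp
      have i3: "integrable M (\<lambda>y. indicator C y * f y - f x * indicator C y)" using i1 i2 by auto
      have "measure (?D f) C - f x * c = (\<integral>y. indicator C y * f y - f x * indicator C y \<partial>M)"
        using i1 i2 sets.sets_into_space[OF CM] mf by (simp add: c_def Int_absorb2)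
      also have "\<bar>\<dots>\<bar> \<le> (\<integral>y. \<bar>indicator C y * f y - f x * indicator C y\<bar> \<partial>M)" by (rule integral_abs_bound)
      also have "\<dots> \<le> (\<integral>y. e / 4 * indicator C y \<partial>M)"
      proof (rule integral_mono)
        fix y assume y: "y \<in> space M"
        have "\<bar>f y - f x\<bar> \<le> e / 4" if "y \<in> C" using r(2)[OF f(1) y x(1) C(3)[OF that C(2)]] .
        thus "\<bar>indicator C y * f y - f x * indicator C y\<bar> \<le> e / 4 * indicator C y"
          by (simp add: indicator_def)
      qed (use i3 i2 in auto)
      also have "\<dots> = e / 4 * c" using sets.sets_into_space[OF CM] by (simp add: c_def Int_absorb2)
      finally show ?thesis .
    qed
    have "e / 4 * c > 0" using e c by simp
    from LIMSEQ_D[OF lim[OF C(1)] this]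
    obtain k0 where k0: "\<And>k. k \<ge> k0 \<Longrightarrow> \<bar>measure (?D (q k)) C - measure (?D p) C\<bar> < e / 4 * c" by auto
    have "norm (q k x - p x) < e" if "k \<ge> k0" for k
    proof -
      have "\<bar>q k x * c - p x * c\<bar> < 3 * (e / 4 * c)"
      proof -
        have "\<bar>measure (?D (q k)) C - q k x * c\<bar> \<le> e / 4 * c" by (rule close[OF q(1) q(2) q(3)])
        moreover have "\<bar>measure (?D p) C - p x * c\<bar> \<le> e / 4 * c" by (rule close[OF p])
        ultimately show ?thesis using k0[OF that] by linarith
      qed
      hence "\<bar>q k x - p x\<bar> * c < 3 * (e / 4) * c" using c by (simp add: abs_mult flip: left_diff_distrib)
      hence "\<bar>q k x - p x\<bar> < 3 * (e / 4)" using c by simp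
      thus ?thesis using e by simp
    qed
    thus "\<exists>k0. \<forall>k\<ge>k0. norm (q k x - p x) < e" by blast
  qed
  have "(\<lambda>k. \<integral>\<^sup>+x. norm (q k x - p x) \<partial>M) \<longlonglongrightarrow> 0"
  proof (rule Scheffe_lemma2)
    show "q k \<in> borel_measurable M" for k by (rule meas[OF q(1)])
    show "integrable M p" by (rule ip)
    show "AE x in M. (\<lambda>k. q k x) \<longlonglongrightarrow> p x"
      using aeN AE_space by eventually_elim (rule conv)
    have "(\<integral>\<^sup>+x. norm (f x) \<partial>M) = (\<integral>\<^sup>+x. ennreal (f x) \<partial>M)" if "\<And>x. x \<in> space M \<Longrightarrow> 0 \<le> f x" for f :: "'a \<Rightarrow> real"
      by (rule nn_integral_cong) (simp add: that)
    thus "(\<integral>\<^sup>+x. norm (q k x) \<partial>M) \<le> (\<integral>\<^sup>+x. norm (p x) \<partial>M)" for k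
      using nn1[OF q(1,3)] nn1[OF p(1,3)] p(2) q(2) by simp
  qed
  hence "eventually (\<lambda>k. (\<integral>\<^sup>+x. norm (q k x - p x) \<partial>M) < ennreal \<epsilon>) sequentially"
    by (rule order_tendstoD) (use \<epsilon> in simp)
  then obtain k where k: "(\<integral>\<^sup>+x. norm (q k x - p x) \<partial>M) < ennreal \<epsilon>"
    by (auto simp: eventually_sequentially)
  have di: "integrable M (\<lambda>x. q k x - p x)" using iq ip by auto
  have le: "(\<integral>x. \<bar>q k x - p x\<bar> \<partial>M) \<le> \<epsilon>"
  proof -
    have "ennreal (\<integral>x. \<bar>q k x - p x\<bar> \<partial>M) = (\<integral>\<^sup>+x. \<bar>q k x - p x\<bar> \<partial>M)"
      by (rule nn_integral_eq_integral[symmetric]) (use di in auto)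
    hence "ennreal (\<integral>x. \<bar>q k x - p x\<bar> \<partial>M) \<le> ennreal \<epsilon>" using k by simp
    thus ?thesis using \<epsilon> by (simp add: ennreal_le_iff)
  qed
  show ?thesis
  proof (intro exI[of _ k] ballI)
    fix S assume S: "S \<in> sets M"
    have i: "integrable M (\<lambda>x. indicator S x * p x)" "integrable M (\<lambda>x. indicator S x * q k x)"
      "integrable M (\<lambda>x. indicator S x * (q k x - p x))"
      using integrable_mult_indicator[OF S ip] integrable_mult_indicator[OF S iq]
        integrable_mult_indicator[OF S di] by auto
    have "\<bar>measure (?D p) S - measure (?D (q k)) S\<bar> = \<bar>\<integral>x. indicator S x * (q k x - p x) \<partial>M\<bar>"
      using i(1,2) by (simp add: msp[OF S] msq[OF S] right_diff_distrib abs_minus_commute)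
    also have "\<dots> \<le> (\<integral>x. \<bar>indicator S x * (q k x - p x)\<bar> \<partial>M)" by (rule integral_abs_bound)
    also have "\<dots> \<le> (\<integral>x. \<bar>q k x - p x\<bar> \<partial>M)"
      by (rule integral_mono) (use i(3) di in \<open>auto simp: indicator_def\<close>)
    finally show "\<bar>measure (?D p) S - measure (?D (q k)) S\<bar> \<le> \<epsilon>" using le by linarith
  qed
qed

section \<open>A consistent test for separated hypotheses\<close>

lemma empirical_frequency_deviation:
  assumes P: "prob_space P" and C: "C \<in> sets P" and n: "n > 0" and \<delta>: "\<delta> > 0"
  shows "measure (iid P n) {s \<in> space (iid P n).
      \<delta> \<le> \<bar>(\<Sum>i<n. indicator C (s i)) / real n - measure P C\<bar>} \<le> 2 * exp (- 2 * real n * \<delta>\<^sup>2)"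
proof -
  interpret P: prob_space P by fact
  interpret I: product_prob_space "\<lambda>_. P" "{..<n}" by unfold_locales
  let ?M = "iid P n"
  have Mp: "prob_space ?M" by (rule prob_space_PiM) (rule P)
  have comp: "distr ?M P (\<lambda>s. s i) = P" if "i < n" for i
    using I.PiM_component[of i] that by simp
  have rv: "(\<lambda>s. s i) \<in> ?M \<rightarrow>\<^sub>M P" if "i < n" for i
    by (rule measurable_component_singleton) (use that in simp)
  have "distr ?M ?M (\<lambda>s. \<lambda>i\<in>{..<n}. s i) = distr ?M ?M (\<lambda>s. s)"
    by (rule distr_cong) (auto simp: space_PiM PiE_def extensional_restrict)
  also have "\<dots> = ?M" by (rule distr_id)
  also have "\<dots> = Pi\<^sub>M {..<n} (\<lambda>i. distr ?M P (\<lambda>s. s i))"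
    by (rule PiM_cong) (use comp in auto)
  finally have "prob_space.indep_vars ?M (\<lambda>_. P) (\<lambda>i s. s i) {..<n}"
    by (subst prob_space.indep_vars_iff_distr_eq_PiM'[OF Mp]) (use n rv in auto)
  hence ind: "prob_space.indep_vars ?M (\<lambda>_. borel) (\<lambda>i s. indicator C (s i) :: real) {..<n}"
    by (rule prob_space.indep_vars_compose2[OF Mp]) (use C in auto)
  have ex: "(\<integral>s. (indicator C (s i) :: real) \<partial>?M) = measure P C" if "i < n" for i
  proof -
    have "(\<integral>x. indicator C x \<partial>distr ?M P (\<lambda>s. s i)) = (\<integral>s. (indicator C (s i) :: real) \<partial>?M)"
      by (rule integral_distr[OF rv[OF that]]) (use C in simp)
    hence "(\<integral>s. (indicator C (s i) :: real) \<partial>?M) = (\<integral>x. indicator C x \<partial>distr ?M P (\<lambda>s. s i))" by simp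
    also have "\<dots> = measure P C" using C sets.sets_into_space[OF C] by (simp add: comp[OF that] Int_absorb2)
    finally show ?thesis .
  qed
  interpret H: Hoeffding_ineq ?M "{..<n}" "\<lambda>i s. indicator C (s i)" "\<lambda>_. 0" "\<lambda>_. 1" "\<Sum>i<n. \<integral>s. indicator C (s i) \<partial>?M"
    by unfold_locales (use ind in auto)
  have \<mu>: "(\<Sum>i<n. \<integral>s. indicator C (s i) \<partial>?M) = real n * measure P C" using ex by simp
  have "{s \<in> space ?M. \<delta> \<le> \<bar>(\<Sum>i<n. indicator C (s i)) / real n - measure P C\<bar>}
      = {s \<in> space ?M. real n * \<delta> \<le> \<bar>(\<Sum>i<n. indicator C (s i)) - (\<Sum>i<n. \<integral>s. indicator C (s i) \<partial>?M)\<bar>}"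
  proof -
    have "\<delta> \<le> \<bar>x / real n - m\<bar> \<longleftrightarrow> real n * \<delta> \<le> \<bar>x - real n * m\<bar>" for x m :: real
    proof -
      have "x - real n * m = real n * (x / real n - m)" using n by (simp add: field_simps)
      hence "\<bar>x - real n * m\<bar> = real n * \<bar>x / real n - m\<bar>" by (simp add: abs_mult)
      thus ?thesis using n by simp
    qed
    thus ?thesis unfolding \<mu> by simp
  qed
  also have "measure ?M \<dots> \<le> 2 * exp (- 2 * (real n * \<delta>)\<^sup>2 / (\<Sum>i<n. (1 - 0)\<^sup>2))"
    by (rule H.Hoeffding_ineq_abs_ge) (use n \<delta> in auto)
  also have "- 2 * (real n * \<delta>)\<^sup>2 / (\<Sum>i<n. (1 - 0)\<^sup>2) = - 2 * real n * \<delta>\<^sup>2"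
    using n by (simp add: power2_eq_square)
  finally show ?thesis .
qed

lemma sum_indicator_card:
  fixes n :: nat
  shows "(\<Sum>i<n. indicator C (s i) :: real) = real (card {i. i < n \<and> s i \<in> C})"
proof -
  have "(\<Sum>i<n. indicator C (s i) :: real) = (\<Sum>i\<in>{..<n}. if s i \<in> C then 1 else 0)"
    by (rule sum.cong) (auto simp: indicator_def)
  also have "\<dots> = real (card ({..<n} \<inter> {i. s i \<in> C}))" by (subst sum.If_cases) auto
  also have "{..<n} \<inter> {i. s i \<in> C} = {i. i < n \<and> s i \<in> C}" by auto
  finally show ?thesis .
qed

text \<open>The test looks at the first \<open>k\<close> of the separating events, with \<open>k\<close> growing slowly in the sample size
  \<open>n\<close>, and accepts if some distribution in \<open>H0\<close> fits their empirical frequencies up to \<open>1 / (2 * (k + 1))\<close>.\<close>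

theorem ex_consistent_test:
  fixes M :: "'a measure" and C :: "nat \<Rightarrow> 'a set"
  assumes prob: "\<And>P. P \<in> \<P> \<Longrightarrow> prob_space P" "\<And>P. P \<in> \<P> \<Longrightarrow> sets P = sets M"
    and C: "\<And>j. C j \<in> sets M"
    and sep: "\<And>P. P \<in> \<P> \<Longrightarrow> P \<notin> H0 \<Longrightarrow>
      \<exists>N. \<exists>\<epsilon>>0. \<forall>Q\<in>H0. \<exists>j<N. \<epsilon> \<le> \<bar>measure P (C j) - measure Q (C j)\<bar>"
  shows "\<exists>\<phi>. (\<forall>n. \<phi> n \<in> iid M n \<rightarrow>\<^sub>M count_space {0, 1 :: nat}) \<and>
    (\<forall>P\<in>\<P>. (P \<in> H0 \<longrightarrow> (\<lambda>n. measure (iid P n) {s \<in> space (iid P n). \<phi> n s = 0}) \<longlonglongrightarrow> 1) \<and>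
      (P \<notin> H0 \<longrightarrow> (\<lambda>n. measure (iid P n) {s \<in> space (iid P n). \<phi> n s = 1}) \<longlonglongrightarrow> 1))"
proof -
  define F where "F n j s = (\<Sum>i<n. indicator (C j) (s i)) / real n" for n j and s :: "nat \<Rightarrow> 'a"
  \<comment> \<open>Slow enough that \<open>k n\<close> deviations of size \<open>\<delta> n\<close> are jointly unlikely: \<open>n * (\<delta> n)\<^sup>2\<close> is of order \<open>sqrt n\<close>.\<close>
  define k where "k n = nat \<lfloor>real n powr (1/4)\<rfloor>" for n
  define \<delta> where "\<delta> n = 1 / (2 * (real (k n) + 1))" for n
  define good where "good n a \<longleftrightarrow> (\<exists>Q\<in>H0. \<forall>j<k n. \<bar>a j - measure Q (C j)\<bar> < \<delta> n)" for n and a :: "nat \<Rightarrow> real"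
  define acc where "acc n = {s \<in> space (iid M n). good n (\<lambda>j. F n j s)}" for n
  define \<phi> where "\<phi> n s = (if s \<in> acc n then 0 else 1 :: nat)" for n s
  have Fm: "F n j \<in> borel_measurable (iid M n)" for n j
    unfolding F_def
    by (intro borel_measurable_divide borel_measurable_sum measurable_const)
      (use C measurable_compose[OF measurable_component_singleton] in auto)
  have acc: "acc n \<in> sets (iid M n)" for n
  proof -
    \<comment> \<open>Empirical frequencies have finitely many values, so \<open>acc n\<close> is a finite union of measurable sets, whatever \<open>H0\<close> is.\<close>
    define A where "A = (\<Pi>\<^sub>E j\<in>{..<k n}. (\<lambda>m. real m / real n) ` {..n}) \<inter> {a. good n a}"
    have fin: "finite A" unfolding A_def by (intro finite_Int disjI1 finite_PiE) auto
    have Frange: "F n j s \<in> (\<lambda>m. real m / real n) ` {..n}" for j s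
    proof -
      have "card {i. i < n \<and> s i \<in> C j} \<le> card {..<n}" by (rule card_mono) auto
      thus ?thesis unfolding F_def sum_indicator_card by auto
    qed
    have gr: "good n a \<longleftrightarrow> good n b" if "\<And>j. j < k n \<Longrightarrow> a j = b j" for a b
      using that unfolding good_def by auto
    have "acc n = (\<Union>a\<in>A. {s \<in> space (iid M n). \<forall>j\<in>{..<k n}. F n j s = a j})"
    proof (intro equalityI subsetI)
      fix s assume s: "s \<in> acc n"
      define a where "a = (\<lambda>j\<in>{..<k n}. F n j s)"
      have "good n a" using s gr[of "\<lambda>j. F n j s" a] by (auto simp: acc_def a_def)
      hence "a \<in> A" using Frange by (auto simp: A_def a_def)
      moreover have "s \<in> {s \<in> space (iid M n). \<forall>j\<in>{..<k n}. F n j s = a j}"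
        using s by (auto simp: acc_def a_def)
      ultimately show "s \<in> (\<Union>a\<in>A. {s \<in> space (iid M n). \<forall>j\<in>{..<k n}. F n j s = a j})" by blast
    next
      fix s assume "s \<in> (\<Union>a\<in>A. {s \<in> space (iid M n). \<forall>j\<in>{..<k n}. F n j s = a j})"
      then obtain a where a: "a \<in> A" "s \<in> space (iid M n)" "\<And>j. j < k n \<Longrightarrow> F n j s = a j" by auto
      have "good n (\<lambda>j. F n j s)" using a gr[of "\<lambda>j. F n j s" a] by (simp add: A_def)
      thus "s \<in> acc n" using a(2) by (simp add: acc_def)
    qed
    moreover have "{s \<in> space (iid M n). \<forall>j\<in>{..<k n}. F n j s = a j} \<in> sets (iid M n)" for a
    proof (rule sets.sets_Collect_finite_All)
      fix j show "{s \<in> space (iid M n). F n j s = a j} \<in> sets (iid M n)"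
        using Fm[of n j] by measurable
    qed simp
    ultimately show ?thesis using fin by auto
  qed
  have \<phi>m: "\<phi> n \<in> iid M n \<rightarrow>\<^sub>M count_space {0, 1}" for n
    unfolding \<phi>_def by (rule measurable_If_set) (use acc[of n] in \<open>auto simp: acc_def Int_absorb2\<close>)
  define bad where "bad P n = {s \<in> space (iid P n). \<exists>j<k n. \<delta> n \<le> \<bar>F n j s - measure P (C j)\<bar>}" for P n
  have badm: "bad P n \<in> sets (iid P n)" and bad: "n > 0 \<Longrightarrow> measure (iid P n) (bad P n) \<le> real (k n) * (2 * exp (- 2 * real n * (\<delta> n)\<^sup>2))"
    if P: "P \<in> \<P>" for P n
  proof -
    interpret prob_space "iid P n" by (rule prob_space_PiM) (rule prob(1)[OF P])
    have s: "sets (iid P n) = sets (iid M n)" by (rule sets_PiM_cong) (use prob(2)[OF P] in auto)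
    define B where "B j = {s \<in> space (iid P n). \<delta> n \<le> \<bar>F n j s - measure P (C j)\<bar>}" for j
    have "F n j \<in> borel_measurable (iid P n)" for j using Fm s by (simp cong: measurable_cong_sets)
    hence Bm: "B j \<in> sets (iid P n)" for j unfolding B_def by measurable
    have e: "bad P n = (\<Union>j<k n. B j)" by (auto simp: bad_def B_def)
    show "bad P n \<in> sets (iid P n)" unfolding e using Bm by auto
    assume n: "n > 0"
    have "measure (iid P n) (bad P n) \<le> (\<Sum>j<k n. measure (iid P n) (B j))"
      unfolding e by (rule finite_measure_subadditive_finite) (use Bm in auto)
    also have "\<dots> \<le> (\<Sum>j<k n. 2 * exp (- 2 * real n * (\<delta> n)\<^sup>2))"
      unfolding B_def F_def
      by (intro sum_mono empirical_frequency_deviation prob(1)[OF P] n)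
        (use C prob(2)[OF P] in \<open>auto simp: \<delta>_def\<close>)
    finally show "measure (iid P n) (bad P n) \<le> real (k n) * (2 * exp (- 2 * real n * (\<delta> n)\<^sup>2))" by simp
  qed
  have bound: "real (k n) * (2 * exp (- 2 * real n * (\<delta> n)\<^sup>2))
      \<le> real n powr (1/4) * (2 * exp (- real n / (2 * (real n powr (1/4) + 1)\<^sup>2)))" for n
  proof -
    have k: "real (k n) \<le> real n powr (1/4)" unfolding k_def by simp
    have "(real (k n) + 1)\<^sup>2 \<le> (real n powr (1/4) + 1)\<^sup>2" by (rule power_mono) (use k in auto)
    hence "real n / (2 * (real n powr (1/4) + 1)\<^sup>2) \<le> real n / (2 * (real (k n) + 1)\<^sup>2)"
      by (intro divide_left_mono mult_pos_pos) (auto simp: zero_less_power2 add_nonneg_eq_0_iff)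
    moreover have d2: "(\<delta> n)\<^sup>2 = 1 / (4 * (real (k n) + 1)\<^sup>2)"
      unfolding \<delta>_def power_divide power_mult_distrib by simp
    have "2 * real n * (\<delta> n)\<^sup>2 = real n / (2 * (real (k n) + 1)\<^sup>2)" unfolding d2 by simp
    with calculation show ?thesis by (intro mult_mono k) auto
  qed
  have lim0: "(\<lambda>n. real n powr (1/4) * (2 * exp (- real n / (2 * (real n powr (1/4) + 1)\<^sup>2)))) \<longlonglongrightarrow> 0"
    by real_asymp
  have bad0: "(\<lambda>n. measure (iid P n) (bad P n)) \<longlonglongrightarrow> 0" if "P \<in> \<P>" for P
  proof (rule tendsto_sandwich[OF _ _ tendsto_const lim0])
    show "\<forall>\<^sub>F n in sequentially. measure (iid P n) (bad P n)
        \<le> real n powr (1/4) * (2 * exp (- real n / (2 * (real n powr (1/4) + 1)\<^sup>2)))"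
      by (rule eventually_sequentiallyI[of 1], rule order_trans[OF bad[OF that] bound]) simp
  qed simp
  have conv: "(\<lambda>n. measure (iid P n) {s \<in> space (iid P n). \<phi> n s = c}) \<longlonglongrightarrow> 1"
    if P: "P \<in> \<P>" and c: "c \<in> {0, 1}"
      and ev: "eventually (\<lambda>n. \<forall>s\<in>space (iid P n). s \<notin> bad P n \<longrightarrow> \<phi> n s = c) sequentially" for P c
  proof (rule tendsto_sandwich)
    show "(\<lambda>n. 1 - measure (iid P n) (bad P n)) \<longlonglongrightarrow> 1"
      using tendsto_diff[OF tendsto_const[of 1] bad0[OF P]] by simp
    show "(\<lambda>n. 1) \<longlonglongrightarrow> (1 :: real)" by simp
    have pr: "prob_space (iid P n)" for n by (rule prob_space_PiM) (rule prob(1)[OF P])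
    show "\<forall>\<^sub>F n in sequentially. measure (iid P n) {s \<in> space (iid P n). \<phi> n s = c} \<le> 1"
      using prob_space.prob_le_1[OF pr] by simp
    show "\<forall>\<^sub>F n in sequentially. 1 - measure (iid P n) (bad P n) \<le> measure (iid P n) {s \<in> space (iid P n). \<phi> n s = c}"
      using ev
    proof eventually_elim
      case (elim n)
      have s: "sets (iid P n) = sets (iid M n)" by (rule sets_PiM_cong) (use prob(2)[OF P] in auto)
      have "\<phi> n \<in> iid P n \<rightarrow>\<^sub>M count_space {0, 1}" using \<phi>m[of n] measurable_cong_sets[OF s refl] by blast
      from measurable_sets[OF this, of "{c}"] c
      have "{s \<in> space (iid P n). \<phi> n s = c} \<in> sets (iid P n)"
        by (auto simp: vimage_def Int_def conj_commute)
      moreover have "space (iid P n) - bad P n \<subseteq> {s \<in> space (iid P n). \<phi> n s = c}" using elim by auto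
      ultimately have "measure (iid P n) (space (iid P n) - bad P n) \<le> measure (iid P n) {s \<in> space (iid P n). \<phi> n s = c}"
        by (intro finite_measure.finite_measure_mono prob_space.finite_measure[OF pr]) auto
      thus ?case using prob_space.prob_compl[OF pr badm[OF P]] by simp
    qed
  qed
  have sp: "space (iid P n) = space (iid M n)" if "P \<in> \<P>" for P n
    by (rule sets_eq_imp_space_eq, rule sets_PiM_cong) (use prob(2)[OF that] in auto)
  have "(\<lambda>n. measure (iid P n) {s \<in> space (iid P n). \<phi> n s = 0}) \<longlonglongrightarrow> 1" if P: "P \<in> \<P>" "P \<in> H0" for P
  proof (rule conv[OF P(1)])
    show "\<forall>\<^sub>F n in sequentially. \<forall>s\<in>space (iid P n). s \<notin> bad P n \<longrightarrow> \<phi> n s = 0"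
    proof (intro always_eventually allI ballI impI)
      fix n s assume s: "s \<in> space (iid P n)" "s \<notin> bad P n"
      have "\<forall>j<k n. \<bar>F n j s - measure P (C j)\<bar> < \<delta> n" using s by (auto simp: bad_def not_le)
      hence "good n (\<lambda>j. F n j s)" using P(2) unfolding good_def by blast
      thus "\<phi> n s = 0" using s sp[OF P(1)] by (simp add: \<phi>_def acc_def)
    qed
  qed simp
  moreover have "(\<lambda>n. measure (iid P n) {s \<in> space (iid P n). \<phi> n s = 1}) \<longlonglongrightarrow> 1" if P: "P \<in> \<P>" "P \<notin> H0" for P
  proof (rule conv[OF P(1)])
    obtain N \<epsilon> where N: "\<epsilon> > 0" "\<And>Q. Q \<in> H0 \<Longrightarrow> \<exists>j<N. \<epsilon> \<le> \<bar>measure P (C j) - measure Q (C j)\<bar>"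
      using sep[OF P] by blast
    have kinf: "filterlim k at_top sequentially" unfolding k_def by real_asymp
    have e1: "eventually (\<lambda>n. N \<le> k n) sequentially" using kinf unfolding filterlim_at_top by blast
    have e2: "eventually (\<lambda>n. nat \<lceil>1 / \<epsilon>\<rceil> \<le> k n) sequentially" using kinf unfolding filterlim_at_top by blast
    show "\<forall>\<^sub>F n in sequentially. \<forall>s\<in>space (iid P n). s \<notin> bad P n \<longrightarrow> \<phi> n s = 1"
      using e1 e2
    proof eventually_elim
      case (elim n)
      have "1 / \<epsilon> \<le> real (k n)" using elim(2) by linarith
      hence "1 \<le> real (k n) * \<epsilon>" using N(1) by (simp add: field_simps)
      hence "1 \<le> (real (k n) + 1) * \<epsilon>" using N(1) by (simp add: algebra_simps)
      hence d: "2 * \<delta> n \<le> \<epsilon>" using N(1) by (simp add: \<delta>_def field_simps)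
      show ?case
      proof (intro ballI impI)
        fix s assume s: "s \<in> space (iid P n)" "s \<notin> bad P n"
        have b: "\<bar>F n j s - measure P (C j)\<bar> < \<delta> n" if "j < k n" for j
          using s that by (auto simp: bad_def not_le)
        have "\<not> good n (\<lambda>j. F n j s)"
        proof
          assume "good n (\<lambda>j. F n j s)"
          then obtain Q where Q: "Q \<in> H0" "\<And>j. j < k n \<Longrightarrow> \<bar>F n j s - measure Q (C j)\<bar> < \<delta> n"
            unfolding good_def by blast
          obtain j where j: "j < N" "\<epsilon> \<le> \<bar>measure P (C j) - measure Q (C j)\<bar>" using N(2)[OF Q(1)] by blast
          have "j < k n" using j elim(1) by simp
          from b[OF this] Q(2)[OF this] j(2) d show False by linarith
        qed
        thus "\<phi> n s = 1" by (simp add: \<phi>_def acc_def)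
      qed
    qed
  qed simp
  ultimately show ?thesis using \<phi>m by blast
qed

section \<open>Bounded equicontinuous Bayesian networks\<close>

lemma emeasure_density_mixture:
  fixes f g :: "'a \<Rightarrow> real"
  assumes t: "t \<in> {0..1}" and f: "f \<in> borel_measurable M" "\<And>x. x \<in> space M \<Longrightarrow> 0 \<le> f x"
    and g: "g \<in> borel_measurable M" "\<And>x. x \<in> space M \<Longrightarrow> 0 \<le> g x" and S: "S \<in> sets M"
  shows "emeasure (density M (\<lambda>x. ennreal ((1 - t) * f x + t * g x))) S =
    ennreal (1 - t) * emeasure (density M (\<lambda>x. ennreal (f x))) S + ennreal t * emeasure (density M (\<lambda>x. ennreal (g x))) S"
proof -
  have "emeasure (density M (\<lambda>x. ennreal ((1 - t) * f x + t * g x))) S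
    = (\<integral>\<^sup>+x. ennreal ((1 - t) * f x + t * g x) * indicator S x \<partial>M)"
    using f g S by (simp add: emeasure_density)
  also have "\<dots> = (\<integral>\<^sup>+x. ennreal (1 - t) * (ennreal (f x) * indicator S x) + ennreal t * (ennreal (g x) * indicator S x) \<partial>M)"
    by (rule nn_integral_cong)
      (use t f(2) g(2) in \<open>auto simp: indicator_def ennreal_mult ennreal_plus\<close>)
  also have "\<dots> = ennreal (1 - t) * (\<integral>\<^sup>+x. ennreal (f x) * indicator S x \<partial>M) + ennreal t * (\<integral>\<^sup>+x. ennreal (g x) * indicator S x \<partial>M)"
    using f g S by (simp add: nn_integral_add nn_integral_cmult)
  finally show ?thesis using f g S by (simp add: emeasure_density)
qed

lemma measure_mixture:
  assumes "prob_space P" "prob_space Q" "t \<in> {0..1}"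
    "emeasure R S = ennreal (1 - t) * emeasure P S + ennreal t * emeasure Q S"
  shows "measure R S = (1 - t) * measure P S + t * measure Q S"
proof -
  have "emeasure R S = ennreal ((1 - t) * measure P S + t * measure Q S)"
    using assms(3) unfolding assms(4)
    by (simp add: finite_measure.emeasure_eq_measure[OF prob_space.finite_measure[OF assms(1)]]
       finite_measure.emeasure_eq_measure[OF prob_space.finite_measure[OF assms(2)]] ennreal_mult ennreal_plus)
  thus ?thesis by (rule measure_eq_emeasure_eq_ennreal[rotated]) (use assms(3) in simp)
qed

definition eqb_density :: "('v \<Rightarrow> 'x metric) \<Rightarrow> real \<Rightarrow> (real \<Rightarrow> real) \<Rightarrow> 'v set \<Rightarrow> (('v \<Rightarrow> 'x) \<Rightarrow> real) \<Rightarrow> bool" where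
  "eqb_density X K \<omega> A p \<longleftrightarrow>
     (\<forall>x\<in>space (prod_space X A). 0 \<le> p x \<and> p x \<le> K) \<and>
     (\<forall>x\<in>space (prod_space X A). \<forall>y\<in>space (prod_space X A).
        \<bar>p x - p y\<bar> \<le> \<omega> (prod_dist_on X A x y))"

lemma eqb_density_mixture:
  assumes "eqb_density X K \<omega> A p" "eqb_density X K \<omega> A q" "t \<in> {0..1}"
  shows "eqb_density X K \<omega> A (\<lambda>x. (1 - t) * p x + t * q x)"
  unfolding eqb_density_def
proof (intro conjI ballI)
  fix x assume x: "x \<in> space (prod_space X A)"
  have p: "0 \<le> p x" "p x \<le> K" and q: "0 \<le> q x" "q x \<le> K" using assms x by (auto simp: eqb_density_def)
  show "0 \<le> (1 - t) * p x + t * q x" using p q assms(3) by simp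
  show "(1 - t) * p x + t * q x \<le> K"
    by (rule convex_bound_le) (use p q assms(3) in auto)
  fix y assume y: "y \<in> space (prod_space X A)"
  let ?w = "\<omega> (prod_dist_on X A x y)"
  have w: "\<bar>p x - p y\<bar> \<le> ?w" "\<bar>q x - q y\<bar> \<le> ?w" using assms x y by (auto simp: eqb_density_def)
  have "(1 - t) * p x + t * q x - ((1 - t) * p y + t * q y) = (1 - t) * (p x - p y) + t * (q x - q y)"
    by (simp add: algebra_simps)
  also have "\<bar>\<dots>\<bar> \<le> (1 - t) * \<bar>p x - p y\<bar> + t * \<bar>q x - q y\<bar>"
    using abs_triangle_ineq[of "(1 - t) * (p x - p y)" "t * (q x - q y)"] assms(3) by (simp add: abs_mult)
  also have "\<dots> \<le> ?w" by (rule convex_bound_le) (use w assms(3) in auto)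
  finally show "\<bar>(1 - t) * p x + t * q x - ((1 - t) * p y + t * q y)\<bar> \<le> ?w" .
qed

lemma modulus_small:
  assumes "modulus_of_continuity \<omega>" "\<epsilon> > 0"
  obtains r where "r > 0" "\<And>t. 0 \<le> t \<Longrightarrow> t \<le> r \<Longrightarrow> \<omega> t \<le> \<epsilon>"
proof -
  have "(\<omega> \<longlongrightarrow> 0) (at_right 0)" "\<omega> 0 = 0" using assms(1) by (auto simp: modulus_of_continuity_def)
  from order_tendstoD(2)[OF this(1) assms(2)] obtain b where b: "b > 0" "\<And>t. 0 < t \<Longrightarrow> t < b \<Longrightarrow> \<omega> t < \<epsilon>"
    by (auto simp: eventually_at_right_field)
  show ?thesis
  proof (rule that[of "b / 2"])
    fix t assume "0 \<le> t" "t \<le> b / 2"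
    thus "\<omega> t \<le> \<epsilon>" using b(1) b(2)[of t] \<open>\<omega> 0 = 0\<close> assms(2) by (cases "t = 0") auto
  qed (use b in simp)
qed

text \<open>Dividing by \<open>K\<close> reduces to factors bounded by one, for which the difference of two products is at most
  the sum of the differences.\<close>

lemma abs_prod_diff_le:
  fixes a b :: "'i \<Rightarrow> real"
  assumes K: "K > 0" and ab: "\<And>i. i \<in> I \<Longrightarrow> \<bar>a i\<bar> \<le> K" "\<And>i. i \<in> I \<Longrightarrow> \<bar>b i\<bar> \<le> K"
    and d: "\<And>i. i \<in> I \<Longrightarrow> \<bar>a i - b i\<bar> \<le> \<eta>"
  shows "\<bar>prod a I - prod b I\<bar> \<le> K ^ card I * (real (card I) * (\<eta> / K))"
proof -
  have "norm ((\<Prod>i\<in>I. a i / K) - (\<Prod>i\<in>I. b i / K)) \<le> (\<Sum>i\<in>I. norm (a i / K - b i / K))"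
    by (rule norm_prod_diff) (use K ab in auto)
  also have "\<dots> \<le> (\<Sum>i\<in>I. \<eta> / K)"
    by (rule sum_mono) (use K d in \<open>simp add: divide_right_mono flip: diff_divide_distrib\<close>)
  finally have "\<bar>(prod a I - prod b I) / K ^ card I\<bar> \<le> real (card I) * (\<eta> / K)"
    by (simp add: prod_dividef diff_divide_distrib)
  thus ?thesis using K by (simp add: abs_divide field_simps)
qed

locale eqb_setting =
  fixes V :: "'v set" and X :: "'v \<Rightarrow> 'x metric" and \<mu> :: "'v \<Rightarrow> 'x measure"
    and K :: real and \<omega> :: "real \<Rightarrow> real"
  assumes fin: "finite V" and pol: "\<forall>v\<in>V. polish_state_space (X v)" and K: "K > 0"
    and mod: "modulus_of_continuity \<omega>" and lf: "\<forall>v\<in>V. locally_finite_on (X v) (\<mu> v)"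
begin

text \<open>Extended by a trivial measure outside \<open>V\<close>, as products of \<open>\<sigma>\<close>-finite measures are set up for
  families indexed by the whole type.\<close>

definition ref :: "'v \<Rightarrow> 'x measure" where
  "ref v = (if v \<in> V then \<mu> v else count_space {})"

lemma sets_ref: "v \<in> V \<Longrightarrow> sets (ref v) = sets (borel_metric (X v))"
  using lf by (simp add: ref_def locally_finite_on_def)

lemma space_ref: "v \<in> V \<Longrightarrow> space (ref v) = mspace (X v)"
  using sets_eq_imp_space_eq[OF sets_ref] by (simp add: space_borel_metric)

lemma ex_cover_ref: "v \<in> V \<Longrightarrow> \<exists>\<C>. fine_cover (ref v) (mdist (X v)) \<C>"
  using ex_fine_cover_polish[of "X v" "\<mu> v"] pol lf by (simp add: ref_def)

lemma product_sigma_finite_ref: "product_sigma_finite ref"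
proof (rule product_sigma_finite.intro)
  fix v show "sigma_finite_measure (ref v)"
  proof (cases "v \<in> V")
    case True
    thus ?thesis using ex_cover_ref fine_cover_sigma_finite by blast
  next
    case False
    thus ?thesis by (simp add: ref_def sigma_finite_measure_count_space_finite)
  qed
qed

lemma sets_PiM_ref: "A \<subseteq> V \<Longrightarrow> sets (Pi\<^sub>M A ref) = sets (prod_space X A)"
  unfolding prod_space_def by (rule sets_PiM_cong) (use sets_ref in auto)

lemma space_PiM_ref: "A \<subseteq> V \<Longrightarrow> space (Pi\<^sub>M A ref) = space (prod_space X A)"
  by (rule sets_eq_imp_space_eq) (rule sets_PiM_ref)

lemma ex_cover_product: "A \<subseteq> V \<Longrightarrow> \<exists>\<C>. fine_cover (Pi\<^sub>M A ref) (prod_dist_on X A) \<C>"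
  by (rule ex_fine_cover_product[OF _ product_sigma_finite_ref])
    (use fin space_ref ex_cover_ref in \<open>auto intro: finite_subset\<close>)

lemma space_prod_space_nonempty: "A \<subseteq> V \<Longrightarrow> space (prod_space X A) \<noteq> {}"
  using pol by (auto simp: space_prod_space PiE_eq_empty_iff polish_state_space_def)

lemma equicontinuous_eqb_density:
  "equicontinuous_on S (prod_dist_on X A) {p. eqb_density X K \<omega> A p}"
  if "S = space (prod_space X A)"
  unfolding equicontinuous_on_def
proof (intro allI impI)
  fix \<epsilon> :: real assume "\<epsilon> > 0"
  from modulus_small[OF mod this] obtain r where r: "r > 0" "\<And>t. 0 \<le> t \<Longrightarrow> t \<le> r \<Longrightarrow> \<omega> t \<le> \<epsilon>" by metis
  have "\<bar>p x - p y\<bar> \<le> \<epsilon>" if p: "eqb_density X K \<omega> A p" and xy: "x \<in> S" "y \<in> S" "prod_dist_on X A x y \<le> r" for p x y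
  proof -
    have "\<bar>p x - p y\<bar> \<le> \<omega> (prod_dist_on X A x y)" using p xy \<open>S = _\<close> by (auto simp: eqb_density_def)
    also have "\<dots> \<le> \<epsilon>" by (rule r(2)) (use xy in \<open>auto simp: prod_dist_on_def\<close>)
    finally show ?thesis .
  qed
  thus "\<exists>r>0. \<forall>f\<in>{p. eqb_density X K \<omega> A p}. \<forall>x\<in>S. \<forall>y\<in>S. prod_dist_on X A x y \<le> r \<longrightarrow> \<bar>f x - f y\<bar> \<le> \<epsilon>"
    using r(1) by blast
qed

lemma eqb_density_measurable:
  assumes "A \<subseteq> V" "eqb_density X K \<omega> A p"
  shows "p \<in> borel_measurable (prod_space X A)"
proof -
  obtain \<C> where C: "fine_cover (Pi\<^sub>M A ref) (prod_dist_on X A) \<C>" using ex_cover_product[OF assms(1)] by blast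
  have "p \<in> borel_measurable (Pi\<^sub>M A ref)"
    by (rule equicontinuous_on_measurable[OF C equicontinuous_eqb_density])
      (use assms space_PiM_ref in auto)
  thus ?thesis unfolding measurable_cong_sets[OF sets_PiM_ref[OF assms(1)] refl] .
qed

definition kernel_density :: "('v \<times> 'v) set \<Rightarrow> ('v, 'x) kernels \<Rightarrow> 'v \<Rightarrow> (('v \<Rightarrow> 'x) \<Rightarrow> real) \<Rightarrow> bool" where
  "kernel_density E m v p \<longleftrightarrow> eqb_density X K \<omega> (insert v (parents E v)) p \<and>
     (\<forall>x\<in>space (prod_space X (parents E v)). m v x = density (\<mu> v) (\<lambda>y. ennreal (p (x(v := y)))))"

lemma bayes_nets_eqb_iff:
  "m \<in> bayes_nets_eqb X V \<mu> K \<omega> E \<longleftrightarrow> m \<in> bayes_nets X V E \<and> (\<forall>v\<in>V. \<exists>p. kernel_density E m v p)"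
  unfolding bayes_nets_eqb_def kernel_density_def eqb_density_def by (simp add: conj_assoc)

lemma kernels_on_bayes_nets: "m \<in> bayes_nets X V E \<Longrightarrow> kernels_on X E V m"
  by (auto simp: bayes_nets_def kernels_on_def)

definition joint :: "('v \<times> 'v) set \<Rightarrow> ('v \<Rightarrow> ('v \<Rightarrow> 'x) \<Rightarrow> real) \<Rightarrow> ('v \<Rightarrow> 'x) \<Rightarrow> real" where
  "joint E p x = (\<Prod>v\<in>V. p v (restrict x (insert v (parents E v))))"

definition joints :: "(('v \<Rightarrow> 'x) \<Rightarrow> real) set" where
  "joints = {joint E p |E p. dag V E \<and> (\<forall>v\<in>V. eqb_density X K \<omega> (insert v (parents E v)) (p v))}"

lemma dag_parents: "dag V E \<Longrightarrow> v \<in> V \<Longrightarrow> insert v (parents E v) \<subseteq> V"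
  by (auto simp: dag_def parents_def)

lemma restrict_in_space: "A \<subseteq> V \<Longrightarrow> x \<in> space (prod_space X V) \<Longrightarrow> restrict x A \<in> space (prod_space X A)"
  by (auto simp: space_prod_space)

lemma joint_nonneg:
  assumes "dag V E" "\<forall>v\<in>V. eqb_density X K \<omega> (insert v (parents E v)) (p v)" "x \<in> space (prod_space X V)"
  shows "0 \<le> joint E p x"
  unfolding joint_def
proof (rule prod_nonneg)
  fix v assume "v \<in> V"
  thus "0 \<le> p v (restrict x (insert v (parents E v)))"
    using assms restrict_in_space[OF dag_parents[OF assms(1)] assms(3)] by (auto simp: eqb_density_def)
qed

lemma equicontinuous_joints: "equicontinuous_on (space (prod_space X V)) (prod_dist_on X V) joints"
  unfolding equicontinuous_on_def
proof (intro allI impI)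
  fix \<epsilon> :: real assume \<epsilon>: "\<epsilon> > 0"
  define \<eta> where "\<eta> = \<epsilon> * K / (K ^ card V * real (Suc (card V)))"
  have \<eta>: "\<eta> > 0" using \<epsilon> K by (simp add: \<eta>_def)
  from modulus_small[OF mod this] obtain r where r: "r > 0" "\<And>t. 0 \<le> t \<Longrightarrow> t \<le> r \<Longrightarrow> \<omega> t \<le> \<eta>" by metis
  have "\<bar>joint E p x - joint E p y\<bar> \<le> \<epsilon>"
    if E: "dag V E" and p: "\<forall>v\<in>V. eqb_density X K \<omega> (insert v (parents E v)) (p v)"
      and xy: "x \<in> space (prod_space X V)" "y \<in> space (prod_space X V)" "prod_dist_on X V x y \<le> r" for E p x y
  proof -
    have "\<bar>joint E p x - joint E p y\<bar> \<le> K ^ card V * (real (card V) * (\<eta> / K))"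
      unfolding joint_def
    proof (rule abs_prod_diff_le[OF K])
      fix v assume v: "v \<in> V"
      let ?B = "insert v (parents E v)"
      have B: "?B \<subseteq> V" by (rule dag_parents[OF E v])
      have x: "restrict x ?B \<in> space (prod_space X ?B)" and y: "restrict y ?B \<in> space (prod_space X ?B)"
        using restrict_in_space[OF B] xy by auto
      have pv: "eqb_density X K \<omega> ?B (p v)" using p v by blast
      show "\<bar>p v (restrict x ?B)\<bar> \<le> K" using pv x by (simp add: eqb_density_def)
      show "\<bar>p v (restrict y ?B)\<bar> \<le> K" using pv y by (simp add: eqb_density_def)
      have "prod_dist_on X ?B (restrict x ?B) (restrict y ?B) = L2_set (\<lambda>v. mdist (X v) (x v) (y v)) ?B"
        unfolding prod_dist_on_def by (rule L2_set_cong) auto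
      also have "\<dots> \<le> prod_dist_on X V x y"
        unfolding prod_dist_on_def L2_set_def by (intro real_sqrt_le_mono sum_mono2 fin B) auto
      finally have "prod_dist_on X ?B (restrict x ?B) (restrict y ?B) \<le> r" using xy(3) by simp
      moreover have "0 \<le> prod_dist_on X ?B (restrict x ?B) (restrict y ?B)" by (simp add: prod_dist_on_def)
      ultimately have "\<omega> (prod_dist_on X ?B (restrict x ?B) (restrict y ?B)) \<le> \<eta>" by (intro r(2))
      moreover have "\<bar>p v (restrict x ?B) - p v (restrict y ?B)\<bar> \<le> \<omega> (prod_dist_on X ?B (restrict x ?B) (restrict y ?B))"
        using pv x y unfolding eqb_density_def by blast
      ultimately show "\<bar>p v (restrict x ?B) - p v (restrict y ?B)\<bar> \<le> \<eta>" by linarith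
    qed
    also have "\<dots> = \<epsilon> * (real (card V) / real (Suc (card V)))" using K by (simp add: \<eta>_def)
    also have "\<dots> \<le> \<epsilon>" by (rule mult_left_le) (use \<epsilon> in auto)
    finally show ?thesis .
  qed
  thus "\<exists>r>0. \<forall>f\<in>joints. \<forall>x\<in>space (prod_space X V). \<forall>y\<in>space (prod_space X V).
      prod_dist_on X V x y \<le> r \<longrightarrow> \<bar>f x - f y\<bar> \<le> \<epsilon>"
    using r(1) unfolding joints_def by blast
qed

lemma obs_dist_prob:
  assumes "dag V E" "m \<in> bayes_nets X V E"
  shows "obs_dist X V E m \<in> space (prob_algebra (prod_space X V))"
proof -
  obtain vs where vs: "set vs = V" "parents_later E vs" "\<And>m. obs_dist X V E m = kernel_product X E m vs"
    using obs_dist_order[OF fin assms(1), of X] by blast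
  show ?thesis unfolding vs(3)
    using kernel_product_in_prob_algebra[OF vs(2), of X m] kernels_on_bayes_nets[OF assms(2)] vs(1) by simp
qed

lemma obs_dist_markov:
  assumes "dag V E" "m \<in> bayes_nets X V E"
  shows "obs_dist X V E m \<in> markov_measures X V E"
proof -
  obtain vs where vs: "set vs = V" "parents_later E vs" "\<And>m. obs_dist X V E m = kernel_product X E m vs"
    using obs_dist_order[OF fin assms(1), of X] by blast
  have "E \<subseteq> V \<times> V" using assms(1) by (simp add: dag_def)
  hence "cond_indep X (kernel_product X E m vs) A B C"
    if "d_sep E A B C" "A \<subseteq> V" "B \<subseteq> V" "C \<subseteq> V" for A B C
    using kernel_product_markov[OF vs(2), of X m A B C] kernels_on_bayes_nets[OF assms(2)] that vs(1) by simp
  thus ?thesis using obs_dist_prob[OF assms] unfolding markov_measures_def vs(3) by blast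
qed

lemma faithful_net_iff:
  assumes "dag V E" "m \<in> bayes_nets X V E"
  shows "faithful_net X V E m \<longleftrightarrow> (\<forall>A B C. A \<subseteq> V \<longrightarrow> B \<subseteq> V \<longrightarrow> C \<subseteq> V \<longrightarrow> \<not> d_sep E A B C \<longrightarrow>
     \<not> cond_indep X (obs_dist X V E m) A B C)"
  using obs_dist_markov[OF assms] unfolding faithful_net_def faithful_measures_def by blast

lemma obs_dist_density:
  assumes E: "dag V E" and m: "m \<in> bayes_nets X V E" and p: "\<And>v. v \<in> V \<Longrightarrow> kernel_density E m v (p v)"
  shows "obs_dist X V E m = density (Pi\<^sub>M V ref) (\<lambda>x. ennreal (joint E p x))"
    and "joint E p \<in> joints" and "\<And>x. x \<in> space (prod_space X V) \<Longrightarrow> 0 \<le> joint E p x"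
proof -
  obtain vs where vs: "set vs = V" "parents_later E vs" "\<And>m. obs_dist X V E m = kernel_product X E m vs"
    using obs_dist_order[OF fin E, of X] by blast
  have p': "\<forall>v\<in>V. eqb_density X K \<omega> (insert v (parents E v)) (p v)"
    using p by (auto simp: kernel_density_def)
  show "joint E p \<in> joints" using E p' by (auto simp: joints_def)
  show nn: "0 \<le> joint E p x" if "x \<in> space (prod_space X V)" for x by (rule joint_nonneg[OF E p' that])
  have jm: "joint E p \<in> borel_measurable (Pi\<^sub>M V ref)"
  proof -
    obtain \<C> where C: "fine_cover (Pi\<^sub>M V ref) (prod_dist_on X V) \<C>" using ex_cover_product[OF order_refl] by blast
    show ?thesis
      by (rule equicontinuous_on_measurable[OF C, of joints])
        (use equicontinuous_joints space_PiM_ref[OF order_refl] \<open>joint E p \<in> joints\<close> in auto)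
  qed
  have "kernel_product X E m vs = density (Pi\<^sub>M (set vs) ref)
      (\<lambda>x. \<Prod>v\<in>set vs. ennreal (p v (restrict x (insert v (parents E v)))))"
  proof (rule kernel_product_density[OF product_sigma_finite_ref vs(2)])
    show "kernels_on X E (set vs) m" using kernels_on_bayes_nets[OF m] vs(1) by simp
    show "sets (ref v) = sets (borel_metric (X v))" if "v \<in> set vs" for v using sets_ref that vs(1) by simp
    show "p v \<in> borel_measurable (prod_space X (insert v (parents E v)))" if "v \<in> set vs" for v
      by (rule eqb_density_measurable[OF dag_parents[OF E]]) (use that vs(1) p' in auto)
    show "m v x = density (ref v) (\<lambda>y. ennreal (p v (x(v := y))))"
      if "v \<in> set vs" "x \<in> space (prod_space X (parents E v))" for v x
      using p[of v] that vs(1) by (simp add: kernel_density_def ref_def)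
  qed
  also have "\<dots> = density (Pi\<^sub>M V ref) (\<lambda>x. ennreal (joint E p x))"
  proof -
    have e: "(\<Prod>v\<in>V. ennreal (p v (restrict x (insert v (parents E v))))) = ennreal (joint E p x)"
      if x: "x \<in> space (Pi\<^sub>M V ref)" for x
      unfolding joint_def
    proof (rule prod_ennreal)
      fix v assume v: "v \<in> V"
      have "x \<in> space (prod_space X V)" using x space_PiM_ref[OF order_refl] by simp
      from restrict_in_space[OF dag_parents[OF E v] this]
      show "0 \<le> p v (restrict x (insert v (parents E v)))" using p' v by (simp add: eqb_density_def)
    qed
    have "(\<lambda>x. \<Prod>v\<in>V. ennreal (p v (restrict x (insert v (parents E v))))) \<in> borel_measurable (Pi\<^sub>M V ref)"
      by (subst measurable_cong[OF e]) (use jm in auto)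
    thus ?thesis unfolding vs(1) by (intro density_cong) (use jm e in auto)
  qed
  finally show "obs_dist X V E m = density (Pi\<^sub>M V ref) (\<lambda>x. ennreal (joint E p x))" unfolding vs(3) .
qed

end

context eqb_setting
begin

section \<open>Continuity and mixtures of observational distributions\<close>

lemma bayes_nets_kernel_space:
  assumes "m \<in> bayes_nets X V E" "v \<in> V" "x \<in> space (prod_space X (parents E v))"
  shows "m v x \<in> space (prob_algebra (borel_metric (X v)))"
proof -
  have "m v \<in> prod_space X (parents E v) \<rightarrow>\<^sub>M prob_algebra (borel_metric (X v))"
    using assms(1,2) unfolding bayes_nets_def by blast
  from measurable_space[OF this assms(3)] show ?thesis .
qed

lemma obs_dist_tv:
  assumes E: "dag V E" and m: "m \<in> bayes_nets X V E" "m' \<in> bayes_nets X V E"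
    and e: "\<And>v x S. v \<in> V \<Longrightarrow> x \<in> space (prod_space X (parents E v)) \<Longrightarrow> S \<in> sets (borel_metric (X v)) \<Longrightarrow>
      \<bar>measure (m v x) S - measure (m' v x) S\<bar> \<le> e v"
    and W: "W \<in> sets (prod_space X V)"
  shows "\<bar>measure (obs_dist X V E m) W - measure (obs_dist X V E m') W\<bar> \<le> (\<Sum>v\<in>V. e v)"
proof -
  obtain vs where vs: "set vs = V" "parents_later E vs" "\<And>m. obs_dist X V E m = kernel_product X E m vs"
    using obs_dist_order[OF fin E, of X] by blast
  show ?thesis
    using kernel_product_tv[OF vs(2), of X m m' e W] kernels_on_bayes_nets[OF m(1)] kernels_on_bayes_nets[OF m(2)] e W
    unfolding vs(1,3) by simp
qed

lemma tv_dist_leI: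
  assumes "\<And>S. S \<in> sets P \<Longrightarrow> \<bar>measure P S - measure Q S\<bar> \<le> c"
  shows "tv_dist P Q \<le> c"
  unfolding tv_dist_def by (rule cSUP_least) (use assms in auto)

lemma tv_circ_le:
  assumes E: "dag V E" and m: "m \<in> bayes_nets X V E" "m' \<in> bayes_nets X V E"
    and e: "\<And>v x S. v \<in> V \<Longrightarrow> x \<in> space (prod_space X (parents E v)) \<Longrightarrow> S \<in> sets (borel_metric (X v)) \<Longrightarrow>
      \<bar>measure (m v x) S - measure (m' v x) S\<bar> \<le> c"
  shows "tv_circ X V (E, m) (E, m') \<le> real (card V) * c"
proof -
  have "(SUP x\<in>space (prod_space X V). tv_dist (m v (restrict x (parents E v))) (m' v (restrict x (parents E v)))) \<le> c"
    if v: "v \<in> V" for v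
  proof (rule cSUP_least)
    show "space (prod_space X V) \<noteq> {}" by (rule space_prod_space_nonempty) simp
    fix x assume x: "x \<in> space (prod_space X V)"
    have pa: "parents E v \<subseteq> V" using dag_parents[OF E v] by simp
    have xp: "restrict x (parents E v) \<in> space (prod_space X (parents E v))" by (rule restrict_in_space[OF pa x])
    have "sets (m v (restrict x (parents E v))) = sets (borel_metric (X v))"
      using bayes_nets_kernel_space[OF m(1) v xp] by (simp add: space_prob_algebra)
    thus "tv_dist (m v (restrict x (parents E v))) (m' v (restrict x (parents E v))) \<le> c"
      by (intro tv_dist_leI e[OF v xp]) simp
  qed
  thus ?thesis unfolding tv_circ_def by (auto intro: sum_bounded_above)
qed

lemma obs_dist_tv_circ:
  assumes E: "dag V E" and m: "m \<in> bayes_nets X V E" "m' \<in> bayes_nets X V E"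
    and W: "W \<in> sets (prod_space X V)"
  shows "\<bar>measure (obs_dist X V E m) W - measure (obs_dist X V E m') W\<bar> \<le> tv_circ X V (E, m) (E, m')"
proof -
  define e where "e v = (SUP x\<in>space (prod_space X V).
    tv_dist (m v (restrict x (parents E v))) (m' v (restrict x (parents E v))))" for v
  have "\<bar>measure (m v x) S - measure (m' v x) S\<bar> \<le> e v"
    if v: "v \<in> V" and x: "x \<in> space (prod_space X (parents E v))" and S: "S \<in> sets (borel_metric (X v))" for v x S
  proof -
    have pa: "parents E v \<subseteq> V" using dag_parents[OF E v] by simp
    obtain z where z: "z \<in> space (prod_space X V)" using space_prod_space_nonempty[OF order_refl] by blast
    define y where "y = (\<lambda>u. if u \<in> parents E v then x u else z u)"
    have y: "y \<in> space (prod_space X V)"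
      using x z pa by (auto simp: y_def space_prod_space PiE_def Pi_def extensional_def)
    have r: "restrict y (parents E v) = x"
      using x by (auto simp: y_def space_prod_space PiE_def extensional_def fun_eq_iff)
    have pr: "prob_space (n v (restrict w (parents E v)))" "sets (n v (restrict w (parents E v))) = sets (borel_metric (X v))"
      if "n \<in> bayes_nets X V E" "w \<in> space (prod_space X V)" for n w
      using bayes_nets_kernel_space[OF that(1) v restrict_in_space[OF pa that(2)]] by (auto simp: space_prob_algebra)
    have "\<bar>measure (m v x) S - measure (m' v x) S\<bar> \<le> tv_dist (m v x) (m' v x)"
      unfolding tv_dist_def
      by (rule cSUP_upper[OF _ tv_dist_bdd(1)]) (use pr[OF m(1) y] pr[OF m(2) y] S in \<open>auto simp: r\<close>)
    also have "\<dots> \<le> e v"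
    proof -
      have "bdd_above ((\<lambda>x. tv_dist (m v (restrict x (parents E v))) (m' v (restrict x (parents E v)))) ` space (prod_space X V))"
        by (rule bdd_aboveI2[of _ _ 1], rule tv_dist_bounds(1)) (use pr m in auto)
      from cSUP_upper[OF y this] show ?thesis by (simp add: e_def r)
    qed
    finally show ?thesis .
  qed
  from obs_dist_tv[OF E m this W] show ?thesis unfolding tv_circ_def e_def case_prod_conv .
qed

text \<open>The contrapositive of closedness in total variation.\<close>

lemma not_cond_indep_open:
  assumes P: "P \<in> space (prob_algebra (prod_space X V))" and ABC: "A \<subseteq> V" "B \<subseteq> V" "C \<subseteq> V"
    and nci: "\<not> cond_indep X P A B C"
  shows "\<exists>\<epsilon>>0. \<forall>Q\<in>space (prob_algebra (prod_space X V)).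
    (\<forall>S\<in>sets (prod_space X V). \<bar>measure P S - measure Q S\<bar> \<le> \<epsilon>) \<longrightarrow> \<not> cond_indep X Q A B C"
proof (rule ccontr)
  assume neg: "\<not> ?thesis"
  have sP: "sets P = sets (prod_space X V)" "prob_space P" using P by (auto simp: space_prob_algebra)
  have "indep_given P (coord_algebra X V A) (coord_algebra X V B) (coord_algebra X V C)"
  proof (rule indep_given_tv_closed[OF sP(2)])
    fix \<epsilon> :: real assume "\<epsilon> > 0"
    then obtain Q where Q: "Q \<in> space (prob_algebra (prod_space X V))" "cond_indep X Q A B C"
      "\<forall>S\<in>sets (prod_space X V). \<bar>measure P S - measure Q S\<bar> \<le> \<epsilon>" using neg by blast
    have sQ: "sets Q = sets (prod_space X V)" "prob_space Q" using Q by (auto simp: space_prob_algebra)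
    show "\<exists>Q. prob_space Q \<and> sets Q = sets P \<and>
       indep_given Q (coord_algebra X V A) (coord_algebra X V B) (coord_algebra X V C) \<and>
       (\<forall>S\<in>sets P. \<bar>measure P S - measure Q S\<bar> \<le> \<epsilon>)"
      using Q sQ sP cond_indep_iff_indep_given[OF sQ(1) ABC(1,2), of C] by auto
  qed (intro subalgebra_coord_algebra ABC sP)+
  thus False using nci cond_indep_iff_indep_given[OF sP(1) ABC(1,2)] by blast
qed

lemma joint_update_mixture:
  assumes v: "v \<in> V"
  shows "joint E (p(v := \<lambda>x. (1 - t) * p v x + t * q x)) x = (1 - t) * joint E p x + t * joint E (p(v := q)) x"
proof -
  define R where "R = (\<Prod>u\<in>V - {v}. p u (restrict x (insert u (parents E u))))"
  have "joint E (p(v := g)) x = g (restrict x (insert v (parents E v))) * R" for g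
  proof -
    have "joint E (p(v := g)) x = g (restrict x (insert v (parents E v))) *
        (\<Prod>u\<in>V - {v}. (p(v := g)) u (restrict x (insert u (parents E u))))"
      unfolding joint_def by (subst prod.remove[OF fin v]) simp
    also have "(\<Prod>u\<in>V - {v}. (p(v := g)) u (restrict x (insert u (parents E u)))) = R"
      unfolding R_def by (rule prod.cong) auto
    finally show ?thesis .
  qed
  from this[of q] this[of "\<lambda>x. (1 - t) * p v x + t * q x"] this[of "p v"]
  show ?thesis by (simp add: algebra_simps)
qed

text \<open>The kernels at one vertex are interpolated linearly. Boundedness and the modulus of continuity
  survive because the constants are fixed, and the joint density, being linear in each factor, is
  interpolated linearly as well.\<close>

lemma ex_interpolation_at_vertex:
  assumes E: "dag V E" and m: "m \<in> bayes_nets_eqb X V \<mu> K \<omega> E" and k: "k \<in> bayes_nets_eqb X V \<mu> K \<omega> E" and v: "v \<in> V"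
  shows "\<exists>n :: real \<Rightarrow> ('v, 'x) kernels. n 0 = m \<and> n 1 = m(v := k v) \<and> (\<forall>t u. u \<noteq> v \<longrightarrow> n t u = m u) \<and>
    (\<forall>t\<in>{0..1}. n t \<in> bayes_nets_eqb X V \<mu> K \<omega> E \<and>
      (\<forall>x\<in>space (prod_space X (parents E v)). \<forall>S\<in>sets (borel_metric (X v)).
         \<bar>measure (n t v x) S - measure (m v x) S\<bar> \<le> t) \<and>
      (\<forall>S\<in>sets (prod_space X V). measure (obs_dist X V E (n t)) S =
         (1 - t) * measure (obs_dist X V E (n 0)) S + t * measure (obs_dist X V E (n 1)) S))"
proof -
  let ?pa = "parents E v"
  have mb: "m \<in> bayes_nets X V E" and kb: "k \<in> bayes_nets X V E" using m k by (auto simp: bayes_nets_eqb_iff)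
  obtain p where p: "\<And>u. u \<in> V \<Longrightarrow> kernel_density E m u (p u)" using m unfolding bayes_nets_eqb_iff by metis
  obtain q where q: "kernel_density E k v q" using k v unfolding bayes_nets_eqb_iff by blast
  define n where "n t = m(v := (\<lambda>x\<in>space (prod_space X ?pa).
      density (\<mu> v) (\<lambda>y. ennreal ((1 - t) * p v (x(v := y)) + t * q (x(v := y))))))" for t
  have pq: "eqb_density X K \<omega> (insert v ?pa) (p v)" "eqb_density X K \<omega> (insert v ?pa) q"
    using p[OF v] q by (auto simp: kernel_density_def)
  have s\<mu>: "sets (\<mu> v) = sets (borel_metric (X v))" using lf v by (simp add: locally_finite_on_def)
  have sp\<mu>: "space (\<mu> v) = mspace (X v)" using sets_eq_imp_space_eq[OF s\<mu>] by (simp add: space_borel_metric)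
  have mx: "m v x = density (\<mu> v) (\<lambda>y. ennreal (p v (x(v := y))))"
    and kx: "k v x = density (\<mu> v) (\<lambda>y. ennreal (q (x(v := y))))" if "x \<in> space (prod_space X ?pa)" for x
    using p[OF v] q that by (auto simp: kernel_density_def)
  have ext: "m \<in> extensional V" "m v \<in> extensional (space (prod_space X ?pa))" "k v \<in> extensional (space (prod_space X ?pa))"
    using mb kb v by (auto simp: bayes_nets_def)
  have n0: "n 0 = m"
  proof -
    have "(\<lambda>x\<in>space (prod_space X ?pa). density (\<mu> v) (\<lambda>y. ennreal ((1 - 0) * p v (x(v := y)) + 0 * q (x(v := y))))) = m v"
      by (rule extensionalityI[of _ "space (prod_space X ?pa)"]) (use ext mx in auto)
    thus ?thesis unfolding n_def by simp
  qed
  have n1: "n 1 = m(v := k v)"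
  proof -
    have "(\<lambda>x\<in>space (prod_space X ?pa). density (\<mu> v) (\<lambda>y. ennreal ((1 - 1) * p v (x(v := y)) + 1 * q (x(v := y))))) = k v"
      by (rule extensionalityI[of _ "space (prod_space X ?pa)"]) (use ext kx in auto)
    thus ?thesis unfolding n_def by simp
  qed
  have mk: "prob_space (m v x)" "prob_space (k v x)" if "x \<in> space (prod_space X ?pa)" for x
    using bayes_nets_kernel_space[OF mb v that] bayes_nets_kernel_space[OF kb v that] by (auto simp: space_prob_algebra)
  have em: "emeasure (n t v x) S = ennreal (1 - t) * emeasure (m v x) S + ennreal t * emeasure (k v x) S"
    if t: "t \<in> {0..1}" and x: "x \<in> space (prod_space X ?pa)" and S: "S \<in> sets (borel_metric (X v))" for t x S
  proof -
    have meas: "(\<lambda>y. r (x(v := y))) \<in> borel_measurable (\<mu> v)" if "eqb_density X K \<omega> (insert v ?pa) r" for r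
      unfolding measurable_cong_sets[OF s\<mu> refl]
      by (rule measurable_compose[OF fun_upd_measurable_prod_space[OF x] eqb_density_measurable[OF dag_parents[OF E v] that]])
    have pos: "0 \<le> r (x(v := y))" if "eqb_density X K \<omega> (insert v ?pa) r" "y \<in> space (\<mu> v)" for r y
      using that space_insert_fun_upd[OF x] sp\<mu> by (auto simp: eqb_density_def)
    have "n t v x = density (\<mu> v) (\<lambda>y. ennreal ((1 - t) * p v (x(v := y)) + t * q (x(v := y))))"
      using x by (simp add: n_def)
    thus ?thesis unfolding mx[OF x] kx[OF x]
      using emeasure_density_mixture[OF t meas[OF pq(1)] pos[OF pq(1)] meas[OF pq(2)] pos[OF pq(2)], of S] S s\<mu> by simp
  qed
  have nx: "n t v x = density (\<mu> v) (\<lambda>y. ennreal ((1 - t) * p v (x(v := y)) + t * q (x(v := y))))"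
    if "x \<in> space (prod_space X ?pa)" for t x
    using that by (simp add: n_def)
  have np: "prob_space (n t v x)" if t: "t \<in> {0..1}" and x: "x \<in> space (prod_space X ?pa)" for t x
  proof -
    have top: "mspace (X v) \<in> sets (borel_metric (X v))" using sets.top[of "borel_metric (X v)"] by (simp add: space_borel_metric)
    have one: "emeasure (m v x) (mspace (X v)) = 1" "emeasure (k v x) (mspace (X v)) = 1"
      using prob_space.emeasure_space_1[OF mk(1)[OF x]] prob_space.emeasure_space_1[OF mk(2)[OF x]]
      unfolding mx[OF x] kx[OF x] by (simp_all add: sp\<mu>)
    have "emeasure (n t v x) (mspace (X v)) = ennreal (1 - t) + ennreal t"
      using em[OF t x top] one by simp
    also have "\<dots> = ennreal 1" using t by (subst ennreal_plus[symmetric]) auto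
    finally show ?thesis by (intro prob_spaceI) (simp add: nx[OF x] sp\<mu>)
  qed
  have nb: "n t \<in> bayes_nets X V E" if t: "t \<in> {0..1}" for t
  proof -
    have "n t v \<in> prod_space X ?pa \<rightarrow>\<^sub>M prob_algebra (borel_metric (X v))"
    proof (rule measurable_prob_algebraI)
      show "prob_space (n t v x)" if "x \<in> space (prod_space X ?pa)" for x by (rule np[OF t that])
      show "n t v \<in> prod_space X ?pa \<rightarrow>\<^sub>M subprob_algebra (borel_metric (X v))"
      proof (rule measurable_subprob_algebra)
        fix x assume x: "x \<in> space (prod_space X ?pa)"
        show "sets (n t v x) = sets (borel_metric (X v))" unfolding nx[OF x] using s\<mu> by simp
        show "subprob_space (n t v x)" by (rule prob_space_imp_subprob_space[OF np[OF t x]])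
      next
        fix S assume S: "S \<in> sets (borel_metric (X v))"
        have ms: "(\<lambda>x. emeasure (j v x) S) \<in> borel_measurable (prod_space X ?pa)" if "j \<in> bayes_nets X V E" for j
          by (rule measurable_emeasure_kernel[OF measurable_prob_algebraD S]) (use that v in \<open>auto simp: bayes_nets_def\<close>)
        have "(\<lambda>x. ennreal (1 - t) * emeasure (m v x) S + ennreal t * emeasure (k v x) S) \<in> borel_measurable (prod_space X ?pa)"
          using ms[OF mb] ms[OF kb] by measurable
        thus "(\<lambda>x. emeasure (n t v x) S) \<in> borel_measurable (prod_space X ?pa)"
          by (rule measurable_cong[THEN iffD1, rotated]) (use em[OF t _ S] in simp)
      qed
    qed
    moreover have "n t v \<in> extensional (space (prod_space X ?pa))" by (simp add: n_def)
    moreover have "n t \<in> extensional V" using ext(1) v by (auto simp: n_def extensional_def)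
    moreover have "n t u = m u" if "u \<noteq> v" for u using that by (simp add: n_def)
    ultimately show ?thesis using mb unfolding bayes_nets_def by (auto, metis+)
  qed
  let ?r = "\<lambda>t. p(v := \<lambda>x. (1 - t) * p v x + t * q x)"
  have kd: "kernel_density E (n t) u (?r t u)" if t: "t \<in> {0..1}" and u: "u \<in> V" for t u
  proof (cases "u = v")
    case True
    thus ?thesis using eqb_density_mixture[OF pq t] by (auto simp: kernel_density_def n_def)
  next
    case False
    thus ?thesis using p[OF u] by (simp add: kernel_density_def n_def)
  qed
  have kd1: "kernel_density E (n 1) u ((p(v := q)) u)" if "u \<in> V" for u
    using kd[of 1 u] that by (cases "u = v") auto
  have neqb: "n t \<in> bayes_nets_eqb X V \<mu> K \<omega> E" if "t \<in> {0..1}" for t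
    unfolding bayes_nets_eqb_iff using nb[OF that] kd[OF that] by blast
  have near: "\<bar>measure (n t v x) S - measure (m v x) S\<bar> \<le> t"
    if t: "t \<in> {0..1}" and x: "x \<in> space (prod_space X ?pa)" and S: "S \<in> sets (borel_metric (X v))" for t x S
  proof -
    have "measure (n t v x) S = (1 - t) * measure (m v x) S + t * measure (k v x) S"
      by (rule measure_mixture[OF mk(1)[OF x] mk(2)[OF x] t em[OF t x S]])
    hence "measure (n t v x) S - measure (m v x) S = t * (measure (k v x) S - measure (m v x) S)"
      by (simp add: algebra_simps)
    moreover have "\<bar>measure (k v x) S - measure (m v x) S\<bar> \<le> 1"
      by (rule tv_dist_bdd(2)[OF mk(2)[OF x] mk(1)[OF x]])
    ultimately show ?thesis using t by (simp add: abs_mult mult_left_le)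
  qed
  have aff: "measure (obs_dist X V E (n t)) S =
      (1 - t) * measure (obs_dist X V E (n 0)) S + t * measure (obs_dist X V E (n 1)) S"
    if t: "t \<in> {0..1}" and S: "S \<in> sets (prod_space X V)" for t S
  proof -
    have m0: "n 0 \<in> bayes_nets X V E" "n 1 \<in> bayes_nets X V E" using nb by auto
    have p0: "\<And>u. u \<in> V \<Longrightarrow> kernel_density E (n 0) u (p u)" using p n0 by simp
    have d0: "obs_dist X V E (n 0) = density (Pi\<^sub>M V ref) (\<lambda>x. ennreal (joint E p x))"
        "joint E p \<in> joints" "\<And>x. x \<in> space (prod_space X V) \<Longrightarrow> 0 \<le> joint E p x"
      by (rule obs_dist_density[OF E m0(1) p0]; assumption)+
    have d1: "obs_dist X V E (n 1) = density (Pi\<^sub>M V ref) (\<lambda>x. ennreal (joint E (p(v := q)) x))"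
        "joint E (p(v := q)) \<in> joints" "\<And>x. x \<in> space (prod_space X V) \<Longrightarrow> 0 \<le> joint E (p(v := q)) x"
      by (rule obs_dist_density[OF E m0(2) kd1]; assumption)+
    have dt: "obs_dist X V E (n t) = density (Pi\<^sub>M V ref) (\<lambda>x. ennreal (joint E (?r t) x))"
      by (rule obs_dist_density(1)[OF E nb[OF t] kd[OF t]])
    obtain \<C> where C: "fine_cover (Pi\<^sub>M V ref) (prod_dist_on X V) \<C>" using ex_cover_product[OF order_refl] by blast
    have jm: "f \<in> borel_measurable (Pi\<^sub>M V ref)" if "f \<in> joints" for f
      by (rule equicontinuous_on_measurable[OF C _ that])
        (use equicontinuous_joints space_PiM_ref[OF order_refl] in auto)
    have pr: "prob_space (obs_dist X V E (n 0))" "prob_space (obs_dist X V E (n 1))"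
      using obs_dist_prob[OF E m0(1)] obs_dist_prob[OF E m0(2)] by (auto simp: space_prob_algebra)
    show ?thesis
    proof (rule measure_mixture[OF pr t])
      show "emeasure (obs_dist X V E (n t)) S = ennreal (1 - t) * emeasure (obs_dist X V E (n 0)) S
          + ennreal t * emeasure (obs_dist X V E (n 1)) S"
        unfolding d0(1) d1(1) dt joint_update_mixture[OF v]
        by (rule emeasure_density_mixture[OF t jm[OF d0(2)] _ jm[OF d1(2)]])
          (use d0(3) d1(3) S sets_PiM_ref[OF order_refl] space_PiM_ref[OF order_refl] in auto)
    qed
  qed
  have "n t u = m u" if "u \<noteq> v" for t u using that by (simp add: n_def)
  with n0 n1 neqb near aff show ?thesis by (intro exI[of _ n]) blast
qed

end

section \<open>Faithful networks form an open dense set\<close>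

context eqb_setting
begin

lemma finite_triples: "finite (triples V)"
  using fin by (simp add: triples_def)

text \<open>The kernel at \<open>v\<close> moves from that of \<open>m\<close> at parameter 0 to that of the faithful network \<open>k\<close> at
  parameter 1. No independence that is absent at 1 holds for more than finitely many parameters, so small
  parameters that avoid all of them exist.\<close>

lemma faithful_step:
  assumes E: "dag V E" and m: "m \<in> bayes_nets_eqb X V \<mu> K \<omega> E"
    and k: "k \<in> bayes_nets_eqb X V \<mu> K \<omega> E" "faithful_net X V E k"
    and v: "v \<in> V" and \<epsilon>: "\<epsilon> > 0"
  shows "\<exists>k'\<in>bayes_nets_eqb X V \<mu> K \<omega> E. faithful_net X V E k' \<and> (\<forall>u. u \<noteq> v \<longrightarrow> k' u = k u) \<and>
    (\<forall>x\<in>space (prod_space X (parents E v)). \<forall>S\<in>sets (borel_metric (X v)).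
       \<bar>measure (k' v x) S - measure (m v x) S\<bar> \<le> \<epsilon>)"
proof -
  obtain n0 :: "real \<Rightarrow> ('v, 'x) kernels" where n0: "n0 1 = k(v := m v)"
    "n0 1 \<in> bayes_nets_eqb X V \<mu> K \<omega> E"
    using ex_interpolation_at_vertex[OF E k(1) m v] by (metis atLeastAtMost_iff order_refl zero_le_one)
  define b where "b = k(v := m v)"
  have b: "b \<in> bayes_nets_eqb X V \<mu> K \<omega> E" using n0 by (simp add: b_def)
  obtain n :: "real \<Rightarrow> ('v, 'x) kernels" where n: "n 1 = b(v := k v)" "\<And>t u. u \<noteq> v \<Longrightarrow> n t u = b u"
    and nt: "\<And>t. t \<in> {0..1} \<Longrightarrow> n t \<in> bayes_nets_eqb X V \<mu> K \<omega> E"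
      "\<And>t x S. t \<in> {0..1} \<Longrightarrow> x \<in> space (prod_space X (parents E v)) \<Longrightarrow> S \<in> sets (borel_metric (X v)) \<Longrightarrow>
         \<bar>measure (n t v x) S - measure (b v x) S\<bar> \<le> t"
      "\<And>t S. t \<in> {0..1} \<Longrightarrow> S \<in> sets (prod_space X V) \<Longrightarrow> measure (obs_dist X V E (n t)) S =
         (1 - t) * measure (obs_dist X V E (n 0)) S + t * measure (obs_dist X V E (n 1)) S"
    using ex_interpolation_at_vertex[OF E b k(1) v] by metis
  have n1: "n 1 = k" using n(1) by (simp add: b_def)
  have nb: "n t \<in> bayes_nets X V E" if "t \<in> {0..1}" for t using nt(1)[OF that] by (simp add: bayes_nets_eqb_iff)
  let ?D = "\<lambda>t. obs_dist X V E (n t)"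
  have D: "?D t \<in> space (prob_algebra (prod_space X V))" if "t \<in> {0..1}" for t
    by (rule obs_dist_prob[OF E nb[OF that]])
  have sD: "sets (?D t) = sets (prod_space X V)" "prob_space (?D t)" if "t \<in> {0..1}" for t
    using D[OF that] by (auto simp: space_prob_algebra)
  define T where "T = {(A, B, C) \<in> triples V. \<not> d_sep E A B C}"
  have T: "finite T" unfolding T_def by (rule finite_subset[OF _ finite_triples]) auto
  define bad where "bad = (\<lambda>(A, B, C). {t \<in> {0..1}. cond_indep X (?D t) A B C})"
  have "finite (bad \<tau>)" if "\<tau> \<in> T" for \<tau>
  proof -
    obtain A B C where \<tau>: "\<tau> = (A, B, C)" by (cases \<tau>)
    have ABC: "A \<subseteq> V" "B \<subseteq> V" "C \<subseteq> V" "\<not> d_sep E A B C" using that by (auto simp: \<tau> T_def triples_def)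
    have k_b: "k \<in> bayes_nets X V E" using k(1) by (simp add: bayes_nets_eqb_iff)
    have "\<not> cond_indep X (?D 1) A B C"
      using k(2) ABC unfolding n1 faithful_net_iff[OF E k_b] by blast
    hence not1: "\<not> indep_given (?D 1) (coord_algebra X V A) (coord_algebra X V B) (coord_algebra X V C)"
      using cond_indep_iff_indep_given[OF sD(1)[of 1] ABC(1,2)] by simp
    have "finite {t \<in> {0..1}. indep_given (?D t) (coord_algebra X V A) (coord_algebra X V B) (coord_algebra X V C)}"
      by (rule finite_indep_given_mixture[where M = "prod_space X V", OF sD(2,1) nt(3) _ _ _ not1])
        (simp_all add: subalgebra_coord_algebra ABC)
    moreover have "bad \<tau> = {t \<in> {0..1}. indep_given (?D t) (coord_algebra X V A) (coord_algebra X V B) (coord_algebra X V C)}"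
      unfolding bad_def \<tau> using cond_indep_iff_indep_given[OF sD(1) ABC(1,2), of _ C] by auto
    ultimately show ?thesis by simp
  qed
  hence "finite (\<Union>\<tau>\<in>T. bad \<tau>)" using T by blast
  moreover have "infinite {0<..<min 1 \<epsilon>}" using \<epsilon> by (simp add: infinite_Ioo)
  ultimately have "{0<..<min 1 \<epsilon>} - (\<Union>\<tau>\<in>T. bad \<tau>) \<noteq> {}"
    by (metis Diff_infinite_finite finite.emptyI)
  then obtain t where t': "t \<in> {0<..<min 1 \<epsilon>}" "t \<notin> (\<Union>\<tau>\<in>T. bad \<tau>)" by blast
  have t: "0 < t" "t < 1" "t < \<epsilon>" using t'(1) by simp_all
  have t_bad: "t \<notin> bad \<tau>" if "\<tau> \<in> T" for \<tau> using t'(2) that by blast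
  have t01: "t \<in> {0..1}" using t by simp
  have "faithful_net X V E (n t)"
    unfolding faithful_net_iff[OF E nb[OF t01]]
  proof (intro allI impI)
    fix A B C assume "A \<subseteq> V" "B \<subseteq> V" "C \<subseteq> V" "\<not> d_sep E A B C"
    hence "(A, B, C) \<in> T" by (auto simp: T_def triples_def)
    from t_bad[OF this] show "\<not> cond_indep X (?D t) A B C" using t01 by (simp add: bad_def)
  qed
  moreover have "n t u = k u" if "u \<noteq> v" for u using n(2)[OF that] that by (simp add: b_def)
  moreover have "\<bar>measure (n t v x) S - measure (m v x) S\<bar> \<le> \<epsilon>"
    if "x \<in> space (prod_space X (parents E v))" "S \<in> sets (borel_metric (X v))" for x S
    using nt(2)[OF t01 that] t(3) by (simp add: b_def)
  ultimately show ?thesis using nt(1)[OF t01] by blast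
qed

lemma faithful_dense:
  assumes E: "dag V E" and m: "m \<in> bayes_nets_eqb X V \<mu> K \<omega> E"
    and k: "k \<in> bayes_nets_eqb X V \<mu> K \<omega> E" "faithful_net X V E k" and \<epsilon>: "\<epsilon> > 0"
  shows "\<exists>k'\<in>bayes_nets_eqb X V \<mu> K \<omega> E. faithful_net X V E k' \<and> tv_circ X V (E, m) (E, k') \<le> real (card V) * \<epsilon>"
proof -
  have "\<exists>k'\<in>bayes_nets_eqb X V \<mu> K \<omega> E. faithful_net X V E k' \<and>
    (\<forall>v\<in>W. \<forall>x\<in>space (prod_space X (parents E v)). \<forall>S\<in>sets (borel_metric (X v)).
       \<bar>measure (k' v x) S - measure (m v x) S\<bar> \<le> \<epsilon>)" if "W \<subseteq> V" for W
    using finite_subset[OF that fin] that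
  proof (induction W rule: finite_induct)
    case empty thus ?case using k by blast
  next
    case (insert v W)
    then obtain k1 where k1: "k1 \<in> bayes_nets_eqb X V \<mu> K \<omega> E" "faithful_net X V E k1"
      "\<forall>v\<in>W. \<forall>x\<in>space (prod_space X (parents E v)). \<forall>S\<in>sets (borel_metric (X v)).
         \<bar>measure (k1 v x) S - measure (m v x) S\<bar> \<le> \<epsilon>" by blast
    have "v \<in> V" using insert.prems by simp
    from faithful_step[OF E m k1(1,2) this \<epsilon>] obtain k2 where k2: "k2 \<in> bayes_nets_eqb X V \<mu> K \<omega> E"
      "faithful_net X V E k2" "\<forall>u. u \<noteq> v \<longrightarrow> k2 u = k1 u"
      "\<forall>x\<in>space (prod_space X (parents E v)). \<forall>S\<in>sets (borel_metric (X v)).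
         \<bar>measure (k2 v x) S - measure (m v x) S\<bar> \<le> \<epsilon>" by blast
    have "\<forall>u\<in>insert v W. \<forall>x\<in>space (prod_space X (parents E u)). \<forall>S\<in>sets (borel_metric (X u)).
         \<bar>measure (k2 u x) S - measure (m u x) S\<bar> \<le> \<epsilon>"
    proof
      fix u assume u: "u \<in> insert v W"
      show "\<forall>x\<in>space (prod_space X (parents E u)). \<forall>S\<in>sets (borel_metric (X u)).
         \<bar>measure (k2 u x) S - measure (m u x) S\<bar> \<le> \<epsilon>"
      proof (cases "u = v")
        case True thus ?thesis using k2(4) by simp
      next
        case False
        hence "k2 u = k1 u" "u \<in> W" using k2(3) u by auto
        thus ?thesis using k1(3) by simp
      qed
    qed
    thus ?case using k2(1,2) by blast
  qed
  from this[OF order_refl] obtain k' where k': "k' \<in> bayes_nets_eqb X V \<mu> K \<omega> E" "faithful_net X V E k'"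
    "\<And>v x S. v \<in> V \<Longrightarrow> x \<in> space (prod_space X (parents E v)) \<Longrightarrow> S \<in> sets (borel_metric (X v)) \<Longrightarrow>
       \<bar>measure (k' v x) S - measure (m v x) S\<bar> \<le> \<epsilon>" by blast
  have "tv_circ X V (E, m) (E, k') \<le> real (card V) * \<epsilon>"
  proof (rule tv_circ_le[OF E])
    show "m \<in> bayes_nets X V E" "k' \<in> bayes_nets X V E" using m k'(1) by (simp_all add: bayes_nets_eqb_iff)
    fix v x S assume "v \<in> V" "x \<in> space (prod_space X (parents E v))" "S \<in> sets (borel_metric (X v))"
    from k'(3)[OF this] show "\<bar>measure (m v x) S - measure (k' v x) S\<bar> \<le> \<epsilon>" by (simp add: abs_minus_commute)
  qed
  thus ?thesis using k' by blast
qed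

lemma faithful_open:
  assumes E: "dag V E" and m: "m \<in> bayes_nets_eqb X V \<mu> K \<omega> E" "faithful_net X V E m"
  shows "\<exists>\<epsilon>>0. \<forall>k\<in>bayes_nets_eqb X V \<mu> K \<omega> E. tv_circ X V (E, m) (E, k) \<le> \<epsilon> \<longrightarrow> faithful_net X V E k"
proof -
  have mb: "m \<in> bayes_nets X V E" using m by (simp add: bayes_nets_eqb_iff)
  define T where "T = {(A, B, C) \<in> triples V. \<not> d_sep E A B C}"
  have T: "finite T" unfolding T_def by (rule finite_subset[OF _ finite_triples]) auto
  define good where "good \<tau> \<epsilon> \<longleftrightarrow> (case \<tau> of (A, B, C) \<Rightarrow> \<forall>Q\<in>space (prob_algebra (prod_space X V)).
    (\<forall>S\<in>sets (prod_space X V). \<bar>measure (obs_dist X V E m) S - measure Q S\<bar> \<le> \<epsilon>) \<longrightarrow> \<not> cond_indep X Q A B C)"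
    for \<tau> and \<epsilon> :: real
  have "\<exists>\<epsilon>>0. good \<tau> \<epsilon>" if "\<tau> \<in> T" for \<tau>
  proof -
    obtain A B C where \<tau>: "\<tau> = (A, B, C)" by (cases \<tau>)
    have ABC: "A \<subseteq> V" "B \<subseteq> V" "C \<subseteq> V" "\<not> d_sep E A B C" using that by (auto simp: \<tau> T_def triples_def)
    hence "\<not> cond_indep X (obs_dist X V E m) A B C" using m(2) unfolding faithful_net_iff[OF E mb] by blast
    from not_cond_indep_open[OF obs_dist_prob[OF E mb] ABC(1-3) this] show ?thesis
      by (simp add: good_def \<tau>)
  qed
  then obtain e where e: "\<And>\<tau>. \<tau> \<in> T \<Longrightarrow> e \<tau> > 0" "\<And>\<tau>. \<tau> \<in> T \<Longrightarrow> good \<tau> (e \<tau>)" by metis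
  define \<epsilon> where "\<epsilon> = Min (insert 1 (e ` T))"
  have \<epsilon>0: "\<epsilon> > 0" unfolding \<epsilon>_def using T e(1) by (subst Min_gr_iff) auto
  have \<epsilon>e: "\<epsilon> \<le> e \<tau>" if "\<tau> \<in> T" for \<tau> unfolding \<epsilon>_def using T that by (intro Min_le) auto
  have "faithful_net X V E k" if k: "k \<in> bayes_nets_eqb X V \<mu> K \<omega> E" "tv_circ X V (E, m) (E, k) \<le> \<epsilon>" for k
  proof -
    have kb: "k \<in> bayes_nets X V E" using k by (simp add: bayes_nets_eqb_iff)
    show ?thesis
      unfolding faithful_net_iff[OF E kb]
    proof (intro allI impI)
      fix A B C assume "A \<subseteq> V" "B \<subseteq> V" "C \<subseteq> V" "\<not> d_sep E A B C"
      hence \<tau>: "(A, B, C) \<in> T" by (auto simp: T_def triples_def)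
      have "\<forall>S\<in>sets (prod_space X V). \<bar>measure (obs_dist X V E m) S - measure (obs_dist X V E k) S\<bar> \<le> e (A, B, C)"
        using obs_dist_tv_circ[OF E mb kb] k(2) \<epsilon>e[OF \<tau>] by (meson order_trans)
      thus "\<not> cond_indep X (obs_dist X V E k) A B C"
        using e(2)[OF \<tau>] obs_dist_prob[OF E kb] unfolding good_def case_prod_conv by blast
    qed
  qed
  thus ?thesis using \<epsilon>0 by blast
qed

section \<open>Existence of consistent tests\<close>

text \<open>The separating events are the members of a cover of the product space. A distribution that no finite
  number of them separates from the hypothesis is a limit of elements of the hypothesis on all of them, hence in
  total variation, hence belongs to it.\<close>

lemma ex_consistent_ci_test:
  assumes ABC: "A \<subseteq> V" "B \<subseteq> V" "C \<subseteq> V"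
  shows "\<exists>\<phi>. consistent_ci_test X V (obs_dists_eqb X V \<mu> K \<omega>) A B C \<phi>"
proof -
  let ?P = "obs_dists_eqb X V \<mu> K \<omega>" and ?M = "prod_space X V"
  define H0 where "H0 = {P \<in> ?P. cond_indep X P A B C}"
  obtain \<C> where C: "fine_cover (Pi\<^sub>M V ref) (prod_dist_on X V) \<C>" using ex_cover_product[OF order_refl] by blast
  have ne: "\<C> \<noteq> {}"
    using space_prod_space_nonempty[OF order_refl] fine_coverD(3)[OF C _ zero_less_one] space_PiM_ref[OF order_refl] by blast
  define c where "c = from_nat_into \<C>"
  have rc: "range c = \<C>" unfolding c_def by (rule range_from_nat_into[OF ne fine_coverD(1)[OF C]])
  have cM: "c j \<in> sets ?M" for j using rc fine_coverD(2)[OF C] sets_PiM_ref[OF order_refl] by blast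
  have dens: "\<exists>f\<in>joints. P = density (Pi\<^sub>M V ref) (\<lambda>x. ennreal (f x)) \<and> (\<forall>x\<in>space (Pi\<^sub>M V ref). 0 \<le> f x)"
    and prob: "P \<in> space (prob_algebra ?M)" if P: "P \<in> ?P" for P
  proof -
    obtain E m where Em: "dag V E" "m \<in> bayes_nets_eqb X V \<mu> K \<omega> E" "P = obs_dist X V E m"
      using P by (auto simp: obs_dists_eqb_def BN_eqb_def)
    have mb: "m \<in> bayes_nets X V E" using Em(2) by (simp add: bayes_nets_eqb_iff)
    obtain p where p: "\<And>v. v \<in> V \<Longrightarrow> kernel_density E m v (p v)" using Em(2) unfolding bayes_nets_eqb_iff by metis
    show "P \<in> space (prob_algebra ?M)" unfolding Em(3) by (rule obs_dist_prob[OF Em(1) mb])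
    have "P = density (Pi\<^sub>M V ref) (\<lambda>x. ennreal (joint E p x))" "joint E p \<in> joints"
      "\<And>x. x \<in> space ?M \<Longrightarrow> 0 \<le> joint E p x"
      unfolding Em(3) by (rule obs_dist_density[OF Em(1) mb p]; assumption)+
    thus "\<exists>f\<in>joints. P = density (Pi\<^sub>M V ref) (\<lambda>x. ennreal (f x)) \<and> (\<forall>x\<in>space (Pi\<^sub>M V ref). 0 \<le> f x)"
      using space_PiM_ref[OF order_refl] by blast
  qed
  have pr: "prob_space P" "sets P = sets ?M" if "P \<in> ?P" for P using prob[OF that] by (auto simp: space_prob_algebra)
  have sep: "\<exists>N. \<exists>\<epsilon>>0. \<forall>Q\<in>H0. \<exists>j<N. \<epsilon> \<le> \<bar>measure P (c j) - measure Q (c j)\<bar>" if P: "P \<in> ?P" "P \<notin> H0" for P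
  proof (rule ccontr)
    assume neg: "\<not> ?thesis"
    have "\<exists>Q\<in>H0. \<forall>j<k. \<bar>measure P (c j) - measure Q (c j)\<bar> < 1 / real (Suc k)" for k
    proof -
      have "1 / real (Suc k) > 0" by simp
      with neg show ?thesis by (meson not_le)
    qed
    then obtain Q where Q: "\<And>k. Q k \<in> H0" "\<And>k j. j < k \<Longrightarrow> \<bar>measure P (c j) - measure (Q k) (c j)\<bar> < 1 / real (Suc k)" by metis
    have QP: "Q k \<in> ?P" for k using Q(1) by (simp add: H0_def)
    obtain f where f: "f \<in> joints" "P = density (Pi\<^sub>M V ref) (\<lambda>x. ennreal (f x))" "\<And>x. x \<in> space (Pi\<^sub>M V ref) \<Longrightarrow> 0 \<le> f x"
      using dens[OF P(1)] by blast
    have "\<forall>k. \<exists>g. g \<in> joints \<and> Q k = density (Pi\<^sub>M V ref) (\<lambda>x. ennreal (g x)) \<and> (\<forall>x\<in>space (Pi\<^sub>M V ref). 0 \<le> g x)"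
      using dens[OF QP] by blast
    then obtain g where g: "\<And>k. g k \<in> joints" "\<And>k. Q k = density (Pi\<^sub>M V ref) (\<lambda>x. ennreal (g k x))"
      "\<And>k x. x \<in> space (Pi\<^sub>M V ref) \<Longrightarrow> 0 \<le> g k x" by metis
    have lim: "(\<lambda>k. measure (Q k) D) \<longlonglongrightarrow> measure P D" if D: "D \<in> \<C>" for D
    proof -
      obtain j where j: "D = c j" using D rc by blast
      have "\<forall>\<^sub>F k in sequentially. norm (measure (Q k) D - measure P D) \<le> 1 / real (Suc k)"
      proof (rule eventually_sequentiallyI[of "Suc j"])
        fix k assume "Suc j \<le> k"
        hence "\<bar>measure P (c j) - measure (Q k) (c j)\<bar> < 1 / real (Suc k)" by (intro Q(2)) simp
        thus "norm (measure (Q k) D - measure P D) \<le> 1 / real (Suc k)" by (simp add: j abs_minus_commute)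
      qed
      hence "(\<lambda>k. measure (Q k) D - measure P D) \<longlonglongrightarrow> 0"
        by (rule Lim_null_comparison) (rule LIMSEQ_inverse_real_of_nat[unfolded inverse_eq_divide])
      thus ?thesis by (simp add: LIM_zero_iff)
    qed
    have "indep_given P (coord_algebra X V A) (coord_algebra X V B) (coord_algebra X V C)"
    proof (rule indep_given_tv_closed[OF pr(1)[OF P(1)]])
      fix \<epsilon> :: real assume "\<epsilon> > 0"
      have "\<exists>k. \<forall>S\<in>sets (Pi\<^sub>M V ref). \<bar>measure (density (Pi\<^sub>M V ref) (\<lambda>x. ennreal (f x))) S
          - measure (density (Pi\<^sub>M V ref) (\<lambda>x. ennreal (g k x))) S\<bar> \<le> \<epsilon>"
      proof (rule equicontinuous_densities_tv_limit[OF C _ f(1,3) _ g(1,3) _ _ \<open>\<epsilon> > 0\<close>])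
        show "equicontinuous_on (space (Pi\<^sub>M V ref)) (prod_dist_on X V) joints"
          using equicontinuous_joints space_PiM_ref[OF order_refl] by simp
        show "prob_space (density (Pi\<^sub>M V ref) (\<lambda>x. ennreal (f x)))" using pr(1)[OF P(1)] f(2) by simp
        show "prob_space (density (Pi\<^sub>M V ref) (\<lambda>x. ennreal (g k x)))" for k
          using pr(1)[OF QP[of k]] unfolding g(2)[of k] .
        show "(\<lambda>k. measure (density (Pi\<^sub>M V ref) (\<lambda>x. ennreal (g k x))) D)
            \<longlonglongrightarrow> measure (density (Pi\<^sub>M V ref) (\<lambda>x. ennreal (f x))) D" if "D \<in> \<C>" for D
          using lim[OF that] unfolding g(2) f(2) .
      qed
      then obtain k where k: "\<forall>S\<in>sets ?M. \<bar>measure P S - measure (Q k) S\<bar> \<le> \<epsilon>"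
        unfolding f(2)[symmetric] g(2)[symmetric] sets_PiM_ref[OF order_refl] by blast
      have "cond_indep X (Q k) A B C" using Q(1)[of k] by (simp add: H0_def)
      hence "indep_given (Q k) (coord_algebra X V A) (coord_algebra X V B) (coord_algebra X V C)"
        using cond_indep_iff_indep_given[OF pr(2)[OF QP] ABC(1,2)] by blast
      thus "\<exists>Q. prob_space Q \<and> sets Q = sets P \<and>
          indep_given Q (coord_algebra X V A) (coord_algebra X V B) (coord_algebra X V C) \<and>
          (\<forall>S\<in>sets P. \<bar>measure P S - measure Q S\<bar> \<le> \<epsilon>)"
        using k pr[OF QP[of k]] pr(2)[OF P(1)] by (intro exI[of _ "Q k"]) simp
    qed (intro subalgebra_coord_algebra ABC pr(2)[OF P(1)])+
    hence "cond_indep X P A B C" using cond_indep_iff_indep_given[OF pr(2)[OF P(1)] ABC(1,2)] by blast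
    thus False using P by (simp add: H0_def)
  qed
  have "\<exists>\<phi>. (\<forall>n. \<phi> n \<in> iid ?M n \<rightarrow>\<^sub>M count_space {0, 1 :: nat}) \<and>
    (\<forall>P\<in>?P. (P \<in> H0 \<longrightarrow> (\<lambda>n. measure (iid P n) {s \<in> space (iid P n). \<phi> n s = 0}) \<longlonglongrightarrow> 1) \<and>
      (P \<notin> H0 \<longrightarrow> (\<lambda>n. measure (iid P n) {s \<in> space (iid P n). \<phi> n s = 1}) \<longlonglongrightarrow> 1))"
    by (rule ex_consistent_test[of ?P ?M c H0]) (fact pr cM sep)+
  then obtain \<phi> :: "nat \<Rightarrow> (nat \<Rightarrow> 'v \<Rightarrow> 'x) \<Rightarrow> nat" where
    \<phi>1: "\<forall>n. \<phi> n \<in> iid ?M n \<rightarrow>\<^sub>M count_space {0, 1}" and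
    \<phi>2: "\<forall>P\<in>?P. (P \<in> H0 \<longrightarrow> (\<lambda>n. measure (iid P n) {s \<in> space (iid P n). \<phi> n s = 0}) \<longlonglongrightarrow> 1) \<and>
      (P \<notin> H0 \<longrightarrow> (\<lambda>n. measure (iid P n) {s \<in> space (iid P n). \<phi> n s = 1}) \<longlonglongrightarrow> 1)" by (elim exE conjE)
  have \<phi>: "\<And>n. \<phi> n \<in> iid ?M n \<rightarrow>\<^sub>M count_space {0, 1}"
    "\<And>P. P \<in> ?P \<Longrightarrow> P \<in> H0 \<Longrightarrow> (\<lambda>n. measure (iid P n) {s \<in> space (iid P n). \<phi> n s = 0}) \<longlonglongrightarrow> 1"
    "\<And>P. P \<in> ?P \<Longrightarrow> P \<notin> H0 \<Longrightarrow> (\<lambda>n. measure (iid P n) {s \<in> space (iid P n). \<phi> n s = 1}) \<longlonglongrightarrow> 1"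
    using \<phi>1 \<phi>2 by simp_all
  have excl: False if P: "P \<in> ?P" and l0: "(\<lambda>n. measure (iid P n) {s \<in> space (iid P n). \<phi> n s = 0}) \<longlonglongrightarrow> 1"
     and l1: "(\<lambda>n. measure (iid P n) {s \<in> space (iid P n). \<phi> n s = 1}) \<longlonglongrightarrow> 1" for P
  proof -
    have "measure (iid P n) {s \<in> space (iid P n). \<phi> n s = 0} + measure (iid P n) {s \<in> space (iid P n). \<phi> n s = 1} \<le> 1" for n
    proof -
      interpret prob_space "iid P n" by (rule prob_space_PiM) (rule pr(1)[OF P])
      have s: "sets (iid P n) = sets (iid ?M n)" by (rule sets_PiM_cong) (use pr(2)[OF P] in auto)
      have "\<phi> n \<in> iid P n \<rightarrow>\<^sub>M count_space {0, 1}" using \<phi>(1)[of n] measurable_cong_sets[OF s refl] by blast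
      hence "\<phi> n -` {b} \<inter> space (iid P n) \<in> sets (iid P n)" if "b \<in> {0, 1}" for b
        by (rule measurable_sets) (use that in auto)
      moreover have "\<phi> n -` {b} \<inter> space (iid P n) = {s \<in> space (iid P n). \<phi> n s = b}" for b by auto
      ultimately have "{s \<in> space (iid P n). \<phi> n s = b} \<in> sets (iid P n)" if "b \<in> {0, 1}" for b
        using that by metis
      hence "measure (iid P n) {s \<in> space (iid P n). \<phi> n s = 0} + measure (iid P n) {s \<in> space (iid P n). \<phi> n s = 1}
         = measure (iid P n) ({s \<in> space (iid P n). \<phi> n s = 0} \<union> {s \<in> space (iid P n). \<phi> n s = 1})"
        by (intro finite_measure_Union[symmetric]) auto
      thus ?thesis using prob_le_1 by simp
    qed
    with tendsto_add[OF l0 l1] have "1 + 1 \<le> (1 :: real)" by (intro LIMSEQ_le_const2) auto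
    thus False by simp
  qed
  have "consistent_ci_test X V ?P A B C \<phi>"
    unfolding consistent_ci_test_def
  proof (intro conjI allI ballI)
    fix P assume P: "P \<in> ?P"
    have H: "P \<in> H0 \<longleftrightarrow> cond_indep X P A B C" using P by (simp add: H0_def)
    show "(\<lambda>n. measure (iid P n) {s \<in> space (iid P n). \<phi> n s = 0}) \<longlonglongrightarrow> 1 \<longleftrightarrow> cond_indep X P A B C"
      using \<phi>(2,3)[OF P] excl[OF P] H by blast
    show "(\<lambda>n. measure (iid P n) {s \<in> space (iid P n). \<phi> n s = 1}) \<longlonglongrightarrow> 1 \<longleftrightarrow> \<not> cond_indep X P A B C"
      using \<phi>(2,3)[OF P] excl[OF P] H by blast
  qed (rule \<phi>(1))
  thus ?thesis by blast
qed

section \<open>Consistency of constraint-based algorithms\<close>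

lemma faithful_imp_consistent:
  fixes f :: "('v set \<times> 'v set \<times> 'v set) set \<Rightarrow> 'y"
  assumes sound: "sound_under_faithfulness X V f R"
    and tests: "\<And>A B C. A \<subseteq> V \<Longrightarrow> B \<subseteq> V \<Longrightarrow> C \<subseteq> V \<Longrightarrow>
       consistent_ci_test X V (obs_dists_eqb X V \<mu> K \<omega>) A B C (\<phi> A B C)"
    and E: "dag V E" and m: "m \<in> bayes_nets_eqb X V \<mu> K \<omega> E" "faithful_net X V E m"
  shows "consistent_at X V f R \<phi> E m"
proof -
  define P where "P = obs_dist X V E m"
  have mb: "m \<in> bayes_nets X V E" using m by (simp add: bayes_nets_eqb_iff)
  have P: "prob_space P" "sets P = sets (prod_space X V)"
    using obs_dist_prob[OF E mb] by (auto simp: P_def space_prob_algebra)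
  have PP: "P \<in> obs_dists_eqb X V \<mu> K \<omega>"
    unfolding obs_dists_eqb_def BN_eqb_def P_def using E m by (intro image_eqI[of _ _ "(E, m)"]) auto
  define d where "d = (\<lambda>(A, B, C). if cond_indep X P A B C then 0 else 1 :: nat)"
  define ev where "ev n \<tau> = {s \<in> space (iid P n). (case \<tau> of (A, B, C) \<Rightarrow> \<phi> A B C n s) = d \<tau>}" for n \<tau>
  have pr: "prob_space (iid P n)" for n by (rule prob_space_PiM) (rule P(1))
  have meas: "{s \<in> space (iid P n). (case \<tau> of (A, B, C) \<Rightarrow> \<phi> A B C n s) = b} \<in> sets (iid P n)"
    if \<tau>: "\<tau> \<in> triples V" and b: "b \<in> {0, 1}" for n \<tau> b
  proof -
    obtain A B C where e: "\<tau> = (A, B, C)" by (cases \<tau>)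
    have s: "sets (iid P n) = sets (iid (prod_space X V) n)" by (rule sets_PiM_cong) (use P(2) in auto)
    have "\<phi> A B C n \<in> iid (prod_space X V) n \<rightarrow>\<^sub>M count_space {0, 1}"
      using tests[of A B C] \<tau> by (auto simp: e triples_def consistent_ci_test_def)
    hence "\<phi> A B C n \<in> iid P n \<rightarrow>\<^sub>M count_space {0, 1}" using measurable_cong_sets[OF s refl] by blast
    from measurable_sets[OF this, of "{b}"] b
    have "\<phi> A B C n -` {b} \<inter> space (iid P n) \<in> sets (iid P n)" by auto
    moreover have "\<phi> A B C n -` {b} \<inter> space (iid P n) = {s \<in> space (iid P n). \<phi> A B C n s = b}" by auto
    ultimately show ?thesis by (simp add: e)
  qed
  have evm: "ev n \<tau> \<in> sets (iid P n)" if "\<tau> \<in> triples V" for n \<tau>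
    unfolding ev_def by (rule meas[OF that]) (auto simp: d_def split: prod.split)
  have lim: "(\<lambda>n. measure (iid P n) (ev n \<tau>)) \<longlonglongrightarrow> 1" if \<tau>: "\<tau> \<in> triples V" for \<tau>
  proof -
    obtain A B C where e: "\<tau> = (A, B, C)" by (cases \<tau>)
    have "consistent_ci_test X V (obs_dists_eqb X V \<mu> K \<omega>) A B C (\<phi> A B C)"
      by (rule tests) (use \<tau> in \<open>auto simp: e triples_def\<close>)
    thus ?thesis using PP unfolding consistent_ci_test_def ev_def d_def e by (auto split: if_splits)
  qed
  define target where "target n = {s \<in> space (iid P n). f {(A, B, C) \<in> triples V. \<phi> A B C n s = 0} \<in> R E}" for n
  have correct: "f {(A, B, C) \<in> triples V. cond_indep X P A B C} \<in> R E"
    using sound E m(2) unfolding sound_under_faithfulness_def faithful_net_def P_def by blast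
  have sub: "space (iid P n) - (\<Union>\<tau>\<in>triples V. space (iid P n) - ev n \<tau>) \<subseteq> target n" for n
  proof
    fix s assume "s \<in> space (iid P n) - (\<Union>\<tau>\<in>triples V. space (iid P n) - ev n \<tau>)"
    hence s: "s \<in> space (iid P n)" "\<And>\<tau>. \<tau> \<in> triples V \<Longrightarrow> s \<in> ev n \<tau>" by auto
    have "\<phi> A B C n s = 0 \<longleftrightarrow> cond_indep X P A B C" if "(A, B, C) \<in> triples V" for A B C
      using s(2)[OF that] by (simp add: ev_def d_def)
    hence "{(A, B, C) \<in> triples V. \<phi> A B C n s = 0} = {(A, B, C) \<in> triples V. cond_indep X P A B C}" by auto
    thus "s \<in> target n" using correct s(1) by (simp add: target_def)
  qed
  have tm: "target n \<in> sets (iid P n)" for n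
  proof -
    let ?z = "\<lambda>\<tau>. {s \<in> space (iid P n). (case \<tau> of (A, B, C) \<Rightarrow> \<phi> A B C n s) = 0}"
    let ?pat = "\<lambda>I. {s \<in> space (iid P n). \<forall>\<tau>\<in>triples V. (\<tau> \<in> I) = (s \<in> ?z \<tau>)}"
    have "target n = (\<Union>I\<in>{I \<in> Pow (triples V). f I \<in> R E}. ?pat I)"
    proof (intro equalityI subsetI)
      fix s assume s: "s \<in> target n"
      define I where "I = {(A, B, C) \<in> triples V. \<phi> A B C n s = 0}"
      have "I \<in> {I \<in> Pow (triples V). f I \<in> R E}" using s by (auto simp: target_def I_def)
      moreover have "s \<in> ?pat I" using s by (auto simp: target_def I_def)
      ultimately show "s \<in> (\<Union>I\<in>{I \<in> Pow (triples V). f I \<in> R E}. ?pat I)" by blast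
    next
      fix s assume "s \<in> (\<Union>I\<in>{I \<in> Pow (triples V). f I \<in> R E}. ?pat I)"
      then obtain I where I: "I \<subseteq> triples V" "f I \<in> R E" "s \<in> space (iid P n)"
        "\<forall>\<tau>\<in>triples V. (\<tau> \<in> I) = (s \<in> ?z \<tau>)" by blast
      have "\<tau> \<in> I \<longleftrightarrow> \<tau> \<in> {(A, B, C) \<in> triples V. \<phi> A B C n s = 0}" for \<tau>
        using I(1,3,4) by (cases \<tau>) auto
      hence "{(A, B, C) \<in> triples V. \<phi> A B C n s = 0} = I" by blast
      thus "s \<in> target n" using I by (simp add: target_def)
    qed
    moreover have "?pat I \<in> sets (iid P n)" for I
    proof (rule sets.sets_Collect_finite_All[OF _ finite_triples])
      fix \<tau> assume \<tau>: "\<tau> \<in> triples V"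
      have z: "?z \<tau> \<in> sets (iid P n)" by (rule meas[OF \<tau>]) simp
      have "{s \<in> space (iid P n). (\<tau> \<in> I) = (s \<in> ?z \<tau>)} = (if \<tau> \<in> I then ?z \<tau> else space (iid P n) - ?z \<tau>)" by auto
      thus "{s \<in> space (iid P n). (\<tau> \<in> I) = (s \<in> ?z \<tau>)} \<in> sets (iid P n)" using z by auto
    qed
    ultimately show ?thesis using finite_triples by (auto intro!: sets.finite_UN)
  qed
  have lower: "1 - (\<Sum>\<tau>\<in>triples V. 1 - measure (iid P n) (ev n \<tau>)) \<le> measure (iid P n) (target n)" for n
  proof -
    interpret prob_space "iid P n" by (rule pr)
    let ?B = "\<Union>\<tau>\<in>triples V. space (iid P n) - ev n \<tau>"
    have Bm: "?B \<in> sets (iid P n)" using finite_triples evm by (intro sets.finite_UN) auto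
    have "measure (iid P n) ?B \<le> (\<Sum>\<tau>\<in>triples V. measure (iid P n) (space (iid P n) - ev n \<tau>))"
      by (rule finite_measure_subadditive_finite) (use finite_triples evm in auto)
    also have "\<dots> = (\<Sum>\<tau>\<in>triples V. 1 - measure (iid P n) (ev n \<tau>))"
      by (rule sum.cong) (use evm prob_compl in auto)
    finally have "1 - (\<Sum>\<tau>\<in>triples V. 1 - measure (iid P n) (ev n \<tau>)) \<le> measure (iid P n) (space (iid P n) - ?B)"
      using prob_compl[OF Bm] by simp
    also have "\<dots> \<le> measure (iid P n) (target n)" by (rule finite_measure_mono[OF sub tm])
    finally show ?thesis .
  qed
  have "(\<lambda>n. measure (iid P n) (target n)) \<longlonglongrightarrow> 1"
  proof (rule tendsto_sandwich)
    show "\<forall>\<^sub>F n in sequentially. 1 - (\<Sum>\<tau>\<in>triples V. 1 - measure (iid P n) (ev n \<tau>)) \<le> measure (iid P n) (target n)"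
      using lower by simp
    show "\<forall>\<^sub>F n in sequentially. measure (iid P n) (target n) \<le> 1" using prob_space.prob_le_1[OF pr] by simp
    have "(\<lambda>n. 1 - (\<Sum>\<tau>\<in>triples V. 1 - measure (iid P n) (ev n \<tau>))) \<longlonglongrightarrow> 1 - (\<Sum>\<tau>\<in>triples V. 1 - 1)"
      by (intro tendsto_diff tendsto_const tendsto_sum lim)
    thus "(\<lambda>n. 1 - (\<Sum>\<tau>\<in>triples V. 1 - measure (iid P n) (ev n \<tau>))) \<longlonglongrightarrow> 1" by simp
  qed simp
  thus ?thesis unfolding consistent_at_def Let_def P_def[symmetric] target_def .
qed

definition faithful_nets :: "(('v \<times> 'v) set \<times> ('v, 'x) kernels) set" where
  "faithful_nets = {(E, m) \<in> BN_eqb X V \<mu> K \<omega>. faithful_net X V E m}"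

lemma tv_circ_nonneg:
  assumes g: "g \<in> BN_eqb X V \<mu> K \<omega>" and h: "h \<in> BN_eqb X V \<mu> K \<omega>"
  shows "0 \<le> tv_circ X V g h"
proof -
  have "0 \<le> (SUP x\<in>space (prod_space X V). tv_dist (snd g v (restrict x (parents (fst g) v))) (snd h v (restrict x (parents (fst h) v))))"
    if v: "v \<in> V" for v
  proof -
    obtain z where z: "z \<in> space (prod_space X V)" using space_prod_space_nonempty[OF order_refl] by blast
    have p: "prob_space (snd i v (restrict x (parents (fst i) v)))" if "i \<in> BN_eqb X V \<mu> K \<omega>" "x \<in> space (prod_space X V)" for i x
    proof -
      have i: "dag V (fst i)" "snd i \<in> bayes_nets X V (fst i)" using that(1) by (auto simp: BN_eqb_def bayes_nets_eqb_def)
      have "restrict x (parents (fst i) v) \<in> space (prod_space X (parents (fst i) v))"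
        by (rule restrict_in_space[OF _ that(2)]) (use dag_parents[OF i(1) v] in simp)
      from bayes_nets_kernel_space[OF i(2) v this] show ?thesis by (simp add: space_prob_algebra)
    qed
    have "bdd_above ((\<lambda>x. tv_dist (snd g v (restrict x (parents (fst g) v))) (snd h v (restrict x (parents (fst h) v)))) ` space (prod_space X V))"
      by (rule bdd_aboveI2[of _ _ 1], rule tv_dist_bounds(1)) (use p g h in auto)
    from cSUP_upper[OF z this] tv_dist_bounds(2)[OF p[OF g z] p[OF h z]] show ?thesis by linarith
  qed
  thus ?thesis unfolding tv_circ_def split_beta by (intro sum_nonneg)
qed

lemma faithful_nets_openin: "openin (BN_eqb_topology X V \<mu> K \<omega>) faithful_nets"
proof -
  let ?B = "BN_eqb X V \<mu> K \<omega>" and ?d = "BN_eqb_dist X V \<mu> K \<omega>"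
  interpret MS: Metric_space ?B ?d by (rule Metric_space_BN_eqb[OF fin pol])
  have "\<exists>r>0. MS.mball g r \<subseteq> faithful_nets" if g: "g \<in> faithful_nets" for g
  proof -
    obtain E m where Em: "g = (E, m)" "dag V E" "m \<in> bayes_nets_eqb X V \<mu> K \<omega> E" "faithful_net X V E m" "g \<in> ?B"
      using g by (auto simp: faithful_nets_def BN_eqb_def)
    obtain \<epsilon> where \<epsilon>: "\<epsilon> > 0" "\<And>k. k \<in> bayes_nets_eqb X V \<mu> K \<omega> E \<Longrightarrow> tv_circ X V (E, m) (E, k) \<le> \<epsilon> \<Longrightarrow> faithful_net X V E k"
      using faithful_open[OF Em(2-4)] by blast
    \<comment> \<open>Distances below 1 force equal graphs.\<close>
    have "MS.mball g (min 1 \<epsilon>) \<subseteq> faithful_nets"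
    proof
      fix h assume "h \<in> MS.mball g (min 1 \<epsilon>)"
      hence h: "h \<in> ?B" "?d g h < 1" "?d g h < \<epsilon>" by (auto simp: MS.in_mball)
      have d: "?d g h = (if fst g = fst h then 0 else 1) + tv_circ X V g h"
        using Em(5) h(1) by (simp add: BN_eqb_dist_def)
      have tv0: "0 \<le> tv_circ X V g h" by (rule tv_circ_nonneg[OF Em(5) h(1)])
      have E': "fst h = E" using d tv0 h(2) Em(1) by (auto split: if_splits)
      obtain k where k: "h = (E, k)" using E' by (cases h) auto
      have kb: "k \<in> bayes_nets_eqb X V \<mu> K \<omega> E" using h(1) by (simp add: k BN_eqb_def)
      have "tv_circ X V (E, m) (E, k) \<le> \<epsilon>" using d h(3) by (simp add: k Em(1))
      hence "faithful_net X V E k" by (rule \<epsilon>(2)[OF kb])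
      thus "h \<in> faithful_nets" using h(1) by (simp add: k faithful_nets_def)
    qed
    thus ?thesis using \<epsilon>(1) by (intro exI[of _ "min 1 \<epsilon>"]) simp
  qed
  moreover have "faithful_nets \<subseteq> ?B" by (auto simp: faithful_nets_def)
  ultimately show ?thesis unfolding BN_eqb_topology_def MS.openin_mtopology by blast
qed

lemma faithful_nets_dense:
  assumes ex: "\<forall>E. dag V E \<longrightarrow> (\<exists>m\<in>bayes_nets_eqb X V \<mu> K \<omega> E. faithful_net X V E m)"
  shows "BN_eqb_topology X V \<mu> K \<omega> closure_of faithful_nets = BN_eqb X V \<mu> K \<omega>"
proof -
  let ?B = "BN_eqb X V \<mu> K \<omega>" and ?d = "BN_eqb_dist X V \<mu> K \<omega>"
  interpret MS: Metric_space ?B ?d by (rule Metric_space_BN_eqb[OF fin pol])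
  have "\<exists>h\<in>faithful_nets. h \<in> MS.mball g r" if g: "g \<in> ?B" and r: "r > 0" for g r
  proof -
    obtain E m where Em: "g = (E, m)" "dag V E" "m \<in> bayes_nets_eqb X V \<mu> K \<omega> E" using g by (auto simp: BN_eqb_def)
    obtain k where k: "k \<in> bayes_nets_eqb X V \<mu> K \<omega> E" "faithful_net X V E k" using ex Em(2) by blast
    have "r / real (Suc (card V)) > 0" using r by simp
    from faithful_dense[OF Em(2,3) k this] obtain k' where k': "k' \<in> bayes_nets_eqb X V \<mu> K \<omega> E" "faithful_net X V E k'"
      "tv_circ X V (E, m) (E, k') \<le> real (card V) * (r / real (Suc (card V)))" by blast
    have B: "(E, k') \<in> ?B" using k'(1) Em(2) by (simp add: BN_eqb_def)
    have "real (card V) * (r / real (Suc (card V))) < r" using r by (simp add: field_simps)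
    hence "?d g (E, k') < r" using k'(3) g B by (simp add: BN_eqb_dist_def Em(1))
    hence "(E, k') \<in> MS.mball g r" using g B by (simp add: MS.in_mball)
    moreover have "(E, k') \<in> faithful_nets" using k'(2) B by (simp add: faithful_nets_def)
    ultimately show ?thesis by blast
  qed
  thus ?thesis unfolding BN_eqb_topology_def MS.metric_closure_of by blast
qed

end

theorem mainTheorem8:
  fixes V :: "'v set" and X :: "'v \<Rightarrow> 'x metric" and \<mu> :: "'v \<Rightarrow> 'x measure"
    and K :: real and \<omega> :: "real \<Rightarrow> real"
  assumes "finite V"
    and "\<forall>v\<in>V. polish_state_space (X v)"
    and "K > 0"
    and "modulus_of_continuity \<omega>"
    and "\<forall>v\<in>V. locally_finite_on (X v) (\<mu> v)"
    and "\<forall>E. dag V E \<longrightarrow> (\<exists>m\<in>bayes_nets_eqb X V \<mu> K \<omega> E. faithful_net X V E m)"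
  shows "(\<forall>A B C. A \<subseteq> V \<longrightarrow> B \<subseteq> V \<longrightarrow> C \<subseteq> V \<longrightarrow>
            (\<exists>\<phi>. consistent_ci_test X V (obs_dists_eqb X V \<mu> K \<omega>) A B C \<phi>)) \<and>
         (\<forall>(f :: ('v set \<times> 'v set \<times> 'v set) set \<Rightarrow> 'y) R \<phi>.
            sound_under_faithfulness X V f R \<longrightarrow>
            (\<forall>A B C. A \<subseteq> V \<longrightarrow> B \<subseteq> V \<longrightarrow> C \<subseteq> V \<longrightarrow>
               consistent_ci_test X V (obs_dists_eqb X V \<mu> K \<omega>) A B C (\<phi> A B C)) \<longrightarrow>
            (\<exists>U. openin (BN_eqb_topology X V \<mu> K \<omega>) U \<and>
                 (BN_eqb_topology X V \<mu> K \<omega>) closure_of U = BN_eqb X V \<mu> K \<omega> \<and>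
                 (\<forall>(E, m)\<in>U. consistent_at X V f R \<phi> E m)))"
proof -
  interpret eqb_setting V X \<mu> K \<omega> by (rule eqb_setting.intro) (use assms in auto)
  show ?thesis
  proof (intro conjI allI impI)
    fix A B C assume "A \<subseteq> V" "B \<subseteq> V" "C \<subseteq> V"
    thus "\<exists>\<phi>. consistent_ci_test X V (obs_dists_eqb X V \<mu> K \<omega>) A B C \<phi>"
      by (rule ex_consistent_ci_test)
  next
    fix f :: "('v set \<times> 'v set \<times> 'v set) set \<Rightarrow> 'y" and R \<phi>
    assume sound: "sound_under_faithfulness X V f R"
      and tests: "\<forall>A B C. A \<subseteq> V \<longrightarrow> B \<subseteq> V \<longrightarrow> C \<subseteq> V \<longrightarrow>
        consistent_ci_test X V (obs_dists_eqb X V \<mu> K \<omega>) A B C (\<phi> A B C)"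
    have "consistent_at X V f R \<phi> E m" if "(E, m) \<in> faithful_nets" for E m
    proof (rule faithful_imp_consistent[OF sound])
      show "consistent_ci_test X V (obs_dists_eqb X V \<mu> K \<omega>) A B C (\<phi> A B C)"
        if "A \<subseteq> V" "B \<subseteq> V" "C \<subseteq> V" for A B C using tests that by simp
      show "dag V E" "m \<in> bayes_nets_eqb X V \<mu> K \<omega> E" "faithful_net X V E m"
        using that by (simp_all add: faithful_nets_def BN_eqb_def)
    qed
    hence "\<forall>(E, m)\<in>faithful_nets. consistent_at X V f R \<phi> E m" by blast
    thus "\<exists>U. openin (BN_eqb_topology X V \<mu> K \<omega>) U \<and>
        (BN_eqb_topology X V \<mu> K \<omega>) closure_of U = BN_eqb X V \<mu> K \<omega> \<and>
        (\<forall>(E, m)\<in>U. consistent_at X V f R \<phi> E m)"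
      by (intro exI[of _ faithful_nets] conjI faithful_nets_openin faithful_nets_dense[OF assms(6)])
  qed
qed

end
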